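(* Let $\mathcal G=(V,E)$ be the graph with 4 vertices $V=\{1,2,3,4\}$ and 4 edges $E=\{\gamma_1,\gamma_2,\gamma_3,\gamma_4\}$, where $\gamma_1=(1,2)$, $\gamma_2=(2,1)$, $\gamma_3=(3,4)$ and $\gamma_4=(4,3)$. Then its quantum automorphism group $A_{aut}(\mathcal G)$ is a noncommutative infinite-dimensional $C^*$-algebra whose spectrum is the dihedral group $D_4$ (the dihedral group with 8 elements).
   Context: All algebras are complex and unital. A finite graph $\mathcal G=(V,E)$ consists of a finite set $V=\{1,\dots,n\}$ of vertices and a set $E=\{\gamma_1,\dots,\gamma_m\}\subset V\times V$ of edges; the source and target maps $s,t:E\to V$ are $s(i,k)=i$, $t(i,k)=k$. Let $A^o_{aut}(\mathcal G)$ be the universal complex algebra with generators $(X_{ij})_{1\le i,j\le n}$ and relations: (R1) $X_{ij}X_{ik}=\delta_{jk}X_{ij}$, $X_{ji}X_{ki}=\delta_{jk}X_{ji}$, $\sum_{l=1}^n X_{il}=1=\sum_{l=1}^n X_{li}$, for $1\le i,j,k\le n$; (R2) $X_{s(\gamma_j)i}X_{t(\gamma_j)k}=X_{t(\gamma_j)k}X_{s(\gamma_j)i}=0$ and $X_{is(\gamma_j)}X_{kt(\gamma_j)}=X_{kt(\gamma_j)}X_{is(\gamma_j)}=0$, for $\gamma_j\in E$ and $(i,k)\in V\times V$ with $(i,k)\notin E$; (R3) $X_{s(\gamma_j)s(\gamma_l)}X_{t(\gamma_j)t(\gamma_l)}=X_{t(\gamma_j)t(\gamma_l)}X_{s(\gamma_j)s(\gamma_l)}$,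 for $\gamma_j,\gamma_l\in E$; (R4) $\sum_{l=1}^m X_{s(\gamma_l)s(\gamma_j)}X_{t(\gamma_l)t(\gamma_j)}=1=\sum_{l=1}^m X_{s(\gamma_j)s(\gamma_l)}X_{t(\gamma_j)t(\gamma_l)}$, for $\gamma_j\in E$. It is a Hopf $*$-algebra with $X_{ij}^*=X_{ij}$, $\Delta(X_{ij})=\sum_k X_{ik}\otimes X_{kj}$, $\varepsilon(X_{ij})=\delta_{ij}$, $S(X_{ij})=X_{ji}$, and the supremum of all $C^*$-seminorms on it exists and is a $C^*$-norm. The quantum automorphism group $A_{aut}(\mathcal G)$ is the enveloping $C^*$-algebra of $A^o_{aut}(\mathcal G)$, i.e. its completion for this norm, with the coproduct $\Delta:A_{aut}(\mathcal G)\to A_{aut}(\mathcal G)\otimes A_{aut}(\mathcal G)$ extending the one above. The spectrum of $A_{aut}(\mathcal G)$ is the set of (unital) $*$-homomorphisms $A_{aut}(\mathcal G)\to\mathbb C$, with the convolution product $\chi\cdot\chi'=(\chi\otimes\chi')\circ\Delta$; the statement about the spectrum is up to isomorphism of groups. *)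

theory Defs
  imports
    Complex_Main
    "Graph_Theory.Pair_Digraph"
    "HOL-Library.Poly_Mapping"
    "HOL-Library.FuncSet"
    "HOL-Algebra.Group"
    "HOL-Algebra.Ring"
    "HOL-Algebra.QuotRing"
    "HOL-Algebra.Module"
begin

section \<open>Complex *-algebras and C*-algebras\<close>

record 'a star_algebra = "(complex, 'a) module" +
  star :: "'a \<Rightarrow> 'a"

record 'a normed_star_algebra = "'a star_algebra" +
  alg_norm :: "'a \<Rightarrow> real"

definition complex_numbers :: "complex star_algebra" where
  "complex_numbers =
    \<lparr>carrier = UNIV, mult = (*), one = 1, zero = 0, add = (+), smult = (*), star = cnj\<rparr>"

text \<open>
  The locale \<open>algebra\<close> of HOL-Algebra demands a commutative multiplication, so algebras are
  described by \<open>ring\<close> and \<open>module\<close>. All algebras are unital.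
\<close>

locale complex_star_algebra =
  fixes A :: "('a, 'm) star_algebra_scheme" (structure)
  assumes is_ring: "ring A"
    and is_module: "Module.module complex_numbers A"
    and smult_mult_left: "\<lbrakk>x \<in> carrier A; y \<in> carrier A\<rbrakk> \<Longrightarrow> (c \<odot> x) \<otimes> y = c \<odot> (x \<otimes> y)"
    and smult_mult_right: "\<lbrakk>x \<in> carrier A; y \<in> carrier A\<rbrakk> \<Longrightarrow> x \<otimes> (c \<odot> y) = c \<odot> (x \<otimes> y)"
    and star_closed: "x \<in> carrier A \<Longrightarrow> star A x \<in> carrier A"
    and star_star: "x \<in> carrier A \<Longrightarrow> star A (star A x) = x"
    and star_add: "\<lbrakk>x \<in> carrier A; y \<in> carrier A\<rbrakk> \<Longrightarrow> star A (x \<oplus> y) = star A x \<oplus> star A y"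
    and star_mult: "\<lbrakk>x \<in> carrier A; y \<in> carrier A\<rbrakk> \<Longrightarrow> star A (x \<otimes> y) = star A y \<otimes> star A x"
    and star_smult: "x \<in> carrier A \<Longrightarrow> star A (c \<odot> x) = cnj c \<odot> star A x"

locale cstar_algebra = complex_star_algebra A
  for A :: "('a, 'm) normed_star_algebra_scheme" (structure) +
  assumes norm_nonneg: "x \<in> carrier A \<Longrightarrow> 0 \<le> alg_norm A x"
    and norm_eq_zero: "x \<in> carrier A \<Longrightarrow> alg_norm A x = 0 \<longleftrightarrow> x = \<zero>"
    and norm_add: "\<lbrakk>x \<in> carrier A; y \<in> carrier A\<rbrakk> \<Longrightarrow> alg_norm A (x \<oplus> y) \<le> alg_norm A x + alg_norm A y"
    and norm_smult: "x \<in> carrier A \<Longrightarrow> alg_norm A (c \<odot> x) = cmod c * alg_norm A x"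
    and norm_mult: "\<lbrakk>x \<in> carrier A; y \<in> carrier A\<rbrakk> \<Longrightarrow> alg_norm A (x \<otimes> y) \<le> alg_norm A x * alg_norm A y"
    and cstar_identity: "x \<in> carrier A \<Longrightarrow> alg_norm A (star A x \<otimes> x) = (alg_norm A x)\<^sup>2"
    and complete:
      "\<lbrakk>\<And>n. u n \<in> carrier A; \<forall>e>0. \<exists>N. \<forall>m\<ge>N. \<forall>n\<ge>N. alg_norm A (u m \<ominus> u n) < e\<rbrakk>
        \<Longrightarrow> \<exists>x\<in>carrier A. (\<lambda>n. alg_norm A (u n \<ominus> x)) \<longlonglongrightarrow> 0"

text \<open>\<^const>\<open>ring_hom\<close> already asks for the preservation of the unit.\<close>

definition star_hom ::
    "('a, 'm) star_algebra_scheme \<Rightarrow> ('b, 'n) star_algebra_scheme \<Rightarrow> ('a \<Rightarrow> 'b) set" where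
  "star_hom A B = {h \<in> ring_hom A B. \<forall>x\<in>carrier A.
     (\<forall>c. h (c \<odot>\<^bsub>A\<^esub> x) = c \<odot>\<^bsub>B\<^esub> h x) \<and> h (star A x) = star B (h x)}"

definition noncommutative :: "('a, 'm) ring_scheme \<Rightarrow> bool" where
  "noncommutative A \<longleftrightarrow> (\<exists>x\<in>carrier A. \<exists>y\<in>carrier A. x \<otimes>\<^bsub>A\<^esub> y \<noteq> y \<otimes>\<^bsub>A\<^esub> x)"

definition finite_dimensional :: "('a, 'm) star_algebra_scheme \<Rightarrow> bool" where
  "finite_dimensional A \<longleftrightarrow> (\<exists>S. finite S \<and> S \<subseteq> carrier A \<and>
     (\<forall>x\<in>carrier A. \<exists>c :: 'a \<Rightarrow> complex. x = (\<Oplus>\<^bsub>A\<^esub>s\<in>S. c s \<odot>\<^bsub>A\<^esub> s)))"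


section \<open>Algebras given by generators and relations\<close>

text \<open>
  The complex algebra of a monoid \<open>M\<close>, with the antilinear extension of an involution \<open>s\<close> of \<open>M\<close>.
\<close>

definition monoid_star_algebra ::
    "('a, 'm) monoid_scheme \<Rightarrow> ('a \<Rightarrow> 'a) \<Rightarrow> ('a \<Rightarrow>\<^sub>0 complex) star_algebra" where
  "monoid_star_algebra M s =
    \<lparr>carrier = {f. Poly_Mapping.keys f \<subseteq> carrier M},
     mult = (\<lambda>f g. \<Sum>x\<in>Poly_Mapping.keys f. \<Sum>y\<in>Poly_Mapping.keys g.
       Poly_Mapping.single (x \<otimes>\<^bsub>M\<^esub> y) (Poly_Mapping.lookup f x * Poly_Mapping.lookup g y)),
     one = Poly_Mapping.single \<one>\<^bsub>M\<^esub> 1,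
     zero = 0,
     add = (+),
     smult = (\<lambda>c f. Poly_Mapping.map ((*) c) f),
     star = (\<lambda>f. \<Sum>x\<in>Poly_Mapping.keys f. Poly_Mapping.single (s x) (cnj (Poly_Mapping.lookup f x)))\<rparr>"

definition word_monoid :: "'g set \<Rightarrow> 'g list monoid" where
  "word_monoid S = \<lparr>carrier = lists S, mult = (@), one = []\<rparr>"

text \<open>Reversing words makes every generator self-adjoint.\<close>

definition free_star_algebra :: "'g set \<Rightarrow> ('g list \<Rightarrow>\<^sub>0 complex) star_algebra" where
  "free_star_algebra S = monoid_star_algebra (word_monoid S) rev"

definition quotient_star_algebra ::
    "('a, 'm) star_algebra_scheme \<Rightarrow> 'a set \<Rightarrow> 'a set star_algebra" where
  "quotient_star_algebra A I =
    \<lparr>carrier = carrier (A Quot I), mult = mult (A Quot I), one = one (A Quot I),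
     zero = zero (A Quot I), add = add (A Quot I),
     smult = (\<lambda>c X. \<Union>x\<in>X. I +>\<^bsub>A\<^esub> (c \<odot>\<^bsub>A\<^esub> x)),
     star = (\<lambda>X. \<Union>x\<in>X. I +>\<^bsub>A\<^esub> star A x)\<rparr>"


section \<open>Completions and enveloping C*-algebras\<close>

text \<open>
  The separated completion for a seminorm \<open>p\<close>: Cauchy sequences modulo null sequences. If \<open>p\<close> is
  a norm, this is the usual completion.
\<close>

definition cauchy_algebra ::
    "('a, 'm) star_algebra_scheme \<Rightarrow> ('a \<Rightarrow> real) \<Rightarrow> (nat \<Rightarrow> 'a) star_algebra" where
  "cauchy_algebra A p =
    \<lparr>carrier = {u. (\<forall>n. u n \<in> carrier A) \<and>
       (\<forall>e>0. \<exists>N. \<forall>m\<ge>N. \<forall>n\<ge>N. p (u m \<ominus>\<^bsub>A\<^esub> u n) < e)},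
     mult = (\<lambda>u v n. u n \<otimes>\<^bsub>A\<^esub> v n),
     one = (\<lambda>n. \<one>\<^bsub>A\<^esub>),
     zero = (\<lambda>n. \<zero>\<^bsub>A\<^esub>),
     add = (\<lambda>u v n. u n \<oplus>\<^bsub>A\<^esub> v n),
     smult = (\<lambda>c u n. c \<odot>\<^bsub>A\<^esub> u n),
     star = (\<lambda>u n. star A (u n))\<rparr>"

definition null_sequences ::
    "('a, 'm) star_algebra_scheme \<Rightarrow> ('a \<Rightarrow> real) \<Rightarrow> (nat \<Rightarrow> 'a) set" where
  "null_sequences A p = {u. (\<forall>n. u n \<in> carrier A) \<and> (\<lambda>n. p (u n)) \<longlonglongrightarrow> 0}"

definition completion ::
    "('a, 'm) star_algebra_scheme \<Rightarrow> ('a \<Rightarrow> real) \<Rightarrow> (nat \<Rightarrow> 'a) set normed_star_algebra" where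
  "completion A p = star_algebra.extend
     (quotient_star_algebra (cauchy_algebra A p) (null_sequences A p))
     (normed_star_algebra.fields (\<lambda>U. THE r. \<exists>u\<in>U. (\<lambda>n. p (u n)) \<longlonglongrightarrow> r))"

definition to_completion ::
    "('a, 'm) star_algebra_scheme \<Rightarrow> ('a \<Rightarrow> real) \<Rightarrow> 'a \<Rightarrow> (nat \<Rightarrow> 'a) set" where
  "to_completion A p a = null_sequences A p +>\<^bsub>cauchy_algebra A p\<^esub> (\<lambda>n. a)"

definition cstar_seminorm :: "('a, 'm) star_algebra_scheme \<Rightarrow> ('a \<Rightarrow> real) \<Rightarrow> bool" where
  "cstar_seminorm A p \<longleftrightarrow>
     (\<forall>x\<in>carrier A. 0 \<le> p x \<and> p (star A x \<otimes>\<^bsub>A\<^esub> x) = (p x)\<^sup>2 \<and>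
        (\<forall>c. p (c \<odot>\<^bsub>A\<^esub> x) = cmod c * p x) \<and>
        (\<forall>y\<in>carrier A. p (x \<oplus>\<^bsub>A\<^esub> y) \<le> p x + p y \<and> p (x \<otimes>\<^bsub>A\<^esub> y) \<le> p x * p y))"

definition universal_norm :: "('a, 'm) star_algebra_scheme \<Rightarrow> 'a \<Rightarrow> real" where
  "universal_norm A a = (SUP p\<in>{p. cstar_seminorm A p}. p a)"

definition cstar_envelope ::
    "('a, 'm) star_algebra_scheme \<Rightarrow> (nat \<Rightarrow> 'a) set normed_star_algebra" where
  "cstar_envelope A = completion A (universal_norm A)"


section \<open>Tensor products\<close>

text \<open>
  The algebraic tensor product is the free vector space on pairs modulo the bilinearity relations.
  The free vector space carries the product \<open>(a, b) (a', b') = (a a', b b')\<close>, for which the linear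
  span of the bilinearity relations is already the two-sided ideal they generate.
\<close>

definition pair_algebra ::
    "('a, 'm) star_algebra_scheme \<Rightarrow> ('b, 'n) star_algebra_scheme
      \<Rightarrow> ('a \<times> 'b \<Rightarrow>\<^sub>0 complex) star_algebra" where
  "pair_algebra A B = monoid_star_algebra (A \<times>\<times> B) (\<lambda>(a, b). (star A a, star B b))"

definition bilinear_relations ::
    "('a, 'm) star_algebra_scheme \<Rightarrow> ('b, 'n) star_algebra_scheme
      \<Rightarrow> ('a \<times> 'b \<Rightarrow>\<^sub>0 complex) set" where
  "bilinear_relations A B =
     (let e = (\<lambda>a b. Poly_Mapping.single (a, b) (1 :: complex)) in
      {e (a \<oplus>\<^bsub>A\<^esub> a') b - (e a b + e a' b) | a a' b.
         a \<in> carrier A \<and> a' \<in> carrier A \<and> b \<in> carrier B} \<union>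
      {e a (b \<oplus>\<^bsub>B\<^esub> b') - (e a b + e a b') | a b b'.
         a \<in> carrier A \<and> b \<in> carrier B \<and> b' \<in> carrier B} \<union>
      {e (c \<odot>\<^bsub>A\<^esub> a) b - Poly_Mapping.single (a, b) c | c a b.
         a \<in> carrier A \<and> b \<in> carrier B} \<union>
      {e a (c \<odot>\<^bsub>B\<^esub> b) - Poly_Mapping.single (a, b) c | c a b.
         a \<in> carrier A \<and> b \<in> carrier B})"

definition tensor_ideal ::
    "('a, 'm) star_algebra_scheme \<Rightarrow> ('b, 'n) star_algebra_scheme
      \<Rightarrow> ('a \<times> 'b \<Rightarrow>\<^sub>0 complex) set" where
  "tensor_ideal A B = Idl\<^bsub>pair_algebra A B\<^esub> (bilinear_relations A B)"

definition algebraic_tensor ::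
    "('a, 'm) star_algebra_scheme \<Rightarrow> ('b, 'n) star_algebra_scheme
      \<Rightarrow> ('a \<times> 'b \<Rightarrow>\<^sub>0 complex) set star_algebra" where
  "algebraic_tensor A B = quotient_star_algebra (pair_algebra A B) (tensor_ideal A B)"

definition algebraic_elem ::
    "('a, 'm) star_algebra_scheme \<Rightarrow> ('b, 'n) star_algebra_scheme
      \<Rightarrow> 'a \<Rightarrow> 'b \<Rightarrow> ('a \<times> 'b \<Rightarrow>\<^sub>0 complex) set" where
  "algebraic_elem A B a b =
     tensor_ideal A B +>\<^bsub>pair_algebra A B\<^esub> Poly_Mapping.single (a, b) 1"

text \<open>
  The C*-tensor product is the maximal one, the completion for the supremum of all C*-seminorms.
  The cross condition below holds for every C*-seminorm on the algebraic tensor product of two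
  C*-algebras; including it makes the boundedness of the supremum evident.
\<close>

definition max_tensor_norm ::
    "('a, 'm) normed_star_algebra_scheme \<Rightarrow> ('b, 'n) normed_star_algebra_scheme
      \<Rightarrow> ('a \<times> 'b \<Rightarrow>\<^sub>0 complex) set \<Rightarrow> real" where
  "max_tensor_norm A B z =
     (SUP p\<in>{p. cstar_seminorm (algebraic_tensor A B) p \<and>
        (\<forall>a\<in>carrier A. \<forall>b\<in>carrier B.
          p (algebraic_elem A B a b) \<le> alg_norm A a * alg_norm B b)}. p z)"

definition cstar_tensor ::
    "('a, 'm) normed_star_algebra_scheme \<Rightarrow> ('b, 'n) normed_star_algebra_scheme
      \<Rightarrow> (nat \<Rightarrow> ('a \<times> 'b \<Rightarrow>\<^sub>0 complex) set) set normed_star_algebra" where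
  "cstar_tensor A B = completion (algebraic_tensor A B) (max_tensor_norm A B)"

definition tensor_elem ::
    "('a, 'm) normed_star_algebra_scheme \<Rightarrow> ('b, 'n) normed_star_algebra_scheme
      \<Rightarrow> 'a \<Rightarrow> 'b \<Rightarrow> (nat \<Rightarrow> ('a \<times> 'b \<Rightarrow>\<^sub>0 complex) set) set" where
  "tensor_elem A B a b =
     to_completion (algebraic_tensor A B) (max_tensor_norm A B) (algebraic_elem A B a b)"


section \<open>Characters\<close>

definition characters :: "('a, 'm) star_algebra_scheme \<Rightarrow> ('a \<Rightarrow> complex) set" where
  "characters A = star_hom A complex_numbers \<inter> extensional (carrier A)"

definition tensor_character ::
    "('a, 'm) normed_star_algebra_scheme \<Rightarrow> ('b, 'n) normed_star_algebra_scheme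
      \<Rightarrow> ('a \<Rightarrow> complex) \<Rightarrow> ('b \<Rightarrow> complex)
      \<Rightarrow> (nat \<Rightarrow> ('a \<times> 'b \<Rightarrow>\<^sub>0 complex) set) set \<Rightarrow> complex" where
  "tensor_character A B \<chi> \<chi>' = (THE \<omega>. \<omega> \<in> characters (cstar_tensor A B) \<and>
     (\<forall>a\<in>carrier A. \<forall>b\<in>carrier B. \<omega> (tensor_elem A B a b) = \<chi> a * \<chi>' b))"


section \<open>The quantum automorphism group of a finite graph\<close>

abbreviation aut_free ::
    "'v pair_pre_digraph \<Rightarrow> (('v \<times> 'v) list \<Rightarrow>\<^sub>0 complex) star_algebra" where
  "aut_free G \<equiv> free_star_algebra (pverts G \<times> pverts G)"

text \<open>
  A relation \<open>a = b\<close> is encoded by \<open>a - b\<close>; the source and target of an edge are its two components.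
\<close>

definition aut_relations :: "'v pair_pre_digraph \<Rightarrow> (('v \<times> 'v) list \<Rightarrow>\<^sub>0 complex) set" where
  "aut_relations G =
    (let V = pverts G; E = parcs G;
         X = (\<lambda>i j. Poly_Mapping.single [(i, j)] (1 :: complex));
         mul = mult (aut_free G); I = one (aut_free G) in
     {mul (X i j) (X i k) - (if j = k then X i j else 0) | i j k. i \<in> V \<and> j \<in> V \<and> k \<in> V} \<union>
     {mul (X j i) (X k i) - (if j = k then X j i else 0) | i j k. i \<in> V \<and> j \<in> V \<and> k \<in> V} \<union>
     {(\<Sum>l\<in>V. X i l) - I | i. i \<in> V} \<union>
     {(\<Sum>l\<in>V. X l i) - I | i. i \<in> V} \<union>
     {mul (X (fst g) i) (X (snd g) k) | g i k. g \<in> E \<and> (i, k) \<in> V \<times> V - E} \<union>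
     {mul (X (snd g) k) (X (fst g) i) | g i k. g \<in> E \<and> (i, k) \<in> V \<times> V - E} \<union>
     {mul (X i (fst g)) (X k (snd g)) | g i k. g \<in> E \<and> (i, k) \<in> V \<times> V - E} \<union>
     {mul (X k (snd g)) (X i (fst g)) | g i k. g \<in> E \<and> (i, k) \<in> V \<times> V - E} \<union>
     {mul (X (fst g) (fst h)) (X (snd g) (snd h)) - mul (X (snd g) (snd h)) (X (fst g) (fst h))
       | g h. g \<in> E \<and> h \<in> E} \<union>
     {(\<Sum>h\<in>E. mul (X (fst h) (fst g)) (X (snd h) (snd g))) - I | g. g \<in> E} \<union>
     {(\<Sum>h\<in>E. mul (X (fst g) (fst h)) (X (snd g) (snd h))) - I | g. g \<in> E})"

definition aut_ideal :: "'v pair_pre_digraph \<Rightarrow> (('v \<times> 'v) list \<Rightarrow>\<^sub>0 complex) set" where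
  "aut_ideal G = Idl\<^bsub>aut_free G\<^esub> (aut_relations G)"

definition aut_algebra0 ::
    "'v pair_pre_digraph \<Rightarrow> (('v \<times> 'v) list \<Rightarrow>\<^sub>0 complex) set star_algebra" where
  "aut_algebra0 G = quotient_star_algebra (aut_free G) (aut_ideal G)"

type_synonym 'v aut_elem = "(nat \<Rightarrow> (('v \<times> 'v) list \<Rightarrow>\<^sub>0 complex) set) set"

definition aut_algebra :: "'v pair_pre_digraph \<Rightarrow> 'v aut_elem normed_star_algebra" where
  "aut_algebra G = cstar_envelope (aut_algebra0 G)"

definition aut_gen :: "'v pair_pre_digraph \<Rightarrow> 'v \<Rightarrow> 'v \<Rightarrow> 'v aut_elem" where
  "aut_gen G i j = to_completion (aut_algebra0 G) (universal_norm (aut_algebra0 G))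
     (aut_ideal G +>\<^bsub>aut_free G\<^esub> Poly_Mapping.single [(i, j)] 1)"

abbreviation aut_tensor where
  "aut_tensor G \<equiv> cstar_tensor (aut_algebra G) (aut_algebra G)"

text \<open>
  The extension by continuity of the coproduct on the generators. Boundedness is automatic for
  *-homomorphisms between C*-algebras.
\<close>

definition aut_coproduct ::
    "'v pair_pre_digraph \<Rightarrow> 'v aut_elem
      \<Rightarrow> (nat \<Rightarrow> ('v aut_elem \<times> 'v aut_elem \<Rightarrow>\<^sub>0 complex) set) set" where
  "aut_coproduct G = (THE D.
     D \<in> star_hom (aut_algebra G) (aut_tensor G) \<inter> extensional (carrier (aut_algebra G)) \<and>
     (\<exists>C. \<forall>a\<in>carrier (aut_algebra G). alg_norm (aut_tensor G) (D a) \<le> C * alg_norm (aut_algebra G) a) \<and>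
     (\<forall>i\<in>pverts G. \<forall>j\<in>pverts G. D (aut_gen G i j) =
       (\<Oplus>\<^bsub>aut_tensor G\<^esub>k\<in>pverts G.
          tensor_elem (aut_algebra G) (aut_algebra G) (aut_gen G i k) (aut_gen G k j))))"

definition aut_counit :: "'v pair_pre_digraph \<Rightarrow> 'v aut_elem \<Rightarrow> complex" where
  "aut_counit G = (THE \<epsilon>. \<epsilon> \<in> characters (aut_algebra G) \<and>
     (\<forall>i\<in>pverts G. \<forall>j\<in>pverts G. \<epsilon> (aut_gen G i j) = (if i = j then 1 else 0)))"

definition aut_spectrum :: "'v pair_pre_digraph \<Rightarrow> ('v aut_elem \<Rightarrow> complex) monoid" where
  "aut_spectrum G =
    \<lparr>carrier = characters (aut_algebra G),
     mult = (\<lambda>\<chi> \<chi>'. compose (carrier (aut_algebra G))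
       (tensor_character (aut_algebra G) (aut_algebra G) \<chi> \<chi>') (aut_coproduct G)),
     one = aut_counit G\<rparr>"


section \<open>Dihedral groups\<close>

text \<open>
  The pair \<open>(a, e)\<close> stands for \<open>r ^ a s ^ e\<close>, where \<open>r ^ n = s ^ 2 = 1\<close> and \<open>s r = r ^ (-1) s\<close>;
  this group has \<open>2 n\<close> elements.
\<close>

definition dihedral_group :: "nat \<Rightarrow> (int \<times> bool) monoid" where
  "dihedral_group n =
    \<lparr>carrier = {0..<int n} \<times> UNIV,
     mult = (\<lambda>(a, e) (b, f). ((if e then a - b else a + b) mod int n, e \<noteq> f)),
     one = (0, False)\<rparr>"

end

theory Submission
  imports Defs "HOL-Analysis.Bounded_Linear_Function" "HOL-Library.Function_Algebras"
begin

text \<open>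
  Let \<open>\<sigma>\<close> be the involution that exchanges the ends of each edge. Relations (R1)--(R4) say that \<open>X\<close> is a
  matrix of projections whose rows and columns are partitions of unity, and that
  \<open>X (\<sigma> i) (\<sigma> j) = X i j\<close>. Homomorphisms from \<open>A\<^sub>a\<^sub>u\<^sub>t\<close> to a C*-algebra therefore correspond to such
  matrices with entries there. The matrices \<open>\<Sum>\<^sub>k X i k \<otimes> X k j\<close> give the coproduct. Complex matrices of
  this kind are the permutation matrices commuting with \<open>\<sigma>\<close>, that is, the symmetries of the square
  whose opposite corners are the two edges. Finally, two projections \<open>p\<close>, \<open>q\<close> on the plane give a
  matrix with diagonal blocks \<open>(p, 1 - p; 1 - p, p)\<close> and \<open>(q, 1 - q; 1 - q, q)\<close>; letting the angle
  between \<open>p\<close> and \<open>q\<close> vary shows that \<open>A\<^sub>a\<^sub>u\<^sub>t\<close> is noncommutative and of infinite dimension.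

  A character of a C*-algebra is contractive by a Neumann series argument, and so it is determined by
  its restriction to a dense subalgebra.
\<close>

section \<open>*-algebras and their homomorphisms\<close>

text \<open>\<open>aut_coproduct\<close>, \<open>aut_counit\<close> and
  \<open>tensor_character\<close> are definite descriptions, so nothing can be computed in the
  spectrum before existence and uniqueness are proved for each. Existence needs maps out of
  completions: the pullback of a C*-norm is one of the seminorms in the supremum that defines the
  completing norm, so homomorphisms given on generators are contractive and extend. That supremum is
  finite because a C*-seminorm takes only the values 0 and 1 on a projection, hence is at most 1 on
  every word in the generators. Uniqueness is density; as characters are not assumed bounded, it
  rests on their automatic contractivity. The symmetry of X comes from (R2): multiplying
  \<open>X i j\<close> by the sum of row \<open>\<sigma> i\<close> leaves only the product of
  \<open>X i j\<close> and \<open>X (\<sigma> i) (\<sigma> j)\<close>, and likewise from the other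
  side. For infinite dimension, the powers of one element are seen through representations with
  different angles; they give power sequences, which are independent because a nonzero polynomial
  has finitely many roots.\<close>

lemma complex_numbers_simps [simp]:
  "carrier complex_numbers = UNIV" "mult complex_numbers = (*)" "one complex_numbers = 1"
  "zero complex_numbers = 0" "add complex_numbers = (+)" "smult complex_numbers = (*)"
  "star complex_numbers = cnj"
  by (simp_all add: complex_numbers_def)

lemma cring_complex_numbers: "cring complex_numbers"
proof (rule cringI)
  show "abelian_group complex_numbers"
    by (rule abelian_groupI) (auto intro: exI[of _ "- x" for x])
  show "Group.comm_monoid complex_numbers"
    by (rule comm_monoidI) auto
qed (simp add: distrib_right)

text \<open>Additive inverses are prescribed as \<open>(-1) \<odot> x\<close>, so that every axiom
  of ring, module and involution becomes an equation or a closure condition. The algebras below are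
  built through this list, or as images of such algebras.\<close>

lemma complex_star_algebraI:
  fixes A (structure)
  assumes add_closed: "\<And>x y. \<lbrakk>x \<in> carrier A; y \<in> carrier A\<rbrakk> \<Longrightarrow> x \<oplus> y \<in> carrier A"
    and zero_closed: "\<zero> \<in> carrier A"
    and add_assoc: "\<And>x y z. \<lbrakk>x \<in> carrier A; y \<in> carrier A; z \<in> carrier A\<rbrakk> \<Longrightarrow> (x \<oplus> y) \<oplus> z = x \<oplus> (y \<oplus> z)"
    and add_comm: "\<And>x y. \<lbrakk>x \<in> carrier A; y \<in> carrier A\<rbrakk> \<Longrightarrow> x \<oplus> y = y \<oplus> x"
    and zero_add: "\<And>x. x \<in> carrier A \<Longrightarrow> \<zero> \<oplus> x = x"
    and neg_add: "\<And>x. x \<in> carrier A \<Longrightarrow> (-1) \<odot> x \<oplus> x = \<zero>"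
    and mult_closed: "\<And>x y. \<lbrakk>x \<in> carrier A; y \<in> carrier A\<rbrakk> \<Longrightarrow> x \<otimes> y \<in> carrier A"
    and one_closed: "\<one> \<in> carrier A"
    and mult_assoc: "\<And>x y z. \<lbrakk>x \<in> carrier A; y \<in> carrier A; z \<in> carrier A\<rbrakk> \<Longrightarrow> (x \<otimes> y) \<otimes> z = x \<otimes> (y \<otimes> z)"
    and one_mult: "\<And>x. x \<in> carrier A \<Longrightarrow> \<one> \<otimes> x = x"
    and mult_one: "\<And>x. x \<in> carrier A \<Longrightarrow> x \<otimes> \<one> = x"
    and distrib_r: "\<And>x y z. \<lbrakk>x \<in> carrier A; y \<in> carrier A; z \<in> carrier A\<rbrakk> \<Longrightarrow> (x \<oplus> y) \<otimes> z = x \<otimes> z \<oplus> y \<otimes> z"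
    and distrib_l: "\<And>x y z. \<lbrakk>x \<in> carrier A; y \<in> carrier A; z \<in> carrier A\<rbrakk> \<Longrightarrow> z \<otimes> (x \<oplus> y) = z \<otimes> x \<oplus> z \<otimes> y"
    and smult_closed: "\<And>c x. x \<in> carrier A \<Longrightarrow> c \<odot> x \<in> carrier A"
    and smult_distr_l: "\<And>c d x. x \<in> carrier A \<Longrightarrow> (c + d) \<odot> x = c \<odot> x \<oplus> d \<odot> x"
    and smult_distr_r: "\<And>c x y. \<lbrakk>x \<in> carrier A; y \<in> carrier A\<rbrakk> \<Longrightarrow> c \<odot> (x \<oplus> y) = c \<odot> x \<oplus> c \<odot> y"
    and smult_assoc: "\<And>c d x. x \<in> carrier A \<Longrightarrow> (c * d) \<odot> x = c \<odot> (d \<odot> x)"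
    and smult_1: "\<And>x. x \<in> carrier A \<Longrightarrow> 1 \<odot> x = x"
    and smult_mult_l: "\<And>c x y. \<lbrakk>x \<in> carrier A; y \<in> carrier A\<rbrakk> \<Longrightarrow> (c \<odot> x) \<otimes> y = c \<odot> (x \<otimes> y)"
    and smult_mult_r: "\<And>c x y. \<lbrakk>x \<in> carrier A; y \<in> carrier A\<rbrakk> \<Longrightarrow> x \<otimes> (c \<odot> y) = c \<odot> (x \<otimes> y)"
    and "\<And>x. x \<in> carrier A \<Longrightarrow> star A x \<in> carrier A"
    and "\<And>x. x \<in> carrier A \<Longrightarrow> star A (star A x) = x"
    and "\<And>x y. \<lbrakk>x \<in> carrier A; y \<in> carrier A\<rbrakk> \<Longrightarrow> star A (x \<oplus> y) = star A x \<oplus> star A y"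
    and "\<And>x y. \<lbrakk>x \<in> carrier A; y \<in> carrier A\<rbrakk> \<Longrightarrow> star A (x \<otimes> y) = star A y \<otimes> star A x"
    and "\<And>c x. x \<in> carrier A \<Longrightarrow> star A (c \<odot> x) = cnj c \<odot> star A x"
  shows "complex_star_algebra A"
proof -
  have ab: "abelian_group A"
  proof (rule abelian_groupI)
    fix x assume "x \<in> carrier A"
    then show "\<exists>y\<in>carrier A. y \<oplus> x = \<zero>"
      by (intro bexI[of _ "(-1) \<odot> x"]) (simp_all add: neg_add smult_closed)
  qed (simp_all add: add_closed zero_closed add_assoc zero_add, rule add_comm)
  have "Group.monoid A"
    by (rule monoidI) (auto simp: mult_closed one_closed mult_assoc one_mult mult_one)
  then have "ring A"
    by (intro ringI ab) (auto simp: distrib_l distrib_r)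
  moreover have "Module.module complex_numbers A"
    by (intro moduleI ab cring_complex_numbers)
      (simp_all add: smult_closed smult_distr_l smult_distr_r smult_assoc smult_1)
  ultimately show ?thesis
    by (intro complex_star_algebra.intro) (simp_all add: assms)
qed

sublocale complex_star_algebra \<subseteq> ring A
  by (rule is_ring)

sublocale complex_star_algebra \<subseteq> scal: Module.module complex_numbers A
  by (rule is_module)

context complex_star_algebra
begin

lemmas smult_closed [simp, intro] = scal.smult_closed[simplified]
lemmas smult_add_left = scal.smult_l_distr[simplified]
lemmas smult_add_right = scal.smult_r_distr[simplified]
lemmas smult_smult = scal.smult_assoc1[simplified, symmetric]
lemmas one_smult [simp] = scal.smult_one[simplified]
lemmas zero_smult [simp] = scal.smult_l_null[simplified]

declare star_closed [simp, intro] star_star [simp]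

text \<open>It rewrites subtraction in terms of addition and scalar multiplication, which
  homomorphisms, seminorms and the involution are known to respect.\<close>

lemma uminus_eq_smult: "x \<in> carrier A \<Longrightarrow> \<ominus> x = (-1) \<odot> x"
proof (rule minus_equality)
  assume x: "x \<in> carrier A"
  have "(-1) \<odot> x \<oplus> 1 \<odot> x = (-1 + 1) \<odot> x"
    by (rule smult_add_left[symmetric, OF x])
  then show "(-1) \<odot> x \<oplus> x = \<zero>"
    using x by simp
qed auto

lemma minus_eq_smult: "\<lbrakk>x \<in> carrier A; y \<in> carrier A\<rbrakk> \<Longrightarrow> x \<ominus> y = x \<oplus> (-1) \<odot> y"
  by (simp add: a_minus_def uminus_eq_smult)

lemma minus_eq_zero_iff [simp]: "\<lbrakk>x \<in> carrier A; y \<in> carrier A\<rbrakk> \<Longrightarrow> x \<ominus> y = \<zero> \<longleftrightarrow> x = y"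
  using minus_equality[of x "\<ominus> y"] by (auto simp: a_minus_def r_neg)

lemma star_zero [simp]: "star A \<zero> = \<zero>"
  using star_smult[of \<zero> 0] by simp

lemma star_one [simp]: "star A \<one> = \<one>"
  by (metis l_one one_closed r_one star_closed star_mult star_star)

lemma star_minus: "\<lbrakk>x \<in> carrier A; y \<in> carrier A\<rbrakk> \<Longrightarrow> star A (x \<ominus> y) = star A x \<ominus> star A y"
  by (simp add: minus_eq_smult star_add star_smult)

end

text \<open>Equational axioms survive under a surjection compatible with all operations. Two
  instances matter: the coset map of a quotient, and the identity when only the norm field is
  added.\<close>

lemma complex_star_algebra_image:
  assumes "complex_star_algebra A" and carrier: "carrier B = \<pi> ` carrier A"
    and add: "\<And>x y. \<lbrakk>x \<in> carrier A; y \<in> carrier A\<rbrakk> \<Longrightarrow> \<pi> x \<oplus>\<^bsub>B\<^esub> \<pi> y = \<pi> (x \<oplus>\<^bsub>A\<^esub> y)"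
    and mult: "\<And>x y. \<lbrakk>x \<in> carrier A; y \<in> carrier A\<rbrakk> \<Longrightarrow> \<pi> x \<otimes>\<^bsub>B\<^esub> \<pi> y = \<pi> (x \<otimes>\<^bsub>A\<^esub> y)"
    and smult: "\<And>c x. x \<in> carrier A \<Longrightarrow> c \<odot>\<^bsub>B\<^esub> \<pi> x = \<pi> (c \<odot>\<^bsub>A\<^esub> x)"
    and star: "\<And>x. x \<in> carrier A \<Longrightarrow> star B (\<pi> x) = \<pi> (star A x)"
    and zero: "\<zero>\<^bsub>B\<^esub> = \<pi> \<zero>\<^bsub>A\<^esub>" and one: "\<one>\<^bsub>B\<^esub> = \<pi> \<one>\<^bsub>A\<^esub>"
  shows "complex_star_algebra B"
proof -
  interpret complex_star_algebra A by fact
  have neg: "(-1) \<odot>\<^bsub>A\<^esub> x \<oplus>\<^bsub>A\<^esub> x = \<zero>\<^bsub>A\<^esub>" if "x \<in> carrier A" for x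
    using that l_neg[of x] by (simp add: uminus_eq_smult)
  then have neg': "x \<oplus>\<^bsub>A\<^esub> (-1) \<odot>\<^bsub>A\<^esub> x = \<zero>\<^bsub>A\<^esub>" if "x \<in> carrier A" for x
    using that by (simp add: a_comm)
  show ?thesis
    by (rule complex_star_algebraI)
      (auto simp: carrier add mult smult star zero one a_ac m_assoc l_distr r_distr neg neg' smult_add_left
        smult_add_right smult_smult star_add star_mult star_smult smult_mult_left smult_mult_right)
qed

lemma star_hom_iff:
  "h \<in> star_hom A B \<longleftrightarrow>
    (\<forall>x\<in>carrier A. h x \<in> carrier B) \<and>
    (\<forall>x\<in>carrier A. \<forall>y\<in>carrier A. h (x \<oplus>\<^bsub>A\<^esub> y) = h x \<oplus>\<^bsub>B\<^esub> h y \<and> h (x \<otimes>\<^bsub>A\<^esub> y) = h x \<otimes>\<^bsub>B\<^esub> h y) \<and>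
    (\<forall>x\<in>carrier A. \<forall>c. h (c \<odot>\<^bsub>A\<^esub> x) = c \<odot>\<^bsub>B\<^esub> h x) \<and>
    (\<forall>x\<in>carrier A. h (star A x) = star B (h x)) \<and> h \<one>\<^bsub>A\<^esub> = \<one>\<^bsub>B\<^esub>"
  by (auto simp: star_hom_def ring_hom_def)

lemma star_homD:
  assumes "h \<in> star_hom A B"
  shows star_hom_closed: "x \<in> carrier A \<Longrightarrow> h x \<in> carrier B"
    and star_hom_add: "\<lbrakk>x \<in> carrier A; y \<in> carrier A\<rbrakk> \<Longrightarrow> h (x \<oplus>\<^bsub>A\<^esub> y) = h x \<oplus>\<^bsub>B\<^esub> h y"
    and star_hom_mult: "\<lbrakk>x \<in> carrier A; y \<in> carrier A\<rbrakk> \<Longrightarrow> h (x \<otimes>\<^bsub>A\<^esub> y) = h x \<otimes>\<^bsub>B\<^esub> h y"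
    and star_hom_smult: "x \<in> carrier A \<Longrightarrow> h (c \<odot>\<^bsub>A\<^esub> x) = c \<odot>\<^bsub>B\<^esub> h x"
    and star_hom_star: "x \<in> carrier A \<Longrightarrow> h (star A x) = star B (h x)"
    and star_hom_one: "h \<one>\<^bsub>A\<^esub> = \<one>\<^bsub>B\<^esub>"
  using assms by (auto simp: star_hom_iff)

lemma star_hom_compose:
  "\<lbrakk>h \<in> star_hom A B; k \<in> star_hom B C\<rbrakk> \<Longrightarrow> (\<lambda>x. k (h x)) \<in> star_hom A C"
  by (auto simp: star_hom_iff)

text \<open>Membership depends only on the values on the carrier, so a homomorphism may be cut down
  to the extensional function that \<open>characters\<close> and \<open>aut_coproduct\<close> ask
  for.\<close>

lemma star_hom_cong:
  assumes "complex_star_algebra A" "h \<in> star_hom A B" "\<And>x. x \<in> carrier A \<Longrightarrow> k x = h x"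
  shows "k \<in> star_hom A B"
proof -
  interpret complex_star_algebra A by fact
  show ?thesis
    using assms(2,3) by (auto simp: star_hom_iff)
qed

locale star_algebra_hom =
  A: complex_star_algebra A + B: complex_star_algebra B for A (structure) and B (structure) +
  fixes h
  assumes hom: "h \<in> star_hom A B"
begin

lemmas hom_simps [simp] = star_homD[OF hom]

lemma hom_zero [simp]: "h \<zero>\<^bsub>A\<^esub> = \<zero>\<^bsub>B\<^esub>"
  using star_hom_smult[OF hom, of "\<zero>\<^bsub>A\<^esub>" 0] by simp

lemma hom_minus: "\<lbrakk>x \<in> carrier A; y \<in> carrier A\<rbrakk> \<Longrightarrow> h (x \<ominus>\<^bsub>A\<^esub> y) = h x \<ominus>\<^bsub>B\<^esub> h y"
  by (simp add: A.minus_eq_smult B.minus_eq_smult)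

lemma hom_finsum:
  "f \<in> S \<rightarrow> carrier A \<Longrightarrow> h (\<Oplus>\<^bsub>A\<^esub>s\<in>S. f s) = (\<Oplus>\<^bsub>B\<^esub>s\<in>S. h (f s))"
proof (induction S rule: infinite_finite_induct)
  case (insert s S)
  then have "f s \<in> carrier A" "f \<in> S \<rightarrow> carrier A" by auto
  with insert show ?case
    by (simp add: A.finsum_insert B.finsum_insert Pi_def)
qed simp_all

lemma kernel_ideal: "ideal {x \<in> carrier A. h x = \<zero>\<^bsub>B\<^esub>} A"
proof (rule idealI)
  show "subgroup {x \<in> carrier A. h x = \<zero>\<^bsub>B\<^esub>} (add_monoid A)"
    by (rule A.add.subgroupI) (auto simp: A.uminus_eq_smult intro!: exI[of _ "\<zero>\<^bsub>A\<^esub>"])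
qed (auto simp: A.is_ring)

end

lemma star_algebra_homI:
  "\<lbrakk>complex_star_algebra A; complex_star_algebra B; h \<in> star_hom A B\<rbrakk> \<Longrightarrow> star_algebra_hom A B h"
  by (simp add: star_algebra_hom.intro star_algebra_hom_axioms.intro)

section \<open>Monoid algebras\<close>

abbreviation single where "single \<equiv> Poly_Mapping.single"
abbreviation lookup where "lookup \<equiv> Poly_Mapping.lookup"
abbreviation keys where "keys \<equiv> Poly_Mapping.keys"

text \<open>One key is removed at a time, so the support never leaves \<open>C\<close>; a linear
  statement about a monoid algebra is thereby reduced to monomials from the carrier.\<close>

lemma poly_mapping_keys_induct [consumes 1, case_names zero single add]:
  fixes f :: "'a \<Rightarrow>\<^sub>0 'b :: ab_group_add"
  assumes "keys f \<subseteq> C" and zero: "P 0" and single: "\<And>x c. x \<in> C \<Longrightarrow> P (single x c)"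
    and add: "\<And>f g. \<lbrakk>keys f \<subseteq> C; keys g \<subseteq> C; P f; P g\<rbrakk> \<Longrightarrow> P (f + g)"
  shows "P f"
  using assms(1)
proof (induction "card (keys f)" arbitrary: f)
  case 0
  then have "f = 0" by simp
  then show ?case by (simp add: zero)
next
  case (Suc n)
  then obtain x where x: "x \<in> keys f" by fastforce
  define g where "g = f - single x (lookup f x)"
  have keys: "keys g = keys f - {x}"
    by (auto simp: g_def in_keys_iff lookup_minus lookup_single when_def split: if_splits)
  then have "n = card (keys g)" "keys g \<subseteq> C"
    using Suc.hyps(2) Suc.prems x by auto
  then have "P g" by (rule Suc.hyps(1))
  then have "P (single x (lookup f x) + g)"
    using Suc.prems x \<open>keys g \<subseteq> C\<close> by (intro add single) auto
  then show ?case by (simp add: g_def)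
qed

lemma keys_add_subset: "\<lbrakk>keys f \<subseteq> C; keys g \<subseteq> C\<rbrakk> \<Longrightarrow> keys (f + g) \<subseteq> C"
  using keys_add[of f g] by blast

lemma lookup_map_times [simp]: "lookup (Poly_Mapping.map ((*) c) f) x = c * lookup f x" for c :: complex
  by (simp add: map.rep_eq when_def)

lemma keys_map_times: "keys (Poly_Mapping.map ((*) c) f) \<subseteq> keys f" for c :: complex
  by (auto simp: in_keys_iff)

text \<open>Two instances are used: words under concatenation with reversal, and pairs of elements
  of two C*-algebras with componentwise product and involution.\<close>

locale involutive_monoid = Group.monoid M for M :: "('a, 'm) monoid_scheme" (structure) +
  fixes s :: "'a \<Rightarrow> 'a"
  assumes s_closed [simp]: "x \<in> carrier M \<Longrightarrow> s x \<in> carrier M"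
    and s_s [simp]: "x \<in> carrier M \<Longrightarrow> s (s x) = x"
    and s_mult: "\<lbrakk>x \<in> carrier M; y \<in> carrier M\<rbrakk> \<Longrightarrow> s (x \<otimes> y) = s y \<otimes> s x"
begin

abbreviation MA where "MA \<equiv> monoid_star_algebra M s"

lemma MA_simps [simp]:
  "carrier MA = {f. keys f \<subseteq> carrier M}" "one MA = single \<one> 1" "zero MA = 0" "add MA = (+)"
  "smult MA = (\<lambda>c f. Poly_Mapping.map ((*) c) f)"
  by (simp_all add: monoid_star_algebra_def)

lemma MA_mult:
  "f \<otimes>\<^bsub>MA\<^esub> g = (\<Sum>x\<in>keys f. \<Sum>y\<in>keys g. single (x \<otimes> y) (lookup f x * lookup g y))"
  by (simp add: monoid_star_algebra_def)

lemma MA_star: "star MA f = (\<Sum>x\<in>keys f. single (s x) (cnj (lookup f x)))"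
  by (simp add: monoid_star_algebra_def)

lemma MA_mult_single [simp]: "single x a \<otimes>\<^bsub>MA\<^esub> single y b = single (x \<otimes> y) (a * b)"
  by (simp add: MA_mult)

lemma MA_mult_zero [simp]: "0 \<otimes>\<^bsub>MA\<^esub> f = 0" "f \<otimes>\<^bsub>MA\<^esub> 0 = 0"
  by (simp_all add: MA_mult)

lemma MA_mult_add:
  "(f + g) \<otimes>\<^bsub>MA\<^esub> h = f \<otimes>\<^bsub>MA\<^esub> h + g \<otimes>\<^bsub>MA\<^esub> h"
  "h \<otimes>\<^bsub>MA\<^esub> (f + g) = h \<otimes>\<^bsub>MA\<^esub> f + h \<otimes>\<^bsub>MA\<^esub> g"
proof -
  show "(f + g) \<otimes>\<^bsub>MA\<^esub> h = f \<otimes>\<^bsub>MA\<^esub> h + g \<otimes>\<^bsub>MA\<^esub> h"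
    unfolding MA_mult
    by (rule setsum_keys_plus_distrib) (simp_all add: distrib_right single_add sum.distrib)
  have "(\<Sum>y\<in>keys (f + g). single (x \<otimes> y) (lookup h x * lookup (f + g) y)) =
      (\<Sum>y\<in>keys f. single (x \<otimes> y) (lookup h x * lookup f y)) +
      (\<Sum>y\<in>keys g. single (x \<otimes> y) (lookup h x * lookup g y))" for x
    by (rule setsum_keys_plus_distrib) (simp_all add: distrib_left single_add)
  then show "h \<otimes>\<^bsub>MA\<^esub> (f + g) = h \<otimes>\<^bsub>MA\<^esub> f + h \<otimes>\<^bsub>MA\<^esub> g"
    by (simp add: MA_mult sum.distrib)
qed

lemma MA_mult_closed:
  assumes "keys f \<subseteq> carrier M" "keys g \<subseteq> carrier M"
  shows "keys (f \<otimes>\<^bsub>MA\<^esub> g) \<subseteq> carrier M"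
  using assms(1)
proof (induction rule: poly_mapping_keys_induct)
  case (single x c)
  from assms(2) show ?case
  proof (induction rule: poly_mapping_keys_induct)
    case (single y d)
    with \<open>x \<in> carrier M\<close> show ?case by simp
  next
    case (add g h)
    then show ?case by (simp add: MA_mult_add keys_add_subset)
  qed simp
next
  case (add f h)
  then show ?case by (simp add: MA_mult_add keys_add_subset)
qed simp

text \<open>Both sides are additive in each argument, so three nested inductions reduce the claim to
  monomials, where it is associativity in the monoid.\<close>

lemma MA_mult_assoc:
  assumes "keys f \<subseteq> carrier M" "keys g \<subseteq> carrier M" "keys h \<subseteq> carrier M"
  shows "(f \<otimes>\<^bsub>MA\<^esub> g) \<otimes>\<^bsub>MA\<^esub> h = f \<otimes>\<^bsub>MA\<^esub> (g \<otimes>\<^bsub>MA\<^esub> h)"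
  using assms(1)
proof (induction rule: poly_mapping_keys_induct)
  case (single x c)
  from assms(2) show ?case
  proof (induction rule: poly_mapping_keys_induct)
    case (single y d)
    from assms(3) show ?case
      by (induction rule: poly_mapping_keys_induct)
        (simp_all add: MA_mult_add m_assoc \<open>x \<in> carrier M\<close> \<open>y \<in> carrier M\<close> mult.assoc)
  qed (simp_all add: MA_mult_add)
qed (simp_all add: MA_mult_add)

lemma MA_star_single [simp]: "star MA (single x c) = single (s x) (cnj c)"
  by (simp add: MA_star)

lemma MA_star_zero [simp]: "star MA 0 = 0"
  by (simp add: MA_star)

lemma MA_star_add: "star MA (f + g) = star MA f + star MA g"
  unfolding MA_star by (rule setsum_keys_plus_distrib) (simp_all add: single_add)

lemma MA_smult_add: "Poly_Mapping.map ((*) c) (f + g) = Poly_Mapping.map ((*) c) f + Poly_Mapping.map ((*) c) g"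
  for c :: complex
  by (rule poly_mapping_eqI) (simp add: lookup_add distrib_left)

lemma MA_smult_zero: "Poly_Mapping.map ((*) c) (0 :: 'a \<Rightarrow>\<^sub>0 complex) = 0"
  by (rule poly_mapping_eqI) simp

lemma monoid_star_algebra: "complex_star_algebra MA"
proof (rule complex_star_algebraI)
  fix f g :: "'a \<Rightarrow>\<^sub>0 complex" and c :: complex
  assume f: "f \<in> carrier MA"
  have kf: "keys f \<subseteq> carrier M" using f by simp
  show "star MA f \<in> carrier MA" "star MA (star MA f) = f"
      "star MA (c \<odot>\<^bsub>MA\<^esub> f) = cnj c \<odot>\<^bsub>MA\<^esub> star MA f"
      "\<one>\<^bsub>MA\<^esub> \<otimes>\<^bsub>MA\<^esub> f = f" "f \<otimes>\<^bsub>MA\<^esub> \<one>\<^bsub>MA\<^esub> = f"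
    using kf
    by (induction rule: poly_mapping_keys_induct)
      (simp_all add: MA_star_add MA_smult_add MA_mult_add MA_smult_zero keys_add_subset)
  assume g: "g \<in> carrier MA"
  have kg: "keys g \<subseteq> carrier M" using g by simp
  show "f \<otimes>\<^bsub>MA\<^esub> g \<in> carrier MA"
    using MA_mult_closed kf kg by simp
  show "f \<oplus>\<^bsub>MA\<^esub> g \<in> carrier MA"
    using kf kg keys_add[of f g] by auto
  show "star MA (f \<otimes>\<^bsub>MA\<^esub> g) = star MA g \<otimes>\<^bsub>MA\<^esub> star MA f"
    "(c \<odot>\<^bsub>MA\<^esub> f) \<otimes>\<^bsub>MA\<^esub> g = c \<odot>\<^bsub>MA\<^esub> (f \<otimes>\<^bsub>MA\<^esub> g)"
    "f \<otimes>\<^bsub>MA\<^esub> (c \<odot>\<^bsub>MA\<^esub> g) = c \<odot>\<^bsub>MA\<^esub> (f \<otimes>\<^bsub>MA\<^esub> g)"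
    using kf
  proof (induction rule: poly_mapping_keys_induct)
    case (single x d)
    {
      case 1
      from kg show ?case
        by (induction rule: poly_mapping_keys_induct)
          (simp_all add: MA_star_add MA_mult_add \<open>x \<in> carrier M\<close> s_mult mult.commute)
    next
      case 2
      from kg show ?case
        by (induction rule: poly_mapping_keys_induct)
          (simp_all add: MA_smult_add MA_mult_add MA_smult_zero mult.assoc)
    next
      case 3
      from kg show ?case
        by (induction rule: poly_mapping_keys_induct)
          (simp_all add: MA_smult_add MA_mult_add MA_smult_zero mult_ac)
    }
  qed (simp_all add: MA_star_add MA_smult_add MA_mult_add MA_smult_zero)
next
  fix f :: "'a \<Rightarrow>\<^sub>0 complex"
  show "-1 \<odot>\<^bsub>MA\<^esub> f \<oplus>\<^bsub>MA\<^esub> f = \<zero>\<^bsub>MA\<^esub>"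
    by (simp, rule poly_mapping_eqI) (simp add: lookup_add)
next
  fix f :: "'a \<Rightarrow>\<^sub>0 complex" and c d
  show "(c + d) \<odot>\<^bsub>MA\<^esub> f = c \<odot>\<^bsub>MA\<^esub> f \<oplus>\<^bsub>MA\<^esub> d \<odot>\<^bsub>MA\<^esub> f"
    by (simp, rule poly_mapping_eqI) (simp add: lookup_add distrib_right)
  show "(c * d) \<odot>\<^bsub>MA\<^esub> f = c \<odot>\<^bsub>MA\<^esub> (d \<odot>\<^bsub>MA\<^esub> f)"
    by (simp, rule poly_mapping_eqI) (simp add: mult.assoc)
  show "1 \<odot>\<^bsub>MA\<^esub> f = f"
    by (simp, rule poly_mapping_eqI) simp
  show "c \<odot>\<^bsub>MA\<^esub> f \<in> carrier MA" if "f \<in> carrier MA"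
    using keys_map_times that by (auto dest: subsetD[OF keys_map_times])
qed (simp_all add: add_ac MA_mult_add MA_mult_assoc MA_smult_add MA_star_add)

lemma MA_single_smult: "single x c = c \<odot>\<^bsub>MA\<^esub> single x 1"
  by simp

lemma monoid_star_algebra_hom_eqI:
  assumes "h \<in> star_hom MA T" "k \<in> star_hom MA T" "complex_star_algebra T"
    and "\<And>x. x \<in> carrier M \<Longrightarrow> h (single x 1) = k (single x 1)"
    and "f \<in> carrier MA"
  shows "h f = k f"
proof -
  interpret MA: complex_star_algebra MA by (rule monoid_star_algebra)
  interpret h: star_algebra_hom MA T h
    using assms by (simp add: star_algebra_homI monoid_star_algebra)
  interpret k: star_algebra_hom MA T k
    using assms by (simp add: star_algebra_homI monoid_star_algebra)
  from assms(5) have "keys f \<subseteq> carrier M" by simp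
  then show ?thesis
  proof (induction rule: poly_mapping_keys_induct)
    case zero
    then show ?case using h.hom_zero k.hom_zero by simp
  next
    case (single x c)
    have "single x 1 \<in> carrier MA" using single by simp
    then show ?case using assms(4)[OF single]
      unfolding MA_single_smult[of x c] by (simp only: h.hom_simps k.hom_simps)
  next
    case (add f g)
    have "f \<in> carrier MA" "g \<in> carrier MA" using add by simp_all
    then have "h (f \<oplus>\<^bsub>MA\<^esub> g) = k (f \<oplus>\<^bsub>MA\<^esub> g)"
      using add.IH by (simp only: h.hom_simps k.hom_simps)
    then show ?case by simp
  qed
qed

text \<open>\<open>h\<close> is the linear extension of \<open>u\<close>; its compatibility with
  products and involutions holds on monomials by assumption and spreads by additivity.\<close>

lemma monoid_star_algebra_universal:
  assumes "complex_star_algebra T" and u: "u \<in> carrier M \<rightarrow> carrier T" "u \<one> = \<one>\<^bsub>T\<^esub>"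
    and u_mult: "\<And>x y. \<lbrakk>x \<in> carrier M; y \<in> carrier M\<rbrakk> \<Longrightarrow> u (x \<otimes> y) = u x \<otimes>\<^bsub>T\<^esub> u y"
    and u_star: "\<And>x. x \<in> carrier M \<Longrightarrow> u (s x) = star T (u x)"
  obtains h where "h \<in> star_hom MA T" "\<And>x c. x \<in> carrier M \<Longrightarrow> h (single x c) = c \<odot>\<^bsub>T\<^esub> u x"
proof -
  interpret T: complex_star_algebra T by fact
  define h where "h f = (\<Oplus>\<^bsub>T\<^esub>x\<in>keys f. lookup f x \<odot>\<^bsub>T\<^esub> u x)" for f
  note [simp] = funcset_mem[OF u(1)]
  have zero [simp]: "h 0 = \<zero>\<^bsub>T\<^esub>" by (simp add: h_def)
  have single [simp]: "h (single x c) = c \<odot>\<^bsub>T\<^esub> u x" if "x \<in> carrier M" for x c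
    using that by (cases "c = 0") (simp_all add: h_def)
  have closed [simp]: "h f \<in> carrier T" if "keys f \<subseteq> carrier M" for f
    unfolding h_def by (rule T.finsum_closed) (use that in auto)
  \<comment> \<open>Sums over different supports are compared on a common finite index set; the
    added terms have coefficient zero.\<close>
  have extend: "h f = (\<Oplus>\<^bsub>T\<^esub>x\<in>F. lookup f x \<odot>\<^bsub>T\<^esub> u x)"
    if "finite F" "keys f \<subseteq> F" "F \<subseteq> carrier M" for f F
    unfolding h_def
    by (rule T.add.finprod_mono_neutral_cong_left) (use that in \<open>auto simp: in_keys_iff\<close>)
  have add: "h (f + g) = h f \<oplus>\<^bsub>T\<^esub> h g"
    if f: "keys f \<subseteq> carrier M" and g: "keys g \<subseteq> carrier M" for f g
  proof -
    let ?F = "keys f \<union> keys g"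
    have F: "x \<in> carrier M" if "x \<in> ?F" for x using that f g by auto
    have "h (f + g) = (\<Oplus>\<^bsub>T\<^esub>x\<in>?F. lookup (f + g) x \<odot>\<^bsub>T\<^esub> u x)"
      by (rule extend) (use f g keys_add[of f g] in auto)
    also have "\<dots> = (\<Oplus>\<^bsub>T\<^esub>x\<in>?F. lookup f x \<odot>\<^bsub>T\<^esub> u x \<oplus>\<^bsub>T\<^esub> lookup g x \<odot>\<^bsub>T\<^esub> u x)"
      by (rule T.finsum_cong') (use F in \<open>auto simp: lookup_add T.smult_add_left\<close>)
    also have "\<dots> = h f \<oplus>\<^bsub>T\<^esub> h g"
      by (subst T.finsum_addf) (use F f g in \<open>auto simp: extend[of ?F f] extend[of ?F g]\<close>)
    finally show ?thesis .
  qed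
  have smult: "h (Poly_Mapping.map ((*) c) f) = c \<odot>\<^bsub>T\<^esub> h f"
    if "keys f \<subseteq> carrier M" for f c
    using that
  proof (induction rule: poly_mapping_keys_induct)
    case (add f g)
    have "keys (Poly_Mapping.map ((*) c) f') \<subseteq> carrier M"
      if "keys f' \<subseteq> carrier M" for f'
      using that keys_map_times by fast
    then show ?case using add by (simp add: MA_smult_add \<open>\<And>f g. _ \<Longrightarrow> _ \<Longrightarrow> h (f + g) = _\<close> T.smult_add_right)
  qed (simp_all add: T.smult_smult MA_smult_zero)
  have mult: "h (f \<otimes>\<^bsub>MA\<^esub> g) = h f \<otimes>\<^bsub>T\<^esub> h g"
    if f: "keys f \<subseteq> carrier M" and g: "keys g \<subseteq> carrier M" for f g
    using f
  proof (induction rule: poly_mapping_keys_induct)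
    case (single x c)
    from g show ?case
    proof (induction rule: poly_mapping_keys_induct)
      case (single y d)
      with \<open>x \<in> carrier M\<close> show ?case
        by (simp add: u_mult T.smult_mult_left T.smult_mult_right T.smult_smult mult.commute)
    next
      case (add g1 g2)
      then show ?case using \<open>x \<in> carrier M\<close> MA_mult_closed[of "single x c"]
        by (simp add: MA_mult_add \<open>\<And>f g. _ \<Longrightarrow> _ \<Longrightarrow> h (f + g) = _\<close> T.r_distr)
    qed (simp add: \<open>x \<in> carrier M\<close>)
  next
    case (add f1 f2)
    then show ?case using g MA_mult_closed[OF _ g]
      by (simp add: MA_mult_add \<open>\<And>f g. _ \<Longrightarrow> _ \<Longrightarrow> h (f + g) = _\<close> T.l_distr)
  qed (simp add: g)
  have star: "h (star MA f) = star T (h f)" if f: "keys f \<subseteq> carrier M" for f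
    using f
  proof (induction rule: poly_mapping_keys_induct)
    case (add f g)
    have "keys (star MA f') \<subseteq> carrier M" if "keys f' \<subseteq> carrier M" for f'
      using that complex_star_algebra.star_closed[OF monoid_star_algebra, of f'] by simp
    with add show ?case by (simp add: MA_star_add \<open>\<And>f g. _ \<Longrightarrow> _ \<Longrightarrow> h (f + g) = _\<close> T.star_add)
  qed (simp_all add: u_star T.star_smult)
  have "h \<in> star_hom MA T"
    using u(2) by (simp add: star_hom_iff add smult mult star T.one_smult)
  then show thesis
    by (rule that) simp
qed

end

section \<open>Quotients\<close>

locale star_ideal = complex_star_algebra A + ideal I A for A (structure) and I +
  assumes star_mem: "x \<in> I \<Longrightarrow> star A x \<in> I"
begin

abbreviation Q where "Q \<equiv> quotient_star_algebra A I"

text \<open>A ring ideal of a unital algebra is a linear subspace: \<open>c \<odot> x\<close> is the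
  product of \<open>c \<odot> \<one>\<close> and \<open>x\<close>.\<close>

lemma smult_mem: "x \<in> I \<Longrightarrow> c \<odot> x \<in> I"
  using I_l_closed[of x "c \<odot> \<one>"] smult_mult_left[of \<one> x c] by simp

lemma coset_eq_iff:
  "\<lbrakk>x \<in> carrier A; y \<in> carrier A\<rbrakk> \<Longrightarrow> I +> x = I +> y \<longleftrightarrow> x \<ominus> y \<in> I"
  by (metis a_rcos_module_minus a_rcos_self a_repr_independence' is_ring)

lemma coset_eq_zero_iff: "x \<in> carrier A \<Longrightarrow> I +> x = I \<longleftrightarrow> x \<in> I"
  by (metis a_coset_join1 a_coset_join2 a_subgroup a_subset)

lemma mem_coset_iff:
  "x \<in> carrier A \<Longrightarrow> y \<in> I +> x \<longleftrightarrow> y \<in> carrier A \<and> y \<ominus> x \<in> I"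
  by (metis a_elemrcos_carrier a_rcos_module_minus is_ring)

lemma carrier_Q: "carrier Q = (+>) I ` carrier A"
  by (auto simp: quotient_star_algebra_def FactRing_def A_RCOSETS_def')

lemma coset_add [simp]:
  "\<lbrakk>x \<in> carrier A; y \<in> carrier A\<rbrakk> \<Longrightarrow> (I +> x) \<oplus>\<^bsub>Q\<^esub> (I +> y) = I +> (x \<oplus> y)"
  by (simp add: quotient_star_algebra_def FactRing_def a_rcos_sum)

lemma coset_mult [simp]:
  "\<lbrakk>x \<in> carrier A; y \<in> carrier A\<rbrakk> \<Longrightarrow> (I +> x) \<otimes>\<^bsub>Q\<^esub> (I +> y) = I +> (x \<otimes> y)"
  by (simp add: quotient_star_algebra_def FactRing_def rcoset_mult_add)

text \<open>Scalar multiplication and involution on a quotient are defined as unions over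
  representatives. If \<open>f\<close> respects congruence modulo \<open>I\<close>, all sets in the
  union coincide.\<close>

lemma coset_UN:
  assumes "x \<in> carrier A" "\<And>y. y \<in> carrier A \<Longrightarrow> f y \<in> carrier A"
    and "\<And>y. y \<in> carrier A \<Longrightarrow> y \<ominus> x \<in> I \<Longrightarrow> f y \<ominus> f x \<in> I"
  shows "(\<Union>y\<in>I +> x. I +> f y) = I +> f x"
proof -
  have "I +> f y = I +> f x" if "y \<in> I +> x" for y
    using that assms by (simp add: coset_eq_iff mem_coset_iff)
  moreover have "x \<in> I +> x"
    using assms(1) by (rule a_rcos_self)
  ultimately show ?thesis by blast
qed

lemma coset_smult [simp]: "x \<in> carrier A \<Longrightarrow> c \<odot>\<^bsub>Q\<^esub> (I +> x) = I +> (c \<odot> x)"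
proof -
  assume x: "x \<in> carrier A"
  have "c \<odot> y \<ominus> c \<odot> x \<in> I" if "y \<in> carrier A" "y \<ominus> x \<in> I" for y
    using smult_mem[OF that(2), of c] that(1) x
    by (simp add: minus_eq_smult smult_add_right smult_smult mult.commute)
  then show ?thesis
    using coset_UN[OF x, of "smult A c"] by (simp add: quotient_star_algebra_def)
qed

lemma coset_star [simp]: "x \<in> carrier A \<Longrightarrow> star Q (I +> x) = I +> star A x"
proof -
  assume x: "x \<in> carrier A"
  have "star A y \<ominus> star A x \<in> I" if "y \<in> carrier A" "y \<ominus> x \<in> I" for y
    using star_mem[OF that(2)] that(1) x by (simp add: star_minus)
  then show ?thesis
    using coset_UN[OF x, of "star A"] by (simp add: quotient_star_algebra_def)
qed

lemma one_Q: "\<one>\<^bsub>Q\<^esub> = I +> \<one>"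
  by (simp add: quotient_star_algebra_def FactRing_def)

lemma zero_Q: "\<zero>\<^bsub>Q\<^esub> = I +> \<zero>"
  using coset_eq_zero_iff[of \<zero>] by (simp add: quotient_star_algebra_def FactRing_def)

lemma quotient_star_algebra: "complex_star_algebra Q"
  by (rule complex_star_algebra_image[of A _ "(+>) I"])
    (simp_all add: carrier_Q one_Q zero_Q complex_star_algebra_axioms)

lemma coset_hom: "(+>) I \<in> star_hom A Q"
  by (auto simp: star_hom_iff carrier_Q one_Q)

end

text \<open>As the involution reverses products, the elements whose star lies in
  \<open>Idl S\<close> form a two-sided ideal. It contains \<open>S\<close>, hence all of
  \<open>Idl S\<close>.\<close>

lemma (in complex_star_algebra) star_ideal_genideal:
  assumes S: "S \<subseteq> carrier A" and star: "\<And>x. x \<in> S \<Longrightarrow> star A x \<in> Idl S"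
  shows "star_ideal A (Idl S)"
proof -
  interpret I: ideal "Idl S" A using S by (rule genideal_ideal)
  have smult_mem: "c \<odot> x \<in> Idl S" if "x \<in> Idl S" for c x
    using I.I_l_closed[OF that, of "c \<odot> \<one>"] smult_mult_left[of \<one> x c] that by simp
  let ?J = "{x \<in> carrier A. star A x \<in> Idl S}"
  have "ideal ?J A"
  proof (rule idealI)
    show "subgroup ?J (add_monoid A)"
      by (rule add.subgroupI)
        (auto simp: uminus_eq_smult star_add star_smult smult_mem intro!: exI[of _ \<zero>])
  qed (auto simp: is_ring star_mult intro: I.I_l_closed I.I_r_closed)
  then have "Idl S \<subseteq> ?J"
    by (rule genideal_minimal) (use S star in auto)
  then show ?thesis
    by unfold_locales auto
qed

text \<open>The kernel of \<open>h\<close> is an ideal that contains \<open>S\<close>.\<close>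

lemma (in star_algebra_hom) hom_genideal:
  assumes "S \<subseteq> carrier A" "\<And>x. x \<in> S \<Longrightarrow> h x = \<zero>\<^bsub>B\<^esub>" "x \<in> Idl\<^bsub>A\<^esub> S"
  shows "h x = \<zero>\<^bsub>B\<^esub>"
  using A.genideal_minimal[OF kernel_ideal, of S] assms by auto

lemma (in star_ideal) quotient_universal:
  assumes "complex_star_algebra T" and h: "h \<in> star_hom A T" and "\<And>x. x \<in> I \<Longrightarrow> h x = \<zero>\<^bsub>T\<^esub>"
  obtains k where "k \<in> star_hom Q T" "\<And>x. x \<in> carrier A \<Longrightarrow> k (I +> x) = h x"
proof -
  interpret h: star_algebra_hom A T h
    using assms by (simp add: star_algebra_homI complex_star_algebra_axioms)
  have well: "h x = h y" if "x \<in> carrier A" "y \<in> carrier A" "I +> x = I +> y" for x y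
  proof -
    have "x \<ominus> y \<in> I" using that by (simp add: coset_eq_iff)
    then have "h x \<ominus>\<^bsub>T\<^esub> h y = \<zero>\<^bsub>T\<^esub>"
      using assms(3) h.hom_minus[of x y] that by simp
    then show ?thesis using that by simp
  qed
  define k where "k X = h (SOME x. x \<in> carrier A \<and> X = I +> x)" for X
  have k [simp]: "k (I +> x) = h x" if "x \<in> carrier A" for x
  proof -
    have "(SOME y. y \<in> carrier A \<and> I +> x = I +> y) \<in> carrier A \<and>
        I +> x = I +> (SOME y. y \<in> carrier A \<and> I +> x = I +> y)"
      by (rule someI[of _ x]) (use that in simp)
    then show ?thesis
      unfolding k_def using well that by metis
  qed
  have "k \<in> star_hom Q T"
    by (auto simp: star_hom_iff carrier_Q one_Q)
  then show thesis by (rule that) simp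
qed

section \<open>C*-seminorms\<close>

locale cstar_seminormed = complex_star_algebra A for A :: "('a, 'm) star_algebra_scheme" (structure) +
  fixes p :: "'a \<Rightarrow> real"
  assumes seminorm: "cstar_seminorm A p"
begin

lemma p_nonneg [simp]: "x \<in> carrier A \<Longrightarrow> 0 \<le> p x"
  and p_star_mult: "x \<in> carrier A \<Longrightarrow> p (star A x \<otimes> x) = (p x)\<^sup>2"
  and p_smult: "x \<in> carrier A \<Longrightarrow> p (c \<odot> x) = cmod c * p x"
  and p_add: "\<lbrakk>x \<in> carrier A; y \<in> carrier A\<rbrakk> \<Longrightarrow> p (x \<oplus> y) \<le> p x + p y"
  and p_mult: "\<lbrakk>x \<in> carrier A; y \<in> carrier A\<rbrakk> \<Longrightarrow> p (x \<otimes> y) \<le> p x * p y"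
  using seminorm by (simp_all add: cstar_seminorm_def)

lemma p_zero [simp]: "p \<zero> = 0"
  using p_smult[of \<zero> 0] by simp

lemma p_minus_commute: "\<lbrakk>x \<in> carrier A; y \<in> carrier A\<rbrakk> \<Longrightarrow> p (x \<ominus> y) = p (y \<ominus> x)"
  using p_smult[of "y \<ominus> x" "-1"]
  by (simp add: minus_eq_smult smult_add_right smult_smult a_comm)

text \<open>The C*-identity gives \<open>(p x)\<^sup>2 \<le> p (star A x) * p x\<close>; cancelling
  \<open>p x\<close> yields one inequality, and replacing \<open>x\<close> by its star yields the
  other.\<close>

lemma p_star: "x \<in> carrier A \<Longrightarrow> p (star A x) = p x"
proof -
  have le: "p x \<le> p (star A x)" if x: "x \<in> carrier A" for x
  proof (cases "p x = 0")
    case False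
    have "p x * p x \<le> p (star A x) * p x"
      using p_mult[of "star A x" x] p_star_mult[OF x] x by (simp add: power2_eq_square)
    then show ?thesis
      using False p_nonneg[OF x] by (simp add: mult_le_cancel_right)
  qed (use x in simp)
  assume "x \<in> carrier A"
  then show ?thesis using le[of x] le[of "star A x"] by simp
qed

lemma p_triangle:
  assumes "x \<in> carrier A" "y \<in> carrier A" "z \<in> carrier A"
  shows "p (x \<ominus> z) \<le> p (x \<ominus> y) + p (y \<ominus> z)"
proof -
  have "x \<ominus> z = (x \<ominus> y) \<oplus> (y \<ominus> z)"
    using assms by (simp add: a_minus_def a_assoc r_neg1)
  then show ?thesis using p_add[of "x \<ominus> y" "y \<ominus> z"] assms by simp
qed

lemma p_diff_le:
  assumes "x \<in> carrier A" "y \<in> carrier A"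
  shows "\<bar>p x - p y\<bar> \<le> p (x \<ominus> y)"
proof -
  have "p x \<le> p (x \<ominus> y) + p y" if "x \<in> carrier A" "y \<in> carrier A" for x y
    using p_triangle[of x y \<zero>] that by (simp add: a_minus_def)
  from this[of x y] this[of y x] show ?thesis
    using assms by (simp add: p_minus_commute[of y x])
qed

lemma p_add_diff:
  assumes "x \<in> carrier A" "y \<in> carrier A" "x' \<in> carrier A" "y' \<in> carrier A"
  shows "p ((x \<oplus> y) \<ominus> (x' \<oplus> y')) \<le> p (x \<ominus> x') + p (y \<ominus> y')"
proof -
  have "(x \<oplus> y) \<ominus> (x' \<oplus> y') = (x \<ominus> x') \<oplus> (y \<ominus> y')"
    using assms by (simp add: minus_eq_smult smult_add_right a_ac)
  then show ?thesis using p_add[of "x \<ominus> x'" "y \<ominus> y'"] assms by simp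
qed

lemma p_mult_diff:
  assumes "x \<in> carrier A" "y \<in> carrier A" "x' \<in> carrier A" "y' \<in> carrier A"
  shows "p (x \<otimes> y \<ominus> x' \<otimes> y') \<le> p (x \<ominus> x') * p y + p x' * p (y \<ominus> y')"
proof -
  have "p (x \<otimes> y \<ominus> x' \<otimes> y') \<le> p (x \<otimes> y \<ominus> x' \<otimes> y) + p (x' \<otimes> y \<ominus> x' \<otimes> y')"
    using assms by (intro p_triangle) auto
  also have "x \<otimes> y \<ominus> x' \<otimes> y = (x \<ominus> x') \<otimes> y"
    using assms by (simp add: minus_eq_smult l_distr smult_mult_left)
  also have "x' \<otimes> y \<ominus> x' \<otimes> y' = x' \<otimes> (y \<ominus> y')"
    using assms by (simp add: minus_eq_smult r_distr smult_mult_right)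
  also have "p ((x \<ominus> x') \<otimes> y) + p (x' \<otimes> (y \<ominus> y')) \<le> p (x \<ominus> x') * p y + p x' * p (y \<ominus> y')"
    using assms by (intro add_mono p_mult) auto
  finally show ?thesis .
qed

lemma p_smult_diff:
  assumes "x \<in> carrier A" "y \<in> carrier A"
  shows "p (c \<odot> x \<ominus> c \<odot> y) = cmod c * p (x \<ominus> y)"
proof -
  have "c \<odot> x \<ominus> c \<odot> y = c \<odot> (x \<ominus> y)"
    using assms by (simp add: minus_eq_smult smult_add_right smult_smult mult.commute)
  then show ?thesis using assms by (simp add: p_smult)
qed

lemma p_star_diff:
  "\<lbrakk>x \<in> carrier A; y \<in> carrier A\<rbrakk> \<Longrightarrow> p (star A x \<ominus> star A y) = p (x \<ominus> y)"
  by (simp add: p_star flip: star_minus)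

text \<open>For a projection the C*-identity reads \<open>p x = (p x)\<^sup>2\<close>, so
  \<open>p x\<close> is 0 or 1. This bounds all C*-seminorms on the generators at once.\<close>

lemma p_idempotent_le_1:
  assumes "x \<in> carrier A" "star A x = x" "x \<otimes> x = x"
  shows "p x \<le> 1"
  using p_star_mult[OF assms(1)] assms p_nonneg[OF assms(1)]
  by (metis mult.right_neutral mult_le_cancel_left_pos nle_le order_le_less power2_eq_square zero_le_one)

definition tends :: "(nat \<Rightarrow> 'a) \<Rightarrow> 'a \<Rightarrow> bool" where
  "tends u x \<longleftrightarrow> (\<forall>n. u n \<in> carrier A) \<and> x \<in> carrier A \<and> (\<lambda>n. p (u n \<ominus> x)) \<longlonglongrightarrow> 0"

definition cauchy :: "(nat \<Rightarrow> 'a) \<Rightarrow> bool" where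
  "cauchy u \<longleftrightarrow> (\<forall>n. u n \<in> carrier A) \<and> (\<forall>e>0. \<exists>N. \<forall>m\<ge>N. \<forall>n\<ge>N. p (u m \<ominus> u n) < e)"

lemma tends_closed: "tends u x \<Longrightarrow> u n \<in> carrier A" "tends u x \<Longrightarrow> x \<in> carrier A"
  and cauchy_closed: "cauchy u \<Longrightarrow> u n \<in> carrier A"
  by (auto simp: tends_def cauchy_def)

lemma tends_le:
  assumes "g \<longlonglongrightarrow> 0" "\<And>n. u n \<in> carrier A" "x \<in> carrier A" "\<And>n. p (u n \<ominus> x) \<le> g n"
  shows "tends u x"
  unfolding tends_def using assms
  by (auto intro!: tendsto_sandwich[OF _ _ tendsto_const assms(1)])

lemma tends_const: "x \<in> carrier A \<Longrightarrow> tends (\<lambda>n. x) x"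
  by (simp add: tends_def a_minus_def r_neg)

lemma tends_norm:
  assumes "tends u x"
  shows "(\<lambda>n. p (u n)) \<longlonglongrightarrow> p x"
proof (rule Lim_transform2[OF tendsto_const])
  have le: "\<bar>p x - p (u n)\<bar> \<le> p (u n \<ominus> x)" for n
    using p_diff_le[of x "u n"] p_minus_commute[of x "u n"] assms by (simp add: tends_def)
  show "(\<lambda>n. p x - p (u n)) \<longlonglongrightarrow> 0"
    by (rule tendsto_rabs_zero_cancel, rule tendsto_sandwich[of "\<lambda>_. 0" _ _ "\<lambda>n. p (u n \<ominus> x)"])
      (use assms le in \<open>auto simp: tends_def\<close>)
qed

lemma tends_add:
  assumes "tends u x" "tends v y"
  shows "tends (\<lambda>n. u n \<oplus> v n) (x \<oplus> y)"
  by (rule tends_le[of "\<lambda>n. p (u n \<ominus> x) + p (v n \<ominus> y)"])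
    (use assms tendsto_add[of "\<lambda>n. p (u n \<ominus> x)" 0 sequentially "\<lambda>n. p (v n \<ominus> y)" 0]
     in \<open>auto simp: tends_def p_add_diff\<close>)

lemma tends_mult:
  assumes "tends u x" "tends v y"
  shows "tends (\<lambda>n. u n \<otimes> v n) (x \<otimes> y)"
proof (rule tends_le)
  show "(\<lambda>n. p (u n \<ominus> x) * p (v n) + p x * p (v n \<ominus> y)) \<longlonglongrightarrow> 0"
    using assms tends_norm[OF assms(2)] by (auto simp: tends_def intro!: tendsto_eq_intros)
qed (use assms in \<open>auto simp: tends_def p_mult_diff\<close>)

lemma tends_smult:
  assumes "tends u x"
  shows "tends (\<lambda>n. c \<odot> u n) (c \<odot> x)"
  by (rule tends_le[of "\<lambda>n. cmod c * p (u n \<ominus> x)"])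
    (use assms in \<open>auto simp: tends_def p_smult_diff intro!: tendsto_eq_intros\<close>)

lemma tends_star: "tends u x \<Longrightarrow> tends (\<lambda>n. star A (u n)) (star A x)"
  by (simp add: tends_def p_star_diff)

text \<open>Limits for a seminorm are determined only up to elements of seminorm zero; in a
  C*-algebra this becomes uniqueness.\<close>

lemma tends_unique_norm:
  assumes "tends u x" "tends u y"
  shows "p (x \<ominus> y) = 0"
proof -
  have "p (x \<ominus> y) \<le> p (u n \<ominus> x) + p (u n \<ominus> y)" for n
    using p_triangle[of x "u n" y] assms by (simp add: tends_def p_minus_commute)
  moreover have "(\<lambda>n. p (u n \<ominus> x) + p (u n \<ominus> y)) \<longlonglongrightarrow> 0 + 0"
    using assms by (intro tendsto_add) (auto simp: tends_def)
  ultimately have "p (x \<ominus> y) \<le> 0"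
    by (intro LIMSEQ_le_const[of _ 0]) auto
  then show ?thesis using p_nonneg[of "x \<ominus> y"] assms by (auto simp: tends_def intro: antisym)
qed

text \<open>Closure of the Cauchy sequences under each operation reduces to one Lipschitz estimate;
  unary operations are covered by taking \<open>u\<close> and \<open>v\<close> equal.\<close>

lemma cauchy_le:
  assumes "cauchy u" "cauchy v" "\<And>n. w n \<in> carrier A"
    and le: "\<And>m n. p (w m \<ominus> w n) \<le> K * (p (u m \<ominus> u n) + p (v m \<ominus> v n))"
  shows "cauchy w"
  unfolding cauchy_def
proof (intro conjI allI impI)
  fix e :: real assume "e > 0"
  \<comment> \<open>Adding 1 to \<open>\<bar>K\<bar>\<close> makes the factor positive, so that
    \<open>e / (2 * L)\<close> is a legitimate tolerance for every \<open>K\<close>.\<close>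
  define L where "L = \<bar>K\<bar> + 1"
  have L: "L > 0" "K \<le> L" by (simp_all add: L_def)
  define d where "d = e / (2 * L)"
  have "d > 0" using \<open>e > 0\<close> L by (simp add: d_def)
  then obtain M N where M: "\<And>m n. m \<ge> M \<Longrightarrow> n \<ge> M \<Longrightarrow> p (u m \<ominus> u n) < d"
    and N: "\<And>m n. m \<ge> N \<Longrightarrow> n \<ge> N \<Longrightarrow> p (v m \<ominus> v n) < d"
    using assms(1,2) by (auto simp: cauchy_def) meson
  have "p (w m \<ominus> w n) < e" if "m \<ge> max M N" "n \<ge> max M N" for m n
  proof -
    have nonneg: "0 \<le> p (u m \<ominus> u n) + p (v m \<ominus> v n)"
      using assms by (simp add: cauchy_closed)
    have "p (w m \<ominus> w n) \<le> L * (p (u m \<ominus> u n) + p (v m \<ominus> v n))"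
      by (rule order_trans[OF le mult_right_mono[OF L(2) nonneg]])
    also have "\<dots> < L * (d + d)"
      by (rule mult_strict_left_mono) (use M[of m n] N[of m n] that L in auto)
    also have "\<dots> = e" using L by (simp add: d_def)
    finally show ?thesis .
  qed
  then show "\<exists>N. \<forall>m\<ge>N. \<forall>n\<ge>N. p (w m \<ominus> w n) < e" by blast
qed (rule assms)

lemma cauchy_const: "x \<in> carrier A \<Longrightarrow> cauchy (\<lambda>n. x)"
  by (auto simp: cauchy_def a_minus_def r_neg)

lemma cauchy_add: "\<lbrakk>cauchy u; cauchy v\<rbrakk> \<Longrightarrow> cauchy (\<lambda>n. u n \<oplus> v n)"
  by (rule cauchy_le[of u v _ 1]) (simp_all add: cauchy_closed p_add_diff)

lemma cauchy_smult: "cauchy u \<Longrightarrow> cauchy (\<lambda>n. c \<odot> u n)"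
  by (rule cauchy_le[of u u _ "cmod c"]) (simp_all add: cauchy_closed p_smult_diff distrib_left)

lemma cauchy_star: "cauchy u \<Longrightarrow> cauchy (\<lambda>n. star A (u n))"
  by (rule cauchy_le[of u u _ 1]) (simp_all add: cauchy_closed p_star_diff)

lemma cauchy_norm_convergent:
  assumes "cauchy u"
  shows "convergent (\<lambda>n. p (u n))"
proof (rule Cauchy_convergent, rule metric_CauchyI)
  fix e :: real assume "e > 0"
  then obtain N where N: "\<And>m n. m \<ge> N \<Longrightarrow> n \<ge> N \<Longrightarrow> p (u m \<ominus> u n) < e"
    using assms by (auto simp: cauchy_def) meson
  have "dist (p (u m)) (p (u n)) < e" if "m \<ge> N" "n \<ge> N" for m n
    using p_diff_le[of "u m" "u n"] N[OF that] assms by (simp add: cauchy_closed dist_real_def)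
  then show "\<exists>N. \<forall>m\<ge>N. \<forall>n\<ge>N. dist (p (u m)) (p (u n)) < e" by blast
qed

lemma cauchy_bounded:
  assumes "cauchy u"
  obtains K where "\<And>n. p (u n) \<le> K"
proof -
  have "Bseq (\<lambda>n. p (u n))"
    using cauchy_norm_convergent[OF assms] by (rule convergent_imp_Bseq)
  then obtain K where "\<And>n. \<bar>p (u n)\<bar> \<le> K"
    by (auto simp: Bseq_def)
  then show thesis using that abs_le_D1 by blast
qed

lemma cauchy_mult:
  assumes "cauchy u" "cauchy v"
  shows "cauchy (\<lambda>n. u n \<otimes> v n)"
proof -
  obtain K where K: "\<And>n. p (u n) \<le> K" using cauchy_bounded[OF assms(1)] by blast
  obtain L where L: "\<And>n. p (v n) \<le> L" using cauchy_bounded[OF assms(2)] by blast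
  note cl = cauchy_closed[OF assms(1)] cauchy_closed[OF assms(2)]
  show ?thesis
  proof (rule cauchy_le[OF assms, of _ "max K L"])
    fix m n
    have "p (u m \<otimes> v m \<ominus> u n \<otimes> v n) \<le> p (u m \<ominus> u n) * p (v m) + p (u n) * p (v m \<ominus> v n)"
      by (rule p_mult_diff) (simp_all add: cl)
    also have "\<dots> \<le> p (u m \<ominus> u n) * max K L + max K L * p (v m \<ominus> v n)"
      using K[of n] L[of m] by (intro add_mono mult_left_mono mult_right_mono) (auto simp: cl)
    finally show "p (u m \<otimes> v m \<ominus> u n \<otimes> v n) \<le> max K L * (p (u m \<ominus> u n) + p (v m \<ominus> v n))"
      by (simp add: algebra_simps)
  qed (simp add: cl)
qed

end

lemma cstar_seminorm_pullback:
  assumes "complex_star_algebra A" and h: "h \<in> star_hom A B" and q: "cstar_seminorm B q"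
  shows "cstar_seminorm A (\<lambda>x. q (h x))"
proof -
  interpret complex_star_algebra A by fact
  show ?thesis
    using q by (simp add: cstar_seminorm_def star_homD[OF h])
qed

section \<open>Suprema of C*-seminorms\<close>

text \<open>The C*-identity survives the supremum because squaring and the square root are monotone
  on nonnegative reals, so each inequality can be tested on the individual seminorms.\<close>

lemma cstar_seminorm_SUP:
  assumes "complex_star_algebra A" and "S \<noteq> {}" and S: "\<And>p. p \<in> S \<Longrightarrow> cstar_seminorm A p"
    and bdd: "\<And>x. x \<in> carrier A \<Longrightarrow> bdd_above ((\<lambda>p. p x) ` S)"
  shows "cstar_seminorm A (\<lambda>x. SUP p\<in>S. p x)"
proof -
  interpret complex_star_algebra A by fact
  define P where "P x = (SUP p\<in>S. p x)" for x
  have sn: "cstar_seminormed A p" if "p \<in> S" for p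
    using S[OF that] by unfold_locales
  have le: "p x \<le> P x" if "p \<in> S" "x \<in> carrier A" for p x
    unfolding P_def by (rule cSUP_upper[OF that(1) bdd[OF that(2)]])
  have least: "P x \<le> r" if "\<And>p. p \<in> S \<Longrightarrow> p x \<le> r" for x r
    unfolding P_def by (rule cSUP_least[OF \<open>S \<noteq> {}\<close> that])
  have nonneg: "0 \<le> P x" if "x \<in> carrier A" for x
    using \<open>S \<noteq> {}\<close> le[OF _ that] cstar_seminormed.p_nonneg[OF sn that] by (meson ex_in_conv order_trans)
  have "P (star A x \<otimes>\<^bsub>A\<^esub> x) = (P x)\<^sup>2" if x: "x \<in> carrier A" for x
  proof (rule antisym)
    show "P (star A x \<otimes>\<^bsub>A\<^esub> x) \<le> (P x)\<^sup>2"
    proof (rule least)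
      fix p assume p: "p \<in> S"
      interpret cstar_seminormed A p by (rule sn[OF p])
      show "p (star A x \<otimes>\<^bsub>A\<^esub> x) \<le> (P x)\<^sup>2"
        using le[OF p x] x by (simp add: p_star_mult power_mono)
    qed
    have "P x \<le> sqrt (P (star A x \<otimes>\<^bsub>A\<^esub> x))"
    proof (rule least)
      fix p assume p: "p \<in> S"
      interpret cstar_seminormed A p by (rule sn[OF p])
      show "p x \<le> sqrt (P (star A x \<otimes>\<^bsub>A\<^esub> x))"
        using le[OF p, of "star A x \<otimes>\<^bsub>A\<^esub> x"] x by (intro real_le_rsqrt) (simp add: p_star_mult)
    qed
    then show "(P x)\<^sup>2 \<le> P (star A x \<otimes>\<^bsub>A\<^esub> x)"
      using nonneg[OF x] nonneg[of "star A x \<otimes>\<^bsub>A\<^esub> x"] x by (simp add: real_le_rsqrt sqrt_ge_absD)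
  qed
  moreover have "P (c \<odot>\<^bsub>A\<^esub> x) = cmod c * P x" if x: "x \<in> carrier A" for c x
  proof (rule antisym)
    show "P (c \<odot>\<^bsub>A\<^esub> x) \<le> cmod c * P x"
      by (rule least) (use le x in \<open>auto simp: cstar_seminormed.p_smult[OF sn] mult_left_mono\<close>)
    show "cmod c * P x \<le> P (c \<odot>\<^bsub>A\<^esub> x)"
    proof (cases "c = 0")
      case False
      have "P x \<le> P (c \<odot>\<^bsub>A\<^esub> x) / cmod c"
      proof (rule least)
        fix p assume p: "p \<in> S"
        show "p x \<le> P (c \<odot>\<^bsub>A\<^esub> x) / cmod c"
          using le[OF p, of "c \<odot>\<^bsub>A\<^esub> x"] x False
          by (simp add: cstar_seminormed.p_smult[OF sn[OF p]] field_simps)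
      qed
      then show ?thesis using False by (simp add: field_simps)
    qed (use nonneg x in simp)
  qed
  moreover have "P (x \<oplus>\<^bsub>A\<^esub> y) \<le> P x + P y" if "x \<in> carrier A" "y \<in> carrier A" for x y
  proof (rule least)
    fix p assume p: "p \<in> S"
    show "p (x \<oplus>\<^bsub>A\<^esub> y) \<le> P x + P y"
      using cstar_seminormed.p_add[OF sn[OF p] that] le[OF p that(1)] le[OF p that(2)] by simp
  qed
  moreover have "P (x \<otimes>\<^bsub>A\<^esub> y) \<le> P x * P y" if "x \<in> carrier A" "y \<in> carrier A" for x y
  proof (rule least)
    fix p assume p: "p \<in> S"
    interpret cstar_seminormed A p by (rule sn[OF p])
    have "p x * p y \<le> P x * P y"
      using le[OF p] that nonneg by (intro mult_mono) auto
    then show "p (x \<otimes>\<^bsub>A\<^esub> y) \<le> P x * P y"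
      using p_mult[OF that] by simp
  qed
  ultimately show ?thesis
    using nonneg unfolding P_def cstar_seminorm_def by simp
qed

section \<open>C*-algebras\<close>

sublocale cstar_algebra \<subseteq> cstar_seminormed A "alg_norm A"
  by unfold_locales
    (simp add: cstar_seminorm_def norm_nonneg norm_add norm_smult norm_mult cstar_identity)

context cstar_algebra
begin

lemma tends_unique: "\<lbrakk>tends u x; tends u y\<rbrakk> \<Longrightarrow> x = y"
  using tends_unique_norm[of u x y] norm_eq_zero[of "x \<ominus> y"] tends_closed by force

lemma cauchy_tends:
  assumes "cauchy u"
  obtains x where "tends u x"
  using complete[of u] assms that by (auto simp: cauchy_def tends_def)

text \<open>If \<open>\<parallel>z\<parallel> < 1\<close>, the Neumann series \<open>y = z + z\<^sup>2 + \<dots>\<close> solves \<open>y = z + z y\<close>.\<close>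

lemma neumann_solution:
  assumes z: "z \<in> carrier A" and "alg_norm A z < 1"
  obtains y where "y \<in> carrier A" "y = z \<oplus> z \<otimes> y"
proof -
  let ?r = "alg_norm A z"
  have r: "0 \<le> ?r" "?r < 1" using assms by (simp_all add: norm_nonneg)
  \<comment> \<open>The iterates are the partial sums of the series: \<open>s n\<close> is
    \<open>z + z^2 + ... + z^n\<close>.\<close>
  define s where "s = rec_nat \<zero> (\<lambda>_ y. z \<oplus> z \<otimes> y)"
  have s0: "s 0 = \<zero>" and s_Suc: "s (Suc n) = z \<oplus> z \<otimes> s n" for n
    by (simp_all add: s_def)
  have s [simp]: "s n \<in> carrier A" for n
    by (induction n) (simp_all add: s0 s_Suc z)
  have diff_Suc: "alg_norm A (s (Suc m) \<ominus> s (Suc n)) \<le> ?r * alg_norm A (s m \<ominus> s n)" for m n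
  proof -
    have "alg_norm A (s (Suc m) \<ominus> s (Suc n)) \<le> alg_norm A (z \<ominus> z) + alg_norm A (z \<otimes> s m \<ominus> z \<otimes> s n)"
      unfolding s_Suc using z by (intro p_add_diff) auto
    also have "\<dots> \<le> ?r * alg_norm A (s m \<ominus> s n)"
      using p_mult_diff[of z "s m" z "s n"] z by (simp add: a_minus_def r_neg)
    finally show ?thesis .
  qed
  \<comment> \<open>\<open>?r / (1 - ?r)\<close> is the fixed point of
    \<open>t \<mapsto> ?r + ?r * t\<close>, hence the recursion preserves it as a bound.\<close>
  have bounded: "alg_norm A (s n) \<le> ?r / (1 - ?r)" for n
  proof (induction n)
    case (Suc n)
    have "alg_norm A (s (Suc n)) \<le> ?r + ?r * alg_norm A (s n)"
      unfolding s_Suc using p_add[of z "z \<otimes> s n"] p_mult[of z "s n"] z by simp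
    also have "\<dots> \<le> ?r + ?r * (?r / (1 - ?r))"
      using Suc r by (intro add_left_mono mult_left_mono) auto
    also have "\<dots> = ?r / (1 - ?r)" using r by (simp add: field_simps)
    finally show ?case .
  qed (use r in \<open>simp add: s0\<close>)
  \<comment> \<open>Each application of the recursion contracts distances by \<open>?r\<close>, so
    shifting both indices by \<open>k\<close> gains the factor \<open>?r ^ k\<close>; the rest is
    twice the uniform bound on the iterates.\<close>
  have dist: "alg_norm A (s (k + m) \<ominus> s (k + n)) \<le> ?r ^ k * (2 * (?r / (1 - ?r)))" for k m n
  proof (induction k)
    case 0
    have "alg_norm A (s m \<ominus> s n) \<le> alg_norm A (s m) + alg_norm A (s n)"
      using p_triangle[of "s m" \<zero> "s n"] by (simp add: p_minus_commute[of \<zero>]) (simp add: a_minus_def)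
    then show ?case using bounded[of m] bounded[of n] by simp
  next
    case (Suc k)
    show ?case
      using order_trans[OF diff_Suc mult_left_mono[OF Suc r(1)]] by (simp add: mult.assoc)
  qed
  have "cauchy s"
    unfolding cauchy_def
  proof (intro conjI allI impI)
    fix e :: real assume "e > 0"
    have "(\<lambda>k. ?r ^ k * (2 * (?r / (1 - ?r)))) \<longlonglongrightarrow> 0 * (2 * (?r / (1 - ?r)))"
      using r by (intro tendsto_mult tendsto_const LIMSEQ_power_zero) simp
    then obtain k where k: "?r ^ k * (2 * (?r / (1 - ?r))) < e"
      using order_tendstoD(2)[of _ 0 sequentially e] \<open>e > 0\<close>
      by (auto simp: eventually_sequentially)
    have "alg_norm A (s m \<ominus> s n) < e" if "m \<ge> k" "n \<ge> k" for m n
      using dist[of k "m - k" "n - k"] k that by simp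
    then show "\<exists>N. \<forall>m\<ge>N. \<forall>n\<ge>N. alg_norm A (s m \<ominus> s n) < e" by blast
  qed simp
  then obtain y where y: "tends s y" by (rule cauchy_tends)
  have "tends (\<lambda>n. s (Suc n)) (z \<oplus> z \<otimes> y)"
    unfolding s_Suc by (intro tends_add tends_mult tends_const z y)
  moreover have "tends (\<lambda>n. s (Suc n)) y"
    using y LIMSEQ_Suc[of "\<lambda>n. alg_norm A (s n \<ominus> y)"] by (auto simp: tends_def)
  ultimately show thesis
    using tends_unique that tends_closed y by metis
qed

text \<open>A violation can be scaled to some \<open>z\<close> with \<open>\<kappa> z = 1\<close>
  and norm below 1. Applying \<open>\<kappa>\<close> to \<open>y = z \<oplus> z \<otimes> y\<close>
  then gives \<open>\<kappa> y = 1 + \<kappa> y\<close>.\<close>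

lemma character_contractive:
  assumes \<kappa>: "\<kappa> \<in> star_hom A complex_numbers" and x: "x \<in> carrier A"
  shows "cmod (\<kappa> x) \<le> alg_norm A x"
proof (rule ccontr)
  assume less: "\<not> ?thesis"
  then have nz: "\<kappa> x \<noteq> 0" using x by auto
  define z where "z = (1 / \<kappa> x) \<odot> x"
  have z: "z \<in> carrier A" "\<kappa> z = 1" "alg_norm A z < 1"
    using x nz less star_hom_smult[OF \<kappa> x] by (simp_all add: z_def p_smult norm_divide field_simps)
  obtain y where "y \<in> carrier A" "y = z \<oplus> z \<otimes> y"
    using neumann_solution z by blast
  then have "\<kappa> y = 1 + \<kappa> y"
    using z star_hom_add[OF \<kappa>, of z "z \<otimes> y"] star_hom_mult[OF \<kappa>, of z y] by simp
  then show False by simp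
qed

end

text \<open>\<open>complex_numbers\<close> carries no norm. With the modulus added, characters
  become homomorphisms between C*-algebras, and the extension and uniqueness theorems for
  completions apply to them.\<close>

definition complex_cstar :: "complex normed_star_algebra" where
  "complex_cstar = star_algebra.extend complex_numbers (normed_star_algebra.fields cmod)"

lemma complex_cstar_simps [simp]:
  "carrier complex_cstar = UNIV" "mult complex_cstar = (*)" "one complex_cstar = 1"
  "zero complex_cstar = 0" "add complex_cstar = (+)" "smult complex_cstar = (*)"
  "star complex_cstar = cnj" "alg_norm complex_cstar = cmod"
  by (simp_all add: complex_cstar_def star_algebra.defs normed_star_algebra.defs)

lemma star_hom_complex_cstar: "star_hom A complex_cstar = star_hom A complex_numbers"
  by (auto simp: star_hom_iff)

lemma complex_star_algebra_complex_numbers: "complex_star_algebra complex_numbers"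
  by (rule complex_star_algebraI) (simp_all add: algebra_simps)

lemma cstar_algebra_complex: "cstar_algebra complex_cstar"
proof -
  interpret complex_star_algebra complex_cstar
    by (rule complex_star_algebraI) (simp_all add: algebra_simps)
  have minus: "x \<ominus>\<^bsub>complex_cstar\<^esub> y = x - y" for x y
    by (simp add: minus_eq_smult)
  show ?thesis
  proof unfold_locales
    fix u :: "nat \<Rightarrow> complex"
    assume "\<forall>e>0. \<exists>N. \<forall>m\<ge>N. \<forall>n\<ge>N. alg_norm complex_cstar (u m \<ominus>\<^bsub>complex_cstar\<^esub> u n) < e"
    then have "Cauchy u"
      by (simp add: minus Cauchy_def dist_norm)
    then obtain x where "u \<longlonglongrightarrow> x"
      using Cauchy_convergent convergent_def by blast
    then have "(\<lambda>n. alg_norm complex_cstar (u n \<ominus>\<^bsub>complex_cstar\<^esub> x)) \<longlonglongrightarrow> 0"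
      by (simp add: minus tendsto_norm_zero LIM_zero)
    then show "\<exists>x\<in>carrier complex_cstar. (\<lambda>n. alg_norm complex_cstar (u n \<ominus>\<^bsub>complex_cstar\<^esub> x)) \<longlonglongrightarrow> 0"
      by auto
  qed (simp_all add: norm_triangle_ineq norm_mult power2_eq_square)
qed

lemma cstar_seminorm_cmod: "cstar_seminorm complex_numbers cmod"
  by (simp add: cstar_seminorm_def norm_triangle_ineq norm_mult power2_eq_square)

section \<open>Completions\<close>

context cstar_seminormed
begin

abbreviation C where "C \<equiv> cauchy_algebra A p"
abbreviation N where "N \<equiv> null_sequences A p"
abbreviation compl where "compl \<equiv> completion A p"
abbreviation cls where "cls u \<equiv> N +>\<^bsub>C\<^esub> u"
abbreviation \<iota> where "\<iota> \<equiv> to_completion A p"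

lemma C_simps:
  "carrier C = {u. cauchy u}" "u \<otimes>\<^bsub>C\<^esub> v = (\<lambda>n. u n \<otimes> v n)" "\<one>\<^bsub>C\<^esub> = (\<lambda>n. \<one>)" "\<zero>\<^bsub>C\<^esub> = (\<lambda>n. \<zero>)"
  "u \<oplus>\<^bsub>C\<^esub> v = (\<lambda>n. u n \<oplus> v n)" "c \<odot>\<^bsub>C\<^esub> u = (\<lambda>n. c \<odot> u n)" "star C u = (\<lambda>n. star A (u n))"
  by (simp_all add: cauchy_algebra_def cauchy_def)

lemma cauchyE:
  assumes "cauchy u" "e > 0"
  obtains K where "\<And>m n. \<lbrakk>m \<ge> K; n \<ge> K\<rbrakk> \<Longrightarrow> p (u m \<ominus> u n) < e"
  using assms unfolding cauchy_def by meson

lemma cauchy_algebra: "complex_star_algebra C"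
proof (rule complex_star_algebraI)
  have "(-1) \<odot> x \<oplus> x = \<zero>" if "x \<in> carrier A" for x
    using that l_neg[of x] by (simp add: uminus_eq_smult)
  then show "(-1) \<odot>\<^bsub>C\<^esub> u \<oplus>\<^bsub>C\<^esub> u = \<zero>\<^bsub>C\<^esub>" if "u \<in> carrier C" for u
    using that by (simp add: C_simps cauchy_closed)
qed (auto simp: C_simps fun_eq_iff cauchy_closed cauchy_const cauchy_add cauchy_mult cauchy_smult cauchy_star
    a_ac m_assoc l_distr r_distr smult_add_left smult_add_right smult_smult
    smult_mult_left smult_mult_right star_add star_mult star_smult)

lemma C_minus: "\<lbrakk>cauchy u; cauchy v\<rbrakk> \<Longrightarrow> u \<ominus>\<^bsub>C\<^esub> v = (\<lambda>n. u n \<ominus> v n)"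
  using complex_star_algebra.minus_eq_smult[OF cauchy_algebra, of u v]
  by (simp add: C_simps minus_eq_smult cauchy_closed)

lemma N_iff_tends: "u \<in> N \<longleftrightarrow> tends u \<zero>"
  by (auto simp: null_sequences_def tends_def a_minus_def)

lemma tends_cauchy:
  assumes "tends u x"
  shows "cauchy u"
  unfolding cauchy_def
proof (intro conjI allI impI)
  fix e :: real assume "e > 0"
  then obtain K where K: "\<And>n. n \<ge> K \<Longrightarrow> p (u n \<ominus> x) < e / 2"
    using assms order_tendstoD(2)[of "\<lambda>n. p (u n \<ominus> x)" 0 sequentially "e/2"]
    by (auto simp: tends_def eventually_sequentially)
  have "p (u m \<ominus> u n) < e" if "m \<ge> K" "n \<ge> K" for m n
    using p_triangle[of "u m" x "u n"] K[of m] K[of n] that tends_closed[OF assms]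
    by (simp add: p_minus_commute[of x])
  then show "\<exists>K. \<forall>m\<ge>K. \<forall>n\<ge>K. p (u m \<ominus> u n) < e" by blast
qed (rule tends_closed[OF assms])

text \<open>Cauchy sequences are bounded, so a null sequence stays null after multiplication from
  either side; this makes \<open>N\<close> an ideal.\<close>

lemma tends_zero_mult:
  assumes "tends u \<zero>" "cauchy v"
  shows "tends (\<lambda>n. u n \<otimes> v n) \<zero>" "tends (\<lambda>n. v n \<otimes> u n) \<zero>"
proof -
  obtain K where K: "\<And>n. p (v n) \<le> K" using cauchy_bounded[OF assms(2)] by blast
  note cl = tends_closed[OF assms(1)] cauchy_closed[OF assms(2)]
  have lim: "(\<lambda>n. p (u n) * K) \<longlonglongrightarrow> 0"
    using tends_norm[OF assms(1)] by (auto intro!: tendsto_eq_intros)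
  show "tends (\<lambda>n. u n \<otimes> v n) \<zero>"
    by (rule tends_le[OF lim])
      (use cl order_trans[OF p_mult mult_left_mono[OF K]] in \<open>auto simp: a_minus_def\<close>)
  have le: "p (v n \<otimes> u n) \<le> p (u n) * K" for n
    using order_trans[OF p_mult mult_right_mono[OF K[of n]], of "u n"] cl by (simp add: mult.commute)
  show "tends (\<lambda>n. v n \<otimes> u n) \<zero>"
    by (rule tends_le[OF lim]) (use cl le in \<open>auto simp: a_minus_def\<close>)
qed

sublocale N: star_ideal C N
proof -
  interpret C: complex_star_algebra C by (rule cauchy_algebra)
  have "ideal N C"
  proof (rule idealI)
    show "subgroup N (add_monoid C)"
    proof (rule C.add.subgroupI)
      show "N \<noteq> {}" using tends_const[of \<zero>] by (auto simp: N_iff_tends)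
    next
      fix u assume "u \<in> N"
      then show "\<ominus>\<^bsub>C\<^esub> u \<in> N"
        using tends_smult[of u \<zero> "-1"] C.uminus_eq_smult[of u] by (simp add: N_iff_tends C_simps tends_cauchy)
    next
      fix u v assume "u \<in> N" "v \<in> N"
      then show "u \<oplus>\<^bsub>C\<^esub> v \<in> N"
        using tends_add[of u \<zero> v \<zero>] by (simp add: N_iff_tends C_simps)
    qed (auto simp: N_iff_tends C_simps tends_cauchy)
  qed (auto simp: C.is_ring N_iff_tends C_simps tends_zero_mult)
  moreover have "star C u \<in> N" if "u \<in> N" for u
    using that tends_star[of u \<zero>] by (simp add: N_iff_tends C_simps)
  ultimately show "star_ideal C N"
    by (simp add: star_ideal.intro cauchy_algebra star_ideal_axioms.intro)
qed

lemma compl_simps: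
  "carrier compl = carrier N.Q" "mult compl = mult N.Q" "one compl = one N.Q" "zero compl = zero N.Q"
  "add compl = add N.Q" "smult compl = smult N.Q" "star compl = star N.Q"
  by (simp_all add: completion_def star_algebra.defs normed_star_algebra.defs)

lemma carrier_compl: "carrier compl = cls ` {u. cauchy u}"
  by (simp add: compl_simps N.carrier_Q C_simps)

lemma cls_simps:
  "\<lbrakk>cauchy u; cauchy v\<rbrakk> \<Longrightarrow> cls u \<oplus>\<^bsub>compl\<^esub> cls v = cls (\<lambda>n. u n \<oplus> v n)"
  "\<lbrakk>cauchy u; cauchy v\<rbrakk> \<Longrightarrow> cls u \<otimes>\<^bsub>compl\<^esub> cls v = cls (\<lambda>n. u n \<otimes> v n)"
  "cauchy u \<Longrightarrow> c \<odot>\<^bsub>compl\<^esub> cls u = cls (\<lambda>n. c \<odot> u n)"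
  "cauchy u \<Longrightarrow> star compl (cls u) = cls (\<lambda>n. star A (u n))"
  "\<one>\<^bsub>compl\<^esub> = cls (\<lambda>n. \<one>)" "\<zero>\<^bsub>compl\<^esub> = cls (\<lambda>n. \<zero>)"
  using N.coset_add[of u v] N.coset_mult[of u v] N.coset_smult[of u c] N.coset_star[of u] N.one_Q N.zero_Q
  by (simp_all add: compl_simps C_simps)

lemma complex_star_algebra_compl: "complex_star_algebra compl"
  by (rule complex_star_algebra_image[OF N.quotient_star_algebra, of _ id])
    (simp_all add: compl_simps)

lemma cls_closed: "cauchy u \<Longrightarrow> cls u \<in> carrier compl"
  by (simp add: carrier_compl)

lemma cls_minus: "\<lbrakk>cauchy u; cauchy v\<rbrakk> \<Longrightarrow> cls u \<ominus>\<^bsub>compl\<^esub> cls v = cls (\<lambda>n. u n \<ominus> v n)"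
  using complex_star_algebra.minus_eq_smult[OF complex_star_algebra_compl, of "cls u" "cls v"]
  by (simp add: cls_closed cls_simps cauchy_smult minus_eq_smult cauchy_closed)

text \<open>The norm of a class is a definite description. Representatives differ by a null
  sequence, hence their seminorms have the same limit.\<close>

lemma norm_cls:
  assumes "cauchy u"
  shows "(\<lambda>n. p (u n)) \<longlonglongrightarrow> alg_norm compl (cls u)"
proof -
  obtain r where r: "(\<lambda>n. p (u n)) \<longlonglongrightarrow> r"
    using cauchy_norm_convergent[OF assms] by (auto simp: convergent_def)
  have u: "u \<in> carrier C" using assms by (simp add: C_simps)
  have "(THE r. \<exists>v\<in>cls u. (\<lambda>n. p (v n)) \<longlonglongrightarrow> r) = r"
  proof (rule the_equality)
    show "\<exists>v\<in>cls u. (\<lambda>n. p (v n)) \<longlonglongrightarrow> r"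
      using r N.a_rcos_self[OF u] by blast
  next
    fix r' assume "\<exists>v\<in>cls u. (\<lambda>n. p (v n)) \<longlonglongrightarrow> r'"
    then obtain v where v: "v \<in> cls u" "(\<lambda>n. p (v n)) \<longlonglongrightarrow> r'" by blast
    then have cv: "cauchy v" and "v \<ominus>\<^bsub>C\<^esub> u \<in> N"
      using N.mem_coset_iff[OF u] by (auto simp: C_simps)
    then have "(\<lambda>n. p (v n \<ominus> u n)) \<longlonglongrightarrow> 0"
      using assms by (simp add: C_minus null_sequences_def)
    then have "(\<lambda>n. p (v n) - p (u n)) \<longlonglongrightarrow> 0"
      by (rule tendsto_0_le[of _ _ _ 1]) (simp add: p_diff_le cauchy_closed cv assms)
    then have "(\<lambda>n. p (v n)) \<longlonglongrightarrow> r"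
      using Lim_transform[OF r] by simp
    then show "r' = r" using v(2) LIMSEQ_unique by blast
  qed
  then show ?thesis
    using r by (simp add: completion_def star_algebra.defs normed_star_algebra.defs)
qed

lemma norm_cls_eqI: "\<lbrakk>cauchy u; (\<lambda>n. p (u n)) \<longlonglongrightarrow> r\<rbrakk> \<Longrightarrow> alg_norm compl (cls u) = r"
  using LIMSEQ_unique norm_cls by blast

lemma norm_cls_le:
  assumes "cauchy u" "\<And>n. n \<ge> K \<Longrightarrow> p (u n) \<le> r"
  shows "alg_norm compl (cls u) \<le> r"
  by (rule LIMSEQ_le_const2[OF norm_cls[OF assms(1)]]) (use assms(2) in blast)

lemma \<iota>_eq: "\<iota> a = cls (\<lambda>n. a)"
  by (simp add: to_completion_def)

lemma \<iota>_hom: "\<iota> \<in> star_hom A compl"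
  by (simp add: star_hom_iff \<iota>_eq cls_simps cls_closed cauchy_const)

lemma norm_\<iota>: "a \<in> carrier A \<Longrightarrow> alg_norm compl (\<iota> a) = p a"
  unfolding \<iota>_eq by (rule norm_cls_eqI) (simp_all add: cauchy_const)

text \<open>A Cauchy sequence, viewed in the completion, converges to its own class: for fixed
  \<open>m\<close> the distance is the limit of \<open>p (u m \<ominus> u n)\<close> over
  \<open>n\<close>.\<close>

lemma cls_limit:
  assumes u: "cauchy u"
  shows "(\<lambda>n. alg_norm compl (\<iota> (u n) \<ominus>\<^bsub>compl\<^esub> cls u)) \<longlonglongrightarrow> 0"
proof (rule LIMSEQ_I)
  fix e :: real assume "e > 0"
  then obtain K where K: "\<And>m n. m \<ge> K \<Longrightarrow> n \<ge> K \<Longrightarrow> p (u m \<ominus> u n) < e / 2"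
    using cauchyE[OF u, of "e / 2"] by auto
  have "norm (alg_norm compl (\<iota> (u m) \<ominus>\<^bsub>compl\<^esub> cls u) - 0) < e" if "m \<ge> K" for m
  proof -
    note c = cauchy_const[OF cauchy_closed[OF u]]
    have eq: "\<iota> (u m) \<ominus>\<^bsub>compl\<^esub> cls u = cls (\<lambda>n. u m \<ominus> u n)"
      unfolding \<iota>_eq by (rule cls_minus) (simp_all add: c u)
    have cau: "cauchy (\<lambda>n. u m \<ominus> u n)"
      using cauchy_add[OF c cauchy_smult[OF u]] by (simp add: minus_eq_smult cauchy_closed[OF u])
    have "alg_norm compl (cls (\<lambda>n. u m \<ominus> u n)) \<le> e / 2"
      by (rule norm_cls_le[OF cau, of K]) (use K that in \<open>simp add: less_imp_le\<close>)
    moreover have "0 \<le> alg_norm compl (cls (\<lambda>n. u m \<ominus> u n))"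
      by (rule LIMSEQ_le_const[OF norm_cls[OF cau]]) (simp add: cauchy_closed[OF u])
    ultimately show ?thesis using \<open>e > 0\<close> by (simp add: eq)
  qed
  then show "\<exists>K. \<forall>m\<ge>K. norm (alg_norm compl (\<iota> (u m) \<ominus>\<^bsub>compl\<^esub> cls u) - 0) < e" by blast
qed

lemma \<iota>_dense:
  assumes "X \<in> carrier compl" "e > 0"
  obtains a where "a \<in> carrier A" "alg_norm compl (\<iota> a \<ominus>\<^bsub>compl\<^esub> X) < e"
proof -
  obtain u where u: "cauchy u" "X = cls u" using assms(1) by (auto simp: carrier_compl)
  obtain n where "alg_norm compl (\<iota> (u n) \<ominus>\<^bsub>compl\<^esub> X) < e"
    using order_tendstoD(2)[OF cls_limit[OF u(1)] assms(2)] u(2) by (auto simp: eventually_sequentially)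
  then show thesis
    using that[of "u n"] cauchy_closed[OF u(1)] by simp
qed

theorem cstar_algebra_compl: "cstar_algebra compl"
proof -
  interpret K: complex_star_algebra compl by (rule complex_star_algebra_compl)
  have cases: "\<exists>u. X = cls u \<and> cauchy u \<and> (\<lambda>n. p (u n)) \<longlonglongrightarrow> alg_norm compl X"
    if "X \<in> carrier compl" for X
    using that norm_cls by (auto simp: carrier_compl)
  have sn: "cstar_seminorm compl (alg_norm compl)"
    unfolding cstar_seminorm_def
  proof (intro ballI conjI allI)
    fix X assume "X \<in> carrier compl"
    then obtain u where u: "X = cls u" "cauchy u" and lu: "(\<lambda>n. p (u n)) \<longlonglongrightarrow> alg_norm compl X"
      using cases by blast
    show "0 \<le> alg_norm compl X"
      by (rule LIMSEQ_le_const[OF lu]) (simp add: cauchy_closed u)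
    have "(\<lambda>n. (p (u n))\<^sup>2) \<longlonglongrightarrow> (alg_norm compl X)\<^sup>2"
      by (intro tendsto_power lu)
    then have "(\<lambda>n. p (star A (u n) \<otimes> u n)) \<longlonglongrightarrow> (alg_norm compl X)\<^sup>2"
      by (simp add: p_star_mult cauchy_closed[OF u(2)])
    then show "alg_norm compl (star compl X \<otimes>\<^bsub>compl\<^esub> X) = (alg_norm compl X)\<^sup>2"
      using u by (simp add: cls_simps cauchy_star cauchy_mult norm_cls_eqI)
    have "(\<lambda>n. p (c \<odot> u n)) \<longlonglongrightarrow> cmod c * alg_norm compl X" for c
      using tendsto_mult_left[OF lu, of "cmod c"] by (simp add: p_smult cauchy_closed[OF u(2)])
    then show "alg_norm compl (c \<odot>\<^bsub>compl\<^esub> X) = cmod c * alg_norm compl X" for c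
      using u by (simp add: cls_simps cauchy_smult norm_cls_eqI)
    fix Y assume "Y \<in> carrier compl"
    then obtain v where v: "Y = cls v" "cauchy v" and lv: "(\<lambda>n. p (v n)) \<longlonglongrightarrow> alg_norm compl Y"
      using cases by blast
    have "alg_norm compl (cls (\<lambda>n. u n \<oplus> v n)) \<le> alg_norm compl X + alg_norm compl Y"
      by (rule LIMSEQ_le[OF norm_cls tendsto_add[OF lu lv]])
        (simp_all add: u v cauchy_add p_add cauchy_closed)
    then show "alg_norm compl (X \<oplus>\<^bsub>compl\<^esub> Y) \<le> alg_norm compl X + alg_norm compl Y"
      using u v by (simp add: cls_simps)
    have "alg_norm compl (cls (\<lambda>n. u n \<otimes> v n)) \<le> alg_norm compl X * alg_norm compl Y"
      by (rule LIMSEQ_le[OF norm_cls tendsto_mult[OF lu lv]])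
        (simp_all add: u v cauchy_mult p_mult cauchy_closed)
    then show "alg_norm compl (X \<otimes>\<^bsub>compl\<^esub> Y) \<le> alg_norm compl X * alg_norm compl Y"
      using u v by (simp add: cls_simps)
  qed
  interpret K: cstar_seminormed compl "alg_norm compl"
    by unfold_locales (rule sn)
  show ?thesis
  proof (unfold_locales)
    fix X assume X: "X \<in> carrier compl"
    then obtain u where u: "X = cls u" "cauchy u" and lu: "(\<lambda>n. p (u n)) \<longlonglongrightarrow> alg_norm compl X"
      using cases by blast
    have "X = \<zero>\<^bsub>compl\<^esub>" if "alg_norm compl X = 0"
    proof -
      have "u \<in> N" using lu that u by (simp add: null_sequences_def cauchy_closed)
      then show ?thesis
        using N.coset_eq_zero_iff[of u] N.coset_eq_zero_iff[of "\<zero>\<^bsub>C\<^esub>"] u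
        by (simp add: cls_simps C_simps N_iff_tends tends_const cauchy_const)
    qed
    then show "alg_norm compl X = 0 \<longleftrightarrow> X = \<zero>\<^bsub>compl\<^esub>" by auto
  next
    fix U :: "nat \<Rightarrow> (nat \<Rightarrow> 'a) set" assume U: "\<And>n. U n \<in> carrier compl"
      and cauchy_U: "\<forall>e>0. \<exists>K. \<forall>m\<ge>K. \<forall>n\<ge>K. alg_norm compl (U m \<ominus>\<^bsub>compl\<^esub> U n) < e"
    \<comment> \<open>Completeness by approximation: \<open>U n\<close> is replaced by an element of
      \<open>A\<close> at distance below \<open>1 / (n + 1)\<close>. These elements form a Cauchy
      sequence, and its class is the limit of \<open>U\<close>.\<close>
    have "\<exists>a. a \<in> carrier A \<and> alg_norm compl (\<iota> a \<ominus>\<^bsub>compl\<^esub> U n) < inverse (real (Suc n))" for n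
      using \<iota>_dense[OF U[of n], of "inverse (real (Suc n))"] by auto
    then obtain a where a: "\<And>n. a n \<in> carrier A"
      and a_le: "\<And>n. alg_norm compl (\<iota> (a n) \<ominus>\<^bsub>compl\<^esub> U n) < inverse (real (Suc n))"
      by metis
    have \<iota>a: "\<iota> (a n) \<in> carrier compl" for n
      using star_hom_closed[OF \<iota>_hom a] .
    have lim: "(\<lambda>n. alg_norm compl (\<iota> (a n) \<ominus>\<^bsub>compl\<^esub> U n)) \<longlonglongrightarrow> 0"
      by (rule tendsto_sandwich[OF _ _ tendsto_const LIMSEQ_inverse_real_of_nat])
        (use a_le \<iota>a U in \<open>auto intro!: always_eventually less_imp_le\<close>)
    have "cauchy a"
      unfolding cauchy_def
    proof (intro conjI allI impI a)
      fix e :: real assume "e > 0"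
      then obtain K where K: "\<And>m n. m \<ge> K \<Longrightarrow> n \<ge> K \<Longrightarrow> alg_norm compl (U m \<ominus>\<^bsub>compl\<^esub> U n) < e / 3"
        using cauchy_U[rule_format, of "e / 3"] by auto
      obtain L where L: "\<And>n. n \<ge> L \<Longrightarrow> alg_norm compl (\<iota> (a n) \<ominus>\<^bsub>compl\<^esub> U n) < e / 3"
        using order_tendstoD(2)[OF lim, of "e / 3"] \<open>e > 0\<close> by (auto simp: eventually_sequentially)
      have "p (a m \<ominus> a n) < e" if "m \<ge> max K L" "n \<ge> max K L" for m n
      proof -
        have "p (a m \<ominus> a n) = alg_norm compl (\<iota> (a m) \<ominus>\<^bsub>compl\<^esub> \<iota> (a n))"
          using norm_\<iota>[of "a m \<ominus> a n"] a star_homD[OF \<iota>_hom]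
          by (simp add: minus_eq_smult K.minus_eq_smult \<iota>a)
        also have "\<dots> \<le> alg_norm compl (\<iota> (a m) \<ominus>\<^bsub>compl\<^esub> U m)
            + (alg_norm compl (U m \<ominus>\<^bsub>compl\<^esub> U n) + alg_norm compl (U n \<ominus>\<^bsub>compl\<^esub> \<iota> (a n)))"
          using K.p_triangle[OF \<iota>a[of m] U[of m] \<iota>a[of n]] K.p_triangle[OF U[of m] U[of n] \<iota>a[of n]] by simp
        also have "\<dots> < e"
          using K[of m n] L[of m] L[of n] that K.p_minus_commute[OF U[of n] \<iota>a[of n]] by simp
        finally show ?thesis .
      qed
      then show "\<exists>K. \<forall>m\<ge>K. \<forall>n\<ge>K. p (a m \<ominus> a n) < e" by blast
    qed
    then have lim': "(\<lambda>n. alg_norm compl (\<iota> (a n) \<ominus>\<^bsub>compl\<^esub> cls a)) \<longlonglongrightarrow> 0"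
      and cls: "cls a \<in> carrier compl"
      by (rule cls_limit, simp add: cls_closed)
    have "(\<lambda>n. alg_norm compl (U n \<ominus>\<^bsub>compl\<^esub> cls a)) \<longlonglongrightarrow> 0"
    proof (rule tendsto_sandwich[OF _ _ tendsto_const])
      show "(\<lambda>n. alg_norm compl (\<iota> (a n) \<ominus>\<^bsub>compl\<^esub> U n) + alg_norm compl (\<iota> (a n) \<ominus>\<^bsub>compl\<^esub> cls a)) \<longlonglongrightarrow> 0"
        using tendsto_add[OF lim lim'] by simp
      show "\<forall>\<^sub>F n in sequentially. alg_norm compl (U n \<ominus>\<^bsub>compl\<^esub> cls a)
          \<le> alg_norm compl (\<iota> (a n) \<ominus>\<^bsub>compl\<^esub> U n) + alg_norm compl (\<iota> (a n) \<ominus>\<^bsub>compl\<^esub> cls a)"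
        using K.p_triangle[OF U \<iota>a cls] K.p_minus_commute[OF U \<iota>a]
        by (auto intro!: always_eventually)
    qed (use U cls in \<open>auto intro!: always_eventually\<close>)
    with cls show "\<exists>X\<in>carrier compl. (\<lambda>n. alg_norm compl (U n \<ominus>\<^bsub>compl\<^esub> X)) \<longlonglongrightarrow> 0" by blast
  qed (rule K.p_nonneg K.p_add K.p_smult K.p_mult K.p_star_mult; assumption)+
qed

text \<open>Contractivity turns Cauchy sequences into Cauchy sequences and null sequences into null
  sequences, so the limit of the images in \<open>B\<close> depends only on the class.\<close>

theorem extend_to_completion:
  assumes "cstar_algebra B" and h: "h \<in> star_hom A B"
    and le: "\<And>x. x \<in> carrier A \<Longrightarrow> alg_norm B (h x) \<le> p x"
  obtains H where "H \<in> star_hom compl B" "\<And>a. a \<in> carrier A \<Longrightarrow> H (\<iota> a) = h a"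
    "\<And>X. X \<in> carrier compl \<Longrightarrow> alg_norm B (H X) \<le> alg_norm compl X"
proof -
  interpret B: cstar_algebra B by fact
  interpret h: star_algebra_hom A B h
    by (rule star_algebra_homI[OF complex_star_algebra_axioms B.complex_star_algebra_axioms h])
  have diff: "alg_norm B (h x \<ominus>\<^bsub>B\<^esub> h y) \<le> p (x \<ominus> y)" if "x \<in> carrier A" "y \<in> carrier A" for x y
    using le[of "x \<ominus> y"] that by (simp add: h.hom_minus)
  have hu: "B.cauchy (\<lambda>n. h (u n))" if u: "cauchy u" for u
    unfolding B.cauchy_def
  proof (intro conjI allI impI)
    fix e :: real assume "e > 0"
    then obtain K where "\<And>m n. \<lbrakk>m \<ge> K; n \<ge> K\<rbrakk> \<Longrightarrow> p (u m \<ominus> u n) < e"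
      using cauchyE[OF u] by blast
    then show "\<exists>K. \<forall>m\<ge>K. \<forall>n\<ge>K. alg_norm B (h (u m) \<ominus>\<^bsub>B\<^esub> h (u n)) < e"
      using diff[OF cauchy_closed cauchy_closed, OF u u] order_le_less_trans by blast
  qed (simp add: cauchy_closed[OF u])
  \<comment> \<open>The choice has a single candidate on Cauchy sequences, since limits in a
    C*-algebra are unique.\<close>
  define L where "L u = (SOME y. B.tends (\<lambda>n. h (u n)) y)" for u
  have L: "B.tends (\<lambda>n. h (u n)) (L u)" if "cauchy u" for u
    unfolding L_def using B.cauchy_tends[OF hu[OF that]] by (metis someI_ex)
  have L_eqI: "L u = y" if "cauchy u" "B.tends (\<lambda>n. h (u n)) y" for u y
    using B.tends_unique[OF L that(2)] that(1) .
  have "L \<in> star_hom C B"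
    unfolding star_hom_iff C_simps mem_Collect_eq
  proof (intro conjI ballI allI)
    fix u assume "u \<in> {u. cauchy u}"
    then have u: "cauchy u" by simp
    note uc = cauchy_closed[OF u]
    show "L u \<in> carrier B" by (rule B.tends_closed[OF L[OF u]])
    show "L (\<lambda>n. c \<odot> u n) = c \<odot>\<^bsub>B\<^esub> L u" for c
      by (rule L_eqI) (use B.tends_smult[OF L[OF u]] in \<open>simp_all add: u uc cauchy_smult\<close>)
    show "L (\<lambda>n. star A (u n)) = star B (L u)"
      by (rule L_eqI) (use B.tends_star[OF L[OF u]] in \<open>simp_all add: u uc cauchy_star\<close>)
    fix v assume "v \<in> {u. cauchy u}"
    then have v: "cauchy v" by simp
    note vc = cauchy_closed[OF v]
    show "L (\<lambda>n. u n \<oplus> v n) = L u \<oplus>\<^bsub>B\<^esub> L v"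
      by (rule L_eqI) (use B.tends_add[OF L[OF u] L[OF v]] in \<open>simp_all add: u v uc vc cauchy_add\<close>)
    show "L (\<lambda>n. u n \<otimes> v n) = L u \<otimes>\<^bsub>B\<^esub> L v"
      by (rule L_eqI) (use B.tends_mult[OF L[OF u] L[OF v]] in \<open>simp_all add: u v uc vc cauchy_mult\<close>)
  next
    show "L (\<lambda>n. \<one>) = \<one>\<^bsub>B\<^esub>"
      by (rule L_eqI) (simp_all add: cauchy_const B.tends_const)
  qed
  moreover have "L u = \<zero>\<^bsub>B\<^esub>" if "u \<in> N" for u
  proof (rule L_eqI)
    have u: "tends u \<zero>" using that by (simp add: N_iff_tends)
    then show "cauchy u" by (rule tends_cauchy)
    show "B.tends (\<lambda>n. h (u n)) \<zero>\<^bsub>B\<^esub>"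
      by (rule B.tends_le[of "\<lambda>n. p (u n \<ominus> \<zero>)"])
        (use u diff[of "u _" \<zero>] in \<open>auto simp: tends_def\<close>)
  qed
  ultimately obtain H where H: "H \<in> star_hom N.Q B" and H_cls: "\<And>u. u \<in> carrier C \<Longrightarrow> H (cls u) = L u"
    using N.quotient_universal[OF B.complex_star_algebra_axioms] by blast
  have H_hom: "H \<in> star_hom compl B"
    using H by (simp add: star_hom_iff compl_simps)
  show thesis
  proof (rule that[OF H_hom])
    show "H (\<iota> a) = h a" if "a \<in> carrier A" for a
      using that by (simp add: \<iota>_eq H_cls C_simps cauchy_const L_eqI B.tends_const)
    show "alg_norm B (H X) \<le> alg_norm compl X" if "X \<in> carrier compl" for X
    proof -
      from that obtain u where u: "X = cls u" "cauchy u" by (auto simp: carrier_compl)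
      then have "H X = L u" by (simp add: H_cls C_simps)
      then show ?thesis
        using LIMSEQ_le[OF B.tends_norm[OF L[OF u(2)]] norm_cls[OF u(2)]] le cauchy_closed[OF u(2)] u by auto
    qed
  qed
qed

text \<open>Bounded homomorphisms that agree on a dense subalgebra are equal. The constants
  \<open>c\<close> and \<open>d\<close> are arbitrary because the specification of the coproduct
  leaves its bound open.\<close>

theorem completion_hom_eqI:
  assumes "cstar_algebra B" and H: "H \<in> star_hom compl B" and K: "K \<in> star_hom compl B"
    and bound: "\<And>X. X \<in> carrier compl \<Longrightarrow> alg_norm B (H X) \<le> c * alg_norm compl X"
      "\<And>X. X \<in> carrier compl \<Longrightarrow> alg_norm B (K X) \<le> d * alg_norm compl X"
    and eq: "\<And>a. a \<in> carrier A \<Longrightarrow> H (\<iota> a) = K (\<iota> a)"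
    and X: "X \<in> carrier compl"
  shows "H X = K X"
proof -
  interpret B: cstar_algebra B by fact
  interpret T: cstar_algebra compl by (rule cstar_algebra_compl)
  interpret H: star_algebra_hom compl B H
    by (rule star_algebra_homI[OF T.complex_star_algebra_axioms B.complex_star_algebra_axioms H])
  interpret K: star_algebra_hom compl B K
    by (rule star_algebra_homI[OF T.complex_star_algebra_axioms B.complex_star_algebra_axioms K])
  obtain u where u: "X = cls u" "cauchy u" using X by (auto simp: carrier_compl)
  have lim: "(\<lambda>n. alg_norm compl (\<iota> (u n) \<ominus>\<^bsub>compl\<^esub> X)) \<longlonglongrightarrow> 0"
    using cls_limit[OF u(2)] u(1) by simp
  have \<iota>u: "\<iota> (u n) \<in> carrier compl" for n
    using star_hom_closed[OF \<iota>_hom cauchy_closed[OF u(2)]] .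
  have tends: "B.tends (\<lambda>n. h (\<iota> (u n))) (h X)"
    if "star_algebra_hom compl B h" "\<And>X. X \<in> carrier compl \<Longrightarrow> alg_norm B (h X) \<le> e * alg_norm compl X" for h e
  proof (rule B.tends_le)
    interpret h: star_algebra_hom compl B h by (rule that)
    show "(\<lambda>n. e * alg_norm compl (\<iota> (u n) \<ominus>\<^bsub>compl\<^esub> X)) \<longlonglongrightarrow> 0"
      using tendsto_mult_left[OF lim, of e] by simp
    show "alg_norm B (h (\<iota> (u n)) \<ominus>\<^bsub>B\<^esub> h X) \<le> e * alg_norm compl (\<iota> (u n) \<ominus>\<^bsub>compl\<^esub> X)" for n
      using that(2)[of "\<iota> (u n) \<ominus>\<^bsub>compl\<^esub> X"] h.hom_minus[OF \<iota>u X] \<iota>u X by simp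
  qed (use that(1) \<iota>u X star_algebra_hom.hom star_hom_closed in \<open>metis+\<close>)
  show ?thesis
    using B.tends_unique[OF tends[OF H.star_algebra_hom_axioms bound(1)]]
      tends[OF K.star_algebra_hom_axioms bound(2)] eq[OF cauchy_closed[OF u(2)]] by simp
qed

text \<open>Contractivity of characters supplies the bounds that the density argument asks
  for.\<close>

lemma character_eqI:
  assumes "\<kappa> \<in> characters compl" "\<psi> \<in> characters compl"
    and "\<And>a. a \<in> carrier A \<Longrightarrow> \<kappa> (\<iota> a) = \<psi> (\<iota> a)"
  shows "\<kappa> = \<psi>"
proof (rule extensionalityI)
  interpret T: cstar_algebra compl by (rule cstar_algebra_compl)
  show "\<kappa> \<in> extensional (carrier compl)" "\<psi> \<in> extensional (carrier compl)"
    using assms by (auto simp: characters_def)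
  have hom: "\<kappa> \<in> star_hom compl complex_numbers" "\<psi> \<in> star_hom compl complex_numbers"
    using assms by (auto simp: characters_def)
  show "\<kappa> X = \<psi> X" if "X \<in> carrier compl" for X
    by (rule completion_hom_eqI[OF cstar_algebra_complex, of _ _ 1 1])
      (use hom that assms(3) T.character_contractive in \<open>auto simp: star_hom_complex_cstar\<close>)
qed

lemma character_extension:
  assumes h: "h \<in> star_hom A complex_numbers" and le: "\<And>x. x \<in> carrier A \<Longrightarrow> cmod (h x) \<le> p x"
  obtains \<kappa> where "\<kappa> \<in> characters compl" "\<And>a. a \<in> carrier A \<Longrightarrow> \<kappa> (\<iota> a) = h a"
proof -
  interpret T: complex_star_algebra compl by (rule complex_star_algebra_compl)
  obtain H where H: "H \<in> star_hom compl complex_numbers" "\<And>a. a \<in> carrier A \<Longrightarrow> H (\<iota> a) = h a"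
    by (rule extend_to_completion[OF cstar_algebra_complex, of h])
      (use h le in \<open>simp_all add: star_hom_complex_cstar\<close>)
  have "restrict H (carrier compl) \<in> star_hom compl complex_numbers"
    by (rule star_hom_cong[OF T.complex_star_algebra_axioms H(1)]) simp
  then show thesis
    using that[of "restrict H (carrier compl)"] H star_hom_closed[OF \<iota>_hom]
    by (auto simp: characters_def)
qed

end

lemma zero_cstar_seminorm: "cstar_seminorm A (\<lambda>x. 0)"
  by (simp add: cstar_seminorm_def)

text \<open>A supremum of reals is informative only for a nonempty set that is bounded above. The
  zero seminorm makes the family nonempty, and \<open>bdd\<close> bounds it pointwise.\<close>

lemma
  assumes "complex_star_algebra A"
    and bdd: "\<And>x. x \<in> carrier A \<Longrightarrow> \<exists>K. \<forall>p. cstar_seminorm A p \<longrightarrow> p x \<le> K"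
  shows cstar_seminorm_universal_norm: "cstar_seminorm A (universal_norm A)"
    and le_universal_norm: "\<lbrakk>cstar_seminorm A p; x \<in> carrier A\<rbrakk> \<Longrightarrow> p x \<le> universal_norm A x"
proof -
  have bdd': "bdd_above ((\<lambda>p. p x) ` {p. cstar_seminorm A p})" if "x \<in> carrier A" for x
    using bdd[OF that] by (auto simp: bdd_above_def)
  show "cstar_seminorm A (universal_norm A)"
    unfolding universal_norm_def[abs_def]
    by (rule cstar_seminorm_SUP) (use assms bdd' zero_cstar_seminorm[of A] in auto)
  show "p x \<le> universal_norm A x" if "cstar_seminorm A p" "x \<in> carrier A"
    unfolding universal_norm_def by (rule cSUP_upper[OF _ bdd']) (use that in auto)
qed

section \<open>Tensor products\<close>

context involutive_monoid
begin

sublocale MA: complex_star_algebra MA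
  by (rule monoid_star_algebra)

lemma MA_minus: "\<lbrakk>f \<in> carrier MA; g \<in> carrier MA\<rbrakk> \<Longrightarrow> f \<ominus>\<^bsub>MA\<^esub> g = f - g"
  using MA.minus_eq_smult[of f g]
  by simp (rule poly_mapping_eqI, simp add: lookup_add lookup_minus)

lemma MA_minus_closed: "\<lbrakk>f \<in> carrier MA; g \<in> carrier MA\<rbrakk> \<Longrightarrow> f - g \<in> carrier MA"
  using MA.minus_closed[of f g] MA_minus[of f g] by simp

lemma MA_star_minus: "star MA (f - g) = star MA f - star MA g"
  using MA_star_add[of "f - g" g] by simp

text \<open>By homogeneity and the triangle inequality, a uniform bound on the images of monomials
  gives one on every element. The monomials will be elementary tensors and words in the
  generators.\<close>

lemma seminorms_bounded_on_image:
  assumes T: "complex_star_algebra T" and h: "h \<in> star_hom MA T" and f: "f \<in> carrier MA"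
    and S: "\<And>p. p \<in> S \<Longrightarrow> cstar_seminorm T p"
    and bound: "\<And>p x. \<lbrakk>p \<in> S; x \<in> carrier M\<rbrakk> \<Longrightarrow> p (h (single x 1)) \<le> K x"
  shows "\<exists>L. \<forall>p\<in>S. p (h f) \<le> L"
proof -
  interpret h: star_algebra_hom MA T h
    by (rule star_algebra_homI[OF monoid_star_algebra T h])
  have sn: "cstar_seminormed T p" if "p \<in> S" for p
    by (intro cstar_seminormed.intro cstar_seminormed_axioms.intro T S that)
  from f have "keys f \<subseteq> carrier M" by simp
  then show ?thesis
  proof (induction rule: poly_mapping_keys_induct)
    case zero
    have "p (h 0) \<le> 0" if "p \<in> S" for p
      using cstar_seminormed.p_zero[OF sn[OF that]] h.hom_zero by simp
    then show ?case by blast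
  next
    case (single x c)
    have x: "single x 1 \<in> carrier MA" using single by simp
    have "p (h (single x c)) \<le> cmod c * K x" if p: "p \<in> S" for p
      unfolding MA_single_smult[of x c] star_hom_smult[OF h x]
      using bound[OF p single] star_hom_closed[OF h x]
      by (simp only: cstar_seminormed.p_smult[OF sn[OF p]] mult_left_mono norm_ge_zero)
    then show ?case by blast
  next
    case (add f g)
    then obtain K L where K: "\<forall>p\<in>S. p (h f) \<le> K" and L: "\<forall>p\<in>S. p (h g) \<le> L" by blast
    have fg: "f \<in> carrier MA" "g \<in> carrier MA" using add by simp_all
    have "p (h (f + g)) \<le> K + L" if p: "p \<in> S" for p
    proof -
      have "p (h f \<oplus>\<^bsub>T\<^esub> h g) \<le> p (h f) + p (h g)"
        by (intro cstar_seminormed.p_add[OF sn[OF p]] star_hom_closed[OF h] fg)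
      then show ?thesis
        using star_hom_add[OF h fg] bspec[OF K p] bspec[OF L p] by simp
    qed
    then show ?case by blast
  qed
qed

end

locale cstar_pair = A: cstar_algebra A + B: cstar_algebra B
  for A :: "('a, 'm) normed_star_algebra_scheme" and B :: "('b, 'n) normed_star_algebra_scheme"
begin

sublocale P: involutive_monoid "A \<times>\<times> B" "\<lambda>(a, b). (star A a, star B b)"
proof -
  interpret Group.monoid "A \<times>\<times> B"
    by (rule DirProd_monoid[OF A.monoid_axioms B.monoid_axioms])
  show "involutive_monoid (A \<times>\<times> B) (\<lambda>(a, b). (star A a, star B b))"
    by unfold_locales (auto simp:  A.star_mult B.star_mult)
qed

abbreviation e where "e a b \<equiv> single (a, b) (1 :: complex)"

lemma single_closed: "\<lbrakk>a \<in> carrier A; b \<in> carrier B\<rbrakk> \<Longrightarrow> single (a, b) c \<in> carrier P.MA"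
  by simp

lemma bilinear_relations_closed: "bilinear_relations A B \<subseteq> carrier P.MA"
proof -
  have "f + g \<in> carrier P.MA" if "f \<in> carrier P.MA" "g \<in> carrier P.MA" for f g
    using P.MA.a_closed[OF that] by simp
  then show ?thesis
    unfolding bilinear_relations_def Let_def
    by (auto simp del: P.MA_simps(1) intro!: P.MA_minus_closed single_closed)
qed

text \<open>The involution turns a relation into the one of the same type for the starred elements
  and the conjugated scalar; hence the ideal they generate is stable under it.\<close>

lemma bilinear_relations_star:
  assumes "f \<in> bilinear_relations A B"
  shows "star P.MA f \<in> bilinear_relations A B"
proof -
  consider
      (1) a a' b where "f = e (a \<oplus>\<^bsub>A\<^esub> a') b - (e a b + e a' b)" "a \<in> carrier A" "a' \<in> carrier A" "b \<in> carrier B"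
    | (2) a b b' where "f = e a (b \<oplus>\<^bsub>B\<^esub> b') - (e a b + e a b')" "a \<in> carrier A" "b \<in> carrier B" "b' \<in> carrier B"
    | (3) c a b where "f = e (c \<odot>\<^bsub>A\<^esub> a) b - single (a, b) c" "a \<in> carrier A" "b \<in> carrier B"
    | (4) c a b where "f = e a (c \<odot>\<^bsub>B\<^esub> b) - single (a, b) c" "a \<in> carrier A" "b \<in> carrier B"
    using assms unfolding bilinear_relations_def Let_def by blast
  then show ?thesis
  proof cases
    case 1
    then have "star P.MA f = e (star A a \<oplus>\<^bsub>A\<^esub> star A a') (star B b) - (e (star A a) (star B b) + e (star A a') (star B b))"
      by (simp add: P.MA_star_minus P.MA_star_add A.star_add)
    with 1 show ?thesis unfolding bilinear_relations_def Let_def by blast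
  next
    case 2
    then have "star P.MA f = e (star A a) (star B b \<oplus>\<^bsub>B\<^esub> star B b') - (e (star A a) (star B b) + e (star A a) (star B b'))"
      by (simp add: P.MA_star_minus P.MA_star_add B.star_add)
    with 2 show ?thesis unfolding bilinear_relations_def Let_def by blast
  next
    case 3
    then have "star P.MA f = e (cnj c \<odot>\<^bsub>A\<^esub> star A a) (star B b) - single (star A a, star B b) (cnj c)"
      by (simp add: P.MA_star_minus A.star_smult)
    with 3 show ?thesis unfolding bilinear_relations_def Let_def by blast
  next
    case 4
    then have "star P.MA f = e (star A a) (cnj c \<odot>\<^bsub>B\<^esub> star B b) - single (star A a, star B b) (cnj c)"
      by (simp add: P.MA_star_minus B.star_smult)
    with 4 show ?thesis unfolding bilinear_relations_def Let_def by blast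
  qed
qed

sublocale I: star_ideal P.MA "tensor_ideal A B"
  unfolding tensor_ideal_def pair_algebra_def
  using bilinear_relations_closed P.MA.genideal_self[OF bilinear_relations_closed]
  by (intro P.MA.star_ideal_genideal) (auto dest: bilinear_relations_star)

abbreviation T0 where "T0 \<equiv> algebraic_tensor A B"
abbreviation coset where "coset f \<equiv> tensor_ideal A B +>\<^bsub>P.MA\<^esub> f"
abbreviation elem where "elem \<equiv> algebraic_elem A B"

lemma T0_eq: "T0 = I.Q"
  by (simp add: algebraic_tensor_def pair_algebra_def)

sublocale T0: complex_star_algebra T0
  unfolding T0_eq by (rule I.quotient_star_algebra)

lemma elem_eq: "elem a b = coset (e a b)"
  by (simp add: algebraic_elem_def pair_algebra_def)

lemma coset_hom: "coset \<in> star_hom P.MA T0"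
  unfolding T0_eq by (rule I.coset_hom)

lemma elem_closed [simp]: "\<lbrakk>a \<in> carrier A; b \<in> carrier B\<rbrakk> \<Longrightarrow> elem a b \<in> carrier T0"
  unfolding elem_eq by (rule star_hom_closed[OF coset_hom single_closed])

lemma coset_relation:
  assumes "f - g \<in> bilinear_relations A B" "f \<in> carrier P.MA" "g \<in> carrier P.MA"
  shows "coset f = coset g"
proof -
  have "f \<ominus>\<^bsub>P.MA\<^esub> g \<in> tensor_ideal A B"
    unfolding P.MA_minus[OF assms(2,3)] tensor_ideal_def pair_algebra_def
    using assms(1) P.MA.genideal_self[OF bilinear_relations_closed] by blast
  then show ?thesis using I.coset_eq_iff[OF assms(2,3)] by simp
qed

lemma coset_single: "\<lbrakk>a \<in> carrier A; b \<in> carrier B\<rbrakk> \<Longrightarrow> coset (single (a, b) c) = c \<odot>\<^bsub>T0\<^esub> elem a b"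
  unfolding elem_eq P.MA_single_smult[of _ c] by (rule star_hom_smult[OF coset_hom single_closed])

lemma elem_add_left:
  assumes "a \<in> carrier A" "a' \<in> carrier A" "b \<in> carrier B"
  shows "elem (a \<oplus>\<^bsub>A\<^esub> a') b = elem a b \<oplus>\<^bsub>T0\<^esub> elem a' b"
proof -
  have "coset (e (a \<oplus>\<^bsub>A\<^esub> a') b) = coset (e a b \<oplus>\<^bsub>P.MA\<^esub> e a' b)"
  proof (rule coset_relation)
    show "e (a \<oplus>\<^bsub>A\<^esub> a') b - (e a b \<oplus>\<^bsub>P.MA\<^esub> e a' b) \<in> bilinear_relations A B"
      using assms unfolding bilinear_relations_def Let_def P.MA_simps by blast
  qed (intro P.MA.a_closed single_closed A.a_closed assms)+
  then show ?thesis
    unfolding elem_eq using star_hom_add[OF coset_hom single_closed single_closed, of a b a' b] assms by simp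
qed

lemma elem_add_right:
  assumes "a \<in> carrier A" "b \<in> carrier B" "b' \<in> carrier B"
  shows "elem a (b \<oplus>\<^bsub>B\<^esub> b') = elem a b \<oplus>\<^bsub>T0\<^esub> elem a b'"
proof -
  have "coset (e a (b \<oplus>\<^bsub>B\<^esub> b')) = coset (e a b \<oplus>\<^bsub>P.MA\<^esub> e a b')"
  proof (rule coset_relation)
    show "e a (b \<oplus>\<^bsub>B\<^esub> b') - (e a b \<oplus>\<^bsub>P.MA\<^esub> e a b') \<in> bilinear_relations A B"
      using assms unfolding bilinear_relations_def Let_def P.MA_simps by blast
  qed (intro P.MA.a_closed single_closed B.a_closed assms)+
  then show ?thesis
    unfolding elem_eq using star_hom_add[OF coset_hom single_closed single_closed, of a b a b'] assms by simp
qed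

lemma elem_smult:
  assumes "a \<in> carrier A" "b \<in> carrier B"
  shows "elem (c \<odot>\<^bsub>A\<^esub> a) b = c \<odot>\<^bsub>T0\<^esub> elem a b" "elem a (c \<odot>\<^bsub>B\<^esub> b) = c \<odot>\<^bsub>T0\<^esub> elem a b"
proof -
  have rel: "e (c \<odot>\<^bsub>A\<^esub> a) b - single (a, b) c \<in> bilinear_relations A B"
    "e a (c \<odot>\<^bsub>B\<^esub> b) - single (a, b) c \<in> bilinear_relations A B"
    using assms unfolding bilinear_relations_def Let_def by blast+
  have "coset (e (c \<odot>\<^bsub>A\<^esub> a) b) = coset (single (a, b) c)"
    by (rule coset_relation[OF rel(1)]; intro single_closed A.smult_closed assms)
  moreover have "coset (e a (c \<odot>\<^bsub>B\<^esub> b)) = coset (single (a, b) c)"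
    by (rule coset_relation[OF rel(2)]; intro single_closed B.smult_closed assms)
  ultimately show "elem (c \<odot>\<^bsub>A\<^esub> a) b = c \<odot>\<^bsub>T0\<^esub> elem a b" "elem a (c \<odot>\<^bsub>B\<^esub> b) = c \<odot>\<^bsub>T0\<^esub> elem a b"
    unfolding coset_single[OF assms, symmetric] by (simp_all only: elem_eq)
qed

lemma elem_mult:
  assumes "a \<in> carrier A" "b \<in> carrier B" "a' \<in> carrier A" "b' \<in> carrier B"
  shows "elem a b \<otimes>\<^bsub>T0\<^esub> elem a' b' = elem (a \<otimes>\<^bsub>A\<^esub> a') (b \<otimes>\<^bsub>B\<^esub> b')"
  unfolding elem_eq
  using star_hom_mult[OF coset_hom single_closed single_closed, of a b a' b' 1 1] assms
  by simp

lemma elem_star: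
  "\<lbrakk>a \<in> carrier A; b \<in> carrier B\<rbrakk> \<Longrightarrow> star T0 (elem a b) = elem (star A a) (star B b)"
  unfolding elem_eq using star_hom_star[OF coset_hom single_closed, of a b 1] by simp

lemma elem_one: "elem \<one>\<^bsub>A\<^esub> \<one>\<^bsub>B\<^esub> = \<one>\<^bsub>T0\<^esub>"
  unfolding elem_eq using star_hom_one[OF coset_hom] by simp

lemma T0_cases:
  assumes "z \<in> carrier T0"
  obtains f where "z = coset f" "f \<in> carrier P.MA"
  using assms unfolding T0_eq I.carrier_Q by blast

definition cross_seminorms where
  "cross_seminorms = {p. cstar_seminorm T0 p \<and>
    (\<forall>a\<in>carrier A. \<forall>b\<in>carrier B. p (elem a b) \<le> alg_norm A a * alg_norm B b)}"

text \<open>The cross condition bounds the elementary tensors, and these span; so the supremum that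
  defines \<open>max_tensor_norm\<close> is finite.\<close>

lemma cross_seminorms_bounded:
  assumes "z \<in> carrier T0"
  shows "bdd_above ((\<lambda>p. p z) ` cross_seminorms)"
proof -
  obtain f where f: "z = coset f" "f \<in> carrier P.MA" using assms by (rule T0_cases)
  have "\<exists>K. \<forall>p\<in>cross_seminorms. p (coset f) \<le> K"
    by (rule P.seminorms_bounded_on_image[OF T0.complex_star_algebra_axioms coset_hom f(2),
          of _ "\<lambda>x. alg_norm A (fst x) * alg_norm B (snd x)"])
      (auto simp: cross_seminorms_def elem_eq)
  then show ?thesis by (auto simp: bdd_above_def f(1))
qed

sublocale T: cstar_seminormed T0 "max_tensor_norm A B"
proof
  have "(\<lambda>z. 0) \<in> cross_seminorms"
    by (simp add: cross_seminorms_def zero_cstar_seminorm)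
  then have "cstar_seminorm T0 (\<lambda>z. SUP p\<in>cross_seminorms. p z)"
    by (intro cstar_seminorm_SUP T0.complex_star_algebra_axioms cross_seminorms_bounded)
      (auto simp: cross_seminorms_def)
  then show "cstar_seminorm T0 (max_tensor_norm A B)"
    by (simp add: max_tensor_norm_def[abs_def] cross_seminorms_def)
qed

abbreviation T where "T \<equiv> cstar_tensor A B"
abbreviation te where "te \<equiv> tensor_elem A B"

lemma T_eq: "T = T.compl"
  by (simp add: cstar_tensor_def)

sublocale TT: cstar_algebra T
  unfolding T_eq by (rule T.cstar_algebra_compl)

lemma te_eq: "te a b = T.\<iota> (elem a b)"
  by (simp add: tensor_elem_def)

lemmas \<iota>_homs = star_homD[OF T.\<iota>_hom, folded T_eq]

lemma te_closed [simp]: "\<lbrakk>a \<in> carrier A; b \<in> carrier B\<rbrakk> \<Longrightarrow> te a b \<in> carrier T"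
  by (simp add: te_eq \<iota>_homs)

lemma te_add_left:
  "\<lbrakk>a \<in> carrier A; a' \<in> carrier A; b \<in> carrier B\<rbrakk> \<Longrightarrow> te (a \<oplus>\<^bsub>A\<^esub> a') b = te a b \<oplus>\<^bsub>T\<^esub> te a' b"
  by (simp add: te_eq elem_add_left \<iota>_homs)

lemma te_add_right:
  "\<lbrakk>a \<in> carrier A; b \<in> carrier B; b' \<in> carrier B\<rbrakk> \<Longrightarrow> te a (b \<oplus>\<^bsub>B\<^esub> b') = te a b \<oplus>\<^bsub>T\<^esub> te a b'"
  by (simp add: te_eq elem_add_right \<iota>_homs)

lemma te_mult:
  "\<lbrakk>a \<in> carrier A; b \<in> carrier B; a' \<in> carrier A; b' \<in> carrier B\<rbrakk>
    \<Longrightarrow> te a b \<otimes>\<^bsub>T\<^esub> te a' b' = te (a \<otimes>\<^bsub>A\<^esub> a') (b \<otimes>\<^bsub>B\<^esub> b')"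
  by (simp add: te_eq elem_mult flip: \<iota>_homs)

lemma te_star: "\<lbrakk>a \<in> carrier A; b \<in> carrier B\<rbrakk> \<Longrightarrow> star T (te a b) = te (star A a) (star B b)"
  by (simp add: te_eq elem_star flip: \<iota>_homs)

lemma te_one: "te \<one>\<^bsub>A\<^esub> \<one>\<^bsub>B\<^esub> = \<one>\<^bsub>T\<^esub>"
  by (simp add: te_eq elem_one \<iota>_homs)

text \<open>Zero is moved out of a tensor as the scalar 0, by homogeneity in either factor.\<close>

lemma te_zero: "b \<in> carrier B \<Longrightarrow> te \<zero>\<^bsub>A\<^esub> b = \<zero>\<^bsub>T\<^esub>" "a \<in> carrier A \<Longrightarrow> te a \<zero>\<^bsub>B\<^esub> = \<zero>\<^bsub>T\<^esub>"
proof -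
  show "te \<zero>\<^bsub>A\<^esub> b = \<zero>\<^bsub>T\<^esub>" if "b \<in> carrier B"
    using elem_smult(1)[of "\<zero>\<^bsub>A\<^esub>" b 0] \<iota>_homs(4)[of "elem \<zero>\<^bsub>A\<^esub> b" 0] that by (simp add: te_eq \<iota>_homs(1))
  show "te a \<zero>\<^bsub>B\<^esub> = \<zero>\<^bsub>T\<^esub>" if "a \<in> carrier A"
    using elem_smult(2)[of a "\<zero>\<^bsub>B\<^esub>" 0] \<iota>_homs(4)[of "elem a \<zero>\<^bsub>B\<^esub>" 0] that by (simp add: te_eq \<iota>_homs(1))
qed

lemma te_finsum:
  "\<lbrakk>f \<in> S \<rightarrow> carrier A; b \<in> carrier B\<rbrakk> \<Longrightarrow> te (\<Oplus>\<^bsub>A\<^esub>s\<in>S. f s) b = (\<Oplus>\<^bsub>T\<^esub>s\<in>S. te (f s) b)"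
  "\<lbrakk>g \<in> S \<rightarrow> carrier B; a \<in> carrier A\<rbrakk> \<Longrightarrow> te a (\<Oplus>\<^bsub>B\<^esub>s\<in>S. g s) = (\<Oplus>\<^bsub>T\<^esub>s\<in>S. te a (g s))"
proof -
  show "te (\<Oplus>\<^bsub>A\<^esub>s\<in>S. f s) b = (\<Oplus>\<^bsub>T\<^esub>s\<in>S. te (f s) b)" if "f \<in> S \<rightarrow> carrier A" "b \<in> carrier B"
    using that
    by (induction S rule: infinite_finite_induct)
      (simp_all add: te_zero A.finsum_insert TT.finsum_insert te_add_left Pi_def)
  show "te a (\<Oplus>\<^bsub>B\<^esub>s\<in>S. g s) = (\<Oplus>\<^bsub>T\<^esub>s\<in>S. te a (g s))" if "g \<in> S \<rightarrow> carrier B" "a \<in> carrier A"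
    using that
    by (induction S rule: infinite_finite_induct)
      (simp_all add: te_zero B.finsum_insert TT.finsum_insert te_add_right Pi_def)
qed

text \<open>Elementary tensors span a dense subalgebra. This is the uniqueness behind the definite
  description \<open>tensor_character\<close>.\<close>

lemma tensor_character_eqI:
  assumes \<omega>: "\<omega> \<in> characters T" and \<omega>': "\<omega>' \<in> characters T"
    and eq: "\<And>a b. \<lbrakk>a \<in> carrier A; b \<in> carrier B\<rbrakk> \<Longrightarrow> \<omega> (te a b) = \<omega>' (te a b)"
  shows "\<omega> = \<omega>'"
proof (rule T.character_eqI[folded T_eq, OF \<omega> \<omega>'])
  fix z assume "z \<in> carrier T0"
  then obtain f where f: "z = coset f" "f \<in> carrier P.MA" by (rule T0_cases)
  have hom: "(\<lambda>f. \<omega> (T.\<iota> (coset f))) \<in> star_hom P.MA complex_numbers" if "\<omega> \<in> characters T" for \<omega>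
    by (rule star_hom_compose[OF star_hom_compose[OF coset_hom T.\<iota>_hom]])
      (use that in \<open>simp add: characters_def T_eq\<close>)
  have "\<omega> (T.\<iota> (coset f)) = \<omega>' (T.\<iota> (coset f))"
    by (rule P.monoid_star_algebra_hom_eqI[OF hom[OF \<omega>] hom[OF \<omega>'] complex_star_algebra_complex_numbers _ f(2)])
      (use eq in \<open>auto simp: te_eq elem_eq\<close>)
  then show "\<omega> (T.\<iota> z) = \<omega>' (T.\<iota> z)" by (simp add: f(1))
qed

text \<open>The product of \<open>\<kappa>\<close> and \<open>\<psi>\<close> is multiplicative on
  pairs, so it extends linearly, and it kills the bilinearity relations. Its modulus is a cross
  seminorm, hence dominated by the maximal norm, and so it passes to the completion.\<close>

lemma tensor_character:
  assumes \<kappa>: "\<kappa> \<in> characters A" and \<psi>: "\<psi> \<in> characters B"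
  shows "tensor_character A B \<kappa> \<psi> \<in> characters T"
    and "\<And>a b. \<lbrakk>a \<in> carrier A; b \<in> carrier B\<rbrakk> \<Longrightarrow> tensor_character A B \<kappa> \<psi> (te a b) = \<kappa> a * \<psi> b"
proof -
  have hom: "\<kappa> \<in> star_hom A complex_numbers" "\<psi> \<in> star_hom B complex_numbers"
    using assms by (simp_all add: characters_def)
  note [simp] = star_homD[OF hom(1)] star_homD[OF hom(2)]
  obtain h where h: "h \<in> star_hom P.MA complex_numbers"
    and h_single: "\<And>x c. x \<in> carrier (A \<times>\<times> B) \<Longrightarrow> h (single x c) = c * (\<kappa> (fst x) * \<psi> (snd x))"
    by (rule P.monoid_star_algebra_universal[OF complex_star_algebra_complex_numbers, of "\<lambda>x. \<kappa> (fst x) * \<psi> (snd x)"])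
      auto
  interpret h: star_algebra_hom P.MA complex_numbers h
    by (rule star_algebra_homI[OF P.MA.complex_star_algebra_axioms complex_star_algebra_complex_numbers h])
  have h_e [simp]: "h (single (a, b) c) = c * (\<kappa> a * \<psi> b)" if "a \<in> carrier A" "b \<in> carrier B" for a b c
    using h_single[of "(a, b)" c] that by simp
  have h_diff: "h (f - g) = h f - h g" if "f \<in> carrier P.MA" "g \<in> carrier P.MA" for f g
    using h.hom_minus[OF that] h.B.minus_eq_smult[of "h f" "h g"] P.MA_minus[OF that] by simp
  have h_add: "h (f + g) = h f + h g" if "f \<in> carrier P.MA" "g \<in> carrier P.MA" for f g
    using star_hom_add[OF h that] by simp
  have add_closed: "f + g \<in> carrier P.MA" if "f \<in> carrier P.MA" "g \<in> carrier P.MA" for f g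
    using P.MA.a_closed[OF that] by simp
  have "h f = \<zero>\<^bsub>complex_numbers\<^esub>" if "f \<in> bilinear_relations A B" for f
    using that unfolding bilinear_relations_def Let_def
    by (auto simp: h_diff h_add single_closed add_closed ring_distribs simp del: P.MA_simps(1))
  then have "h f = \<zero>\<^bsub>complex_numbers\<^esub>" if "f \<in> tensor_ideal A B" for f
    using h.hom_genideal[OF bilinear_relations_closed] that by (simp add: tensor_ideal_def pair_algebra_def)
  then obtain k where k: "k \<in> star_hom T0 complex_numbers" and k_cos: "\<And>f. f \<in> carrier P.MA \<Longrightarrow> k (coset f) = h f"
    using I.quotient_universal[OF complex_star_algebra_complex_numbers h] unfolding T0_eq by blast
  have k_elem: "k (elem a b) = \<kappa> a * \<psi> b" if "a \<in> carrier A" "b \<in> carrier B" for a b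
    using that by (simp add: elem_eq k_cos[OF single_closed])
  have "cstar_seminorm T0 (\<lambda>z. cmod (k z))"
    by (rule cstar_seminorm_pullback[OF T0.complex_star_algebra_axioms k cstar_seminorm_cmod])
  \<comment> \<open>The cross condition for this seminorm follows from the contractivity of the two
    characters.\<close>
  then have "(\<lambda>z. cmod (k z)) \<in> cross_seminorms"
    using A.character_contractive[OF hom(1)] B.character_contractive[OF hom(2)]
    by (auto simp: cross_seminorms_def k_elem norm_mult intro!: mult_mono)
  then have "cmod (k z) \<le> max_tensor_norm A B z" if "z \<in> carrier T0" for z
    using cSUP_upper[OF _ cross_seminorms_bounded[OF that]]
    by (simp add: max_tensor_norm_def cross_seminorms_def[symmetric])
  then obtain \<omega> where "\<omega> \<in> characters T" "\<And>z. z \<in> carrier T0 \<Longrightarrow> \<omega> (T.\<iota> z) = k z"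
    using T.character_extension[OF k] unfolding T_eq by blast
  then have "\<exists>!\<omega>. \<omega> \<in> characters T \<and> (\<forall>a\<in>carrier A. \<forall>b\<in>carrier B. \<omega> (te a b) = \<kappa> a * \<psi> b)"
    by (intro ex1I[of _ \<omega>]) (auto simp: te_eq k_elem intro!: tensor_character_eqI)
  from theI'[OF this]
  show "tensor_character A B \<kappa> \<psi> \<in> characters T"
    "\<And>a b. \<lbrakk>a \<in> carrier A; b \<in> carrier B\<rbrakk> \<Longrightarrow> tensor_character A B \<kappa> \<psi> (te a b) = \<kappa> a * \<psi> b"
    by (simp_all add: tensor_character_def)
qed

end

section \<open>Quantum automorphism groups of graphs of involutions\<close>

text \<open>The relations are written with the sum of the type class, while homomorphisms are
  compatible with the sum of the ring record; the two agree on the monoid algebra.\<close>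

lemma (in involutive_monoid) MA_finsum:
  "f \<in> S \<rightarrow> carrier MA \<Longrightarrow> (\<Oplus>\<^bsub>MA\<^esub>s\<in>S. f s) = (\<Sum>s\<in>S. f s)"
proof (induction S rule: infinite_finite_induct)
  case (insert s S)
  then show ?case
    using MA.finsum_insert[of S s f] by (auto simp: Pi_def simp del: MA_simps(1))
qed simp_all

lemma (in involutive_monoid) MA_star_sum: "star MA (\<Sum>s\<in>S. f s) = (\<Sum>s\<in>S. star MA (f s))"
  by (induction S rule: infinite_finite_induct) (simp_all add: MA_star_add)

text \<open>
  For a graph whose edges are the pairs \<open>(i, \<sigma> i)\<close> of an involution \<open>\<sigma>\<close>, the relations (R2)--(R4) say
  \<open>X (\<sigma> i) (\<sigma> j) = X i j\<close>.
\<close>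

locale magic_family = complex_star_algebra T for T (structure) +
  fixes V :: "'v set" and \<sigma> :: "'v \<Rightarrow> 'v" and x :: "'v \<Rightarrow> 'v \<Rightarrow> _"
  assumes x_closed [simp, intro]: "\<lbrakk>i \<in> V; j \<in> V\<rbrakk> \<Longrightarrow> x i j \<in> carrier T"
    and x_star: "\<lbrakk>i \<in> V; j \<in> V\<rbrakk> \<Longrightarrow> star T (x i j) = x i j"
    and x_row: "\<lbrakk>i \<in> V; j \<in> V; k \<in> V\<rbrakk> \<Longrightarrow> x i j \<otimes> x i k = (if j = k then x i j else \<zero>)"
    and x_col: "\<lbrakk>i \<in> V; j \<in> V; k \<in> V\<rbrakk> \<Longrightarrow> x j i \<otimes> x k i = (if j = k then x j i else \<zero>)"
    and row_sum: "i \<in> V \<Longrightarrow> (\<Oplus>l\<in>V. x i l) = \<one>"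
    and col_sum: "i \<in> V \<Longrightarrow> (\<Oplus>l\<in>V. x l i) = \<one>"
    and x_invol: "\<lbrakk>i \<in> V; j \<in> V\<rbrakk> \<Longrightarrow> x (\<sigma> i) (\<sigma> j) = x i j"

lemma (in star_algebra_hom) magic_family_image:
  assumes "magic_family A V \<sigma> x" and \<sigma>: "\<And>i. i \<in> V \<Longrightarrow> \<sigma> i \<in> V"
  shows "magic_family B V \<sigma> (\<lambda>i j. h (x i j))"
proof -
  interpret magic_family A V \<sigma> x by fact
  show ?thesis
  proof unfold_locales
    show "(\<Oplus>\<^bsub>B\<^esub>l\<in>V. h (x i l)) = \<one>\<^bsub>B\<^esub>" if "i \<in> V" for i
      using hom_finsum[of "x i" V] that by (simp add: row_sum Pi_def)
    show "(\<Oplus>\<^bsub>B\<^esub>l\<in>V. h (x l i)) = \<one>\<^bsub>B\<^esub>" if "i \<in> V" for i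
      using hom_finsum[of "\<lambda>l. x l i" V] that by (simp add: col_sum Pi_def)
  qed (simp_all add: \<sigma> x_invol x_row x_col x_star flip: hom_simps(3,5))
qed

lemma finsum_complex_numbers: "(\<Oplus>\<^bsub>complex_numbers\<^esub>s\<in>S. f s) = (\<Sum>s\<in>S. f s)"
proof -
  interpret complex_star_algebra complex_numbers by (rule complex_star_algebra_complex_numbers)
  show ?thesis
    by (induction S rule: infinite_finite_induct) (simp_all add: finsum_insert)
qed

context complex_star_algebra
begin

text \<open>It serves to multiply two entries of the coproduct matrix, where all cross terms vanish
  in one of the tensor factors.\<close>

lemma finsum_mult_orthogonal:
  assumes "finite S" and a: "a \<in> S \<rightarrow> carrier A" and b: "b \<in> S \<rightarrow> carrier A"
    and orth: "\<And>k l. \<lbrakk>k \<in> S; l \<in> S; k \<noteq> l\<rbrakk> \<Longrightarrow> a k \<otimes> b l = \<zero>"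
  shows "(\<Oplus>k\<in>S. a k) \<otimes> (\<Oplus>k\<in>S. b k) = (\<Oplus>k\<in>S. a k \<otimes> b k)"
proof -
  have "(\<Oplus>k\<in>S. a k) \<otimes> (\<Oplus>l\<in>S. b l) = (\<Oplus>k\<in>S. a k \<otimes> (\<Oplus>l\<in>S. b l))"
    using assms by (intro finsum_ldistr) auto
  also have "\<dots> = (\<Oplus>k\<in>S. a k \<otimes> b k)"
  proof (rule finsum_cong')
    fix k assume k: "k \<in> S"
    have "a k \<otimes> (\<Oplus>l\<in>S. b l) = (\<Oplus>l\<in>S. a k \<otimes> b l)"
      using k assms by (intro finsum_rdistr) auto
    also have "\<dots> = (\<Oplus>l\<in>S. if k = l then a k \<otimes> b l else \<zero>)"
      using k a b orth by (intro finsum_cong') (auto simp: Pi_def)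
    also have "\<dots> = a k \<otimes> b k"
      using k a b \<open>finite S\<close> by (intro finsum_singleton) (auto simp: Pi_def)
    finally show "a k \<otimes> (\<Oplus>l\<in>S. b l) = a k \<otimes> b k" .
  qed (use a b in auto)
  finally show ?thesis .
qed

lemma finsum_exchange:
  assumes "finite S" and "finite S'" and f: "\<And>k l. \<lbrakk>k \<in> S; l \<in> S'\<rbrakk> \<Longrightarrow> f k l \<in> carrier A"
  shows "(\<Oplus>k\<in>S. \<Oplus>l\<in>S'. f k l) = (\<Oplus>l\<in>S'. \<Oplus>k\<in>S. f k l)"
  using assms(1) f
proof (induction S)
  case (insert s S)
  have "(\<Oplus>l\<in>S'. \<Oplus>k\<in>insert s S. f k l) = (\<Oplus>l\<in>S'. f s l \<oplus> (\<Oplus>k\<in>S. f k l))"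
    using insert by (intro finsum_cong') (auto simp: finsum_insert Pi_def)
  also have "\<dots> = (\<Oplus>l\<in>S'. f s l) \<oplus> (\<Oplus>l\<in>S'. \<Oplus>k\<in>S. f k l)"
    using insert by (intro finsum_addf) (auto simp: Pi_def)
  also have "\<dots> = (\<Oplus>k\<in>insert s S. \<Oplus>l\<in>S'. f k l)"
    using insert by (subst finsum_insert) (auto simp: Pi_def)
  finally show ?case ..
qed simp

lemma star_finsum: "f \<in> S \<rightarrow> carrier A \<Longrightarrow> star A (\<Oplus>s\<in>S. f s) = (\<Oplus>s\<in>S. star A (f s))"
proof (induction S rule: infinite_finite_induct)
  case (insert s S)
  then show ?case by (simp add: finsum_insert Pi_def star_add)
qed simp_all

end

text \<open>In a product along a row the cross terms die in the first factor, by the row relation of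
  \<open>x\<close>; along a column they die in the second, by the column relation of
  \<open>y\<close>. The symmetry follows by substituting \<open>\<sigma> k\<close> for the summation
  index.\<close>

lemma (in cstar_pair) magic_family_tensor:
  assumes x: "magic_family A V \<sigma> x" and y: "magic_family B V \<sigma> y"
    and "finite V" and \<sigma>: "bij_betw \<sigma> V V"
  shows "magic_family T V \<sigma> (\<lambda>i j. \<Oplus>\<^bsub>T\<^esub>k\<in>V. te (x i k) (y k j))"
proof -
  interpret x: magic_family A V \<sigma> x by fact
  interpret y: magic_family B V \<sigma> y by fact
  note [simp] = \<open>finite V\<close>
  show ?thesis
  proof unfold_locales
    fix i j assume i: "i \<in> V" and j: "j \<in> V"
    show "(\<Oplus>\<^bsub>T\<^esub>k\<in>V. te (x i k) (y k j)) \<in> carrier T"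
      using i j by (intro TT.finsum_closed) auto
    have "star T (\<Oplus>\<^bsub>T\<^esub>k\<in>V. te (x i k) (y k j)) = (\<Oplus>\<^bsub>T\<^esub>k\<in>V. star T (te (x i k) (y k j)))"
      using i j by (intro TT.star_finsum) auto
    also have "\<dots> = (\<Oplus>\<^bsub>T\<^esub>k\<in>V. te (x i k) (y k j))"
      using i j by (intro TT.finsum_cong') (auto simp: te_star x.x_star y.x_star)
    finally show "star T (\<Oplus>\<^bsub>T\<^esub>k\<in>V. te (x i k) (y k j)) = (\<Oplus>\<^bsub>T\<^esub>k\<in>V. te (x i k) (y k j))" .
    have \<sigma>_closed: "\<sigma> k \<in> V" if "k \<in> V" for k using \<sigma> that by (auto simp: bij_betw_def)
    have "(\<Oplus>\<^bsub>T\<^esub>k\<in>\<sigma> ` V. te (x (\<sigma> i) k) (y k (\<sigma> j))) =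
        (\<Oplus>\<^bsub>T\<^esub>k\<in>V. te (x (\<sigma> i) (\<sigma> k)) (y (\<sigma> k) (\<sigma> j)))"
      using \<sigma> i j \<sigma>_closed by (intro TT.finsum_reindex) (auto simp: bij_betw_def)
    also have "\<dots> = (\<Oplus>\<^bsub>T\<^esub>k\<in>V. te (x i k) (y k j))"
      using i j by (intro TT.finsum_cong') (auto simp: x.x_invol y.x_invol)
    finally show "(\<Oplus>\<^bsub>T\<^esub>k\<in>V. te (x (\<sigma> i) k) (y k (\<sigma> j))) = (\<Oplus>\<^bsub>T\<^esub>k\<in>V. te (x i k) (y k j))"
      using \<sigma> by (simp add: bij_betw_def)
    fix k assume k: "k \<in> V"
    have "(\<Oplus>\<^bsub>T\<^esub>l\<in>V. te (x i l) (y l j)) \<otimes>\<^bsub>T\<^esub> (\<Oplus>\<^bsub>T\<^esub>l\<in>V. te (x i l) (y l k)) =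
        (\<Oplus>\<^bsub>T\<^esub>l\<in>V. te (x i l) (y l j) \<otimes>\<^bsub>T\<^esub> te (x i l) (y l k))"
      using i j k by (intro TT.finsum_mult_orthogonal) (auto simp: te_mult x.x_row te_zero)
    also have "\<dots> = (\<Oplus>\<^bsub>T\<^esub>l\<in>V. if j = k then te (x i l) (y l j) else \<zero>\<^bsub>T\<^esub>)"
      using i j k by (intro TT.finsum_cong') (auto simp: te_mult x.x_row y.x_row te_zero)
    finally show "(\<Oplus>\<^bsub>T\<^esub>l\<in>V. te (x i l) (y l j)) \<otimes>\<^bsub>T\<^esub> (\<Oplus>\<^bsub>T\<^esub>l\<in>V. te (x i l) (y l k)) =
        (if j = k then \<Oplus>\<^bsub>T\<^esub>l\<in>V. te (x i l) (y l j) else \<zero>\<^bsub>T\<^esub>)"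
      by simp
    have "(\<Oplus>\<^bsub>T\<^esub>l\<in>V. te (x j l) (y l i)) \<otimes>\<^bsub>T\<^esub> (\<Oplus>\<^bsub>T\<^esub>l\<in>V. te (x k l) (y l i)) =
        (\<Oplus>\<^bsub>T\<^esub>l\<in>V. te (x j l) (y l i) \<otimes>\<^bsub>T\<^esub> te (x k l) (y l i))"
      using i j k by (intro TT.finsum_mult_orthogonal) (auto simp: te_mult y.x_col te_zero)
    also have "\<dots> = (\<Oplus>\<^bsub>T\<^esub>l\<in>V. if j = k then te (x j l) (y l i) else \<zero>\<^bsub>T\<^esub>)"
      using i j k by (intro TT.finsum_cong') (auto simp: te_mult x.x_col y.x_col te_zero)
    finally show "(\<Oplus>\<^bsub>T\<^esub>l\<in>V. te (x j l) (y l i)) \<otimes>\<^bsub>T\<^esub> (\<Oplus>\<^bsub>T\<^esub>l\<in>V. te (x k l) (y l i)) =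
        (if j = k then \<Oplus>\<^bsub>T\<^esub>l\<in>V. te (x j l) (y l i) else \<zero>\<^bsub>T\<^esub>)"
      by simp
  next
    fix i assume i: "i \<in> V"
    have "(\<Oplus>\<^bsub>T\<^esub>l\<in>V. \<Oplus>\<^bsub>T\<^esub>k\<in>V. te (x i k) (y k l)) = (\<Oplus>\<^bsub>T\<^esub>k\<in>V. \<Oplus>\<^bsub>T\<^esub>l\<in>V. te (x i k) (y k l))"
      using i by (intro TT.finsum_exchange) auto
    also have "\<dots> = (\<Oplus>\<^bsub>T\<^esub>k\<in>V. te (x i k) \<one>\<^bsub>B\<^esub>)"
    proof (intro TT.finsum_cong' refl)
      show "(\<Oplus>\<^bsub>T\<^esub>l\<in>V. te (x i k) (y k l)) = te (x i k) \<one>\<^bsub>B\<^esub>" if "k \<in> V" for k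
        using te_finsum(2)[of "y k" V "x i k"] i that by (simp add: y.row_sum Pi_def)
    qed (use i in auto)
    also have "\<dots> = \<one>\<^bsub>T\<^esub>"
      using i te_finsum(1)[of "x i" V "\<one>\<^bsub>B\<^esub>"] by (simp add: x.row_sum te_one Pi_def)
    finally show "(\<Oplus>\<^bsub>T\<^esub>l\<in>V. \<Oplus>\<^bsub>T\<^esub>k\<in>V. te (x i k) (y k l)) = \<one>\<^bsub>T\<^esub>" .
    have "(\<Oplus>\<^bsub>T\<^esub>l\<in>V. \<Oplus>\<^bsub>T\<^esub>k\<in>V. te (x l k) (y k i)) = (\<Oplus>\<^bsub>T\<^esub>k\<in>V. \<Oplus>\<^bsub>T\<^esub>l\<in>V. te (x l k) (y k i))"
      using i by (intro TT.finsum_exchange) auto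
    also have "\<dots> = (\<Oplus>\<^bsub>T\<^esub>k\<in>V. te \<one>\<^bsub>A\<^esub> (y k i))"
    proof (intro TT.finsum_cong' refl)
      show "(\<Oplus>\<^bsub>T\<^esub>l\<in>V. te (x l k) (y k i)) = te \<one>\<^bsub>A\<^esub> (y k i)" if "k \<in> V" for k
        using te_finsum(1)[of "\<lambda>l. x l k" V "y k i"] i that by (simp add: x.col_sum Pi_def)
    qed (use i in auto)
    also have "\<dots> = \<one>\<^bsub>T\<^esub>"
      using i te_finsum(2)[of "\<lambda>l. y l i" V "\<one>\<^bsub>A\<^esub>"] by (simp add: y.col_sum te_one Pi_def)
    finally show "(\<Oplus>\<^bsub>T\<^esub>l\<in>V. \<Oplus>\<^bsub>T\<^esub>k\<in>V. te (x l k) (y k i)) = \<one>\<^bsub>T\<^esub>" .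
  qed
qed

section \<open>Finite involutions and the permutations commuting with them\<close>

locale finite_involution =
  fixes V :: "'v set" and \<sigma> :: "'v \<Rightarrow> 'v"
  assumes finite_V: "finite V" and \<sigma>_closed [simp]: "i \<in> V \<Longrightarrow> \<sigma> i \<in> V"
    and \<sigma>_\<sigma> [simp]: "i \<in> V \<Longrightarrow> \<sigma> (\<sigma> i) = i"
begin

lemma \<sigma>_bij: "bij_betw \<sigma> V V"
  by (rule bij_betw_byWitness[of _ \<sigma>]) auto

definition aut_perms :: "('v \<Rightarrow> 'v) set" where
  "aut_perms = {\<pi>. bij_betw \<pi> V V \<and> (\<forall>j\<in>V. \<pi> (\<sigma> j) = \<sigma> (\<pi> j))}"

text \<open>Column \<open>j\<close> has its 1 in row \<open>\<pi> j\<close>. With this convention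
  the product of two matrices belongs to the composition of the permutations in the same
  order.\<close>

lemma magic_permutation:
  assumes "\<pi> \<in> aut_perms"
  shows "magic_family complex_numbers V \<sigma> (\<lambda>i j. if i = \<pi> j then 1 else 0)"
proof -
  have bij: "bij_betw \<pi> V V" and comm: "\<And>j. j \<in> V \<Longrightarrow> \<pi> (\<sigma> j) = \<sigma> (\<pi> j)"
    using assms by (auto simp: aut_perms_def)
  have inj: "\<pi> j = \<pi> k \<longleftrightarrow> j = k" if "j \<in> V" "k \<in> V" for j k
    using bij_betw_imp_inj_on[OF bij] that by (auto dest: inj_onD)
  have closed: "\<pi> j \<in> V" if "j \<in> V" for j
    using bij_betwE[OF bij] that by blast
  show ?thesis
  proof (intro magic_family.intro[OF complex_star_algebra_complex_numbers] magic_family_axioms.intro)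
    fix i assume i: "i \<in> V"
    then have "i \<in> \<pi> ` V"
      by (simp only: bij_betw_imp_surj_on[OF bij])
    then obtain l0 where l0: "l0 \<in> V" "\<pi> l0 = i" by blast
    have "i = \<pi> l \<longleftrightarrow> l0 = l" if "l \<in> V" for l
      using inj[OF l0(1) that] l0(2) by simp
    then have "(\<Sum>l\<in>V. if i = \<pi> l then 1 else 0) = (\<Sum>l\<in>V. if l0 = l then 1 else (0 :: complex))"
      by (intro sum.cong) simp_all
    then show "(\<Oplus>\<^bsub>complex_numbers\<^esub>l\<in>V. if i = \<pi> l then 1 else 0) = \<one>\<^bsub>complex_numbers\<^esub>"
      using finite_V l0 by (simp add: finsum_complex_numbers)
    show "(\<Oplus>\<^bsub>complex_numbers\<^esub>l\<in>V. if l = \<pi> i then 1 else 0) = \<one>\<^bsub>complex_numbers\<^esub>"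
      using finite_V closed[OF i] by (simp add: finsum_complex_numbers)
  next
    fix i j assume i: "i \<in> V" and j: "j \<in> V"
    have "\<sigma> i = \<sigma> (\<pi> j) \<longleftrightarrow> i = \<pi> j"
      by (rule inj_on_eq_iff[OF bij_betw_imp_inj_on[OF \<sigma>_bij] i closed[OF j]])
    then show "(if \<sigma> i = \<pi> (\<sigma> j) then 1 else (0 :: complex)) = (if i = \<pi> j then 1 else 0)"
      unfolding comm[OF j] by simp
  next
    fix i j k assume "i \<in> V" "j \<in> V" "k \<in> V"
    then show "(if i = \<pi> j then 1 else 0) \<otimes>\<^bsub>complex_numbers\<^esub> (if i = \<pi> k then 1 else 0) =
        (if j = k then if i = \<pi> j then 1 else 0 else \<zero>\<^bsub>complex_numbers\<^esub>)"
      using inj[of j k] by (cases "j = k") auto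
  qed simp_all
qed

text \<open>A complex idempotent is 0 or 1. Column orthogonality and column sums leave exactly one 1
  in each column, which defines \<open>\<pi>\<close>; row orthogonality makes it injective, and
  finiteness of \<open>V\<close> makes it bijective. By the symmetry, the 1 of column
  \<open>\<sigma> j\<close> stands in row \<open>\<sigma> (\<pi> j)\<close>.\<close>

lemma magic_complex_permutation:
  assumes "magic_family complex_numbers V \<sigma> x"
  obtains \<pi> where "\<pi> \<in> aut_perms" "\<And>i j. \<lbrakk>i \<in> V; j \<in> V\<rbrakk> \<Longrightarrow> x i j = (if i = \<pi> j then 1 else 0)"
proof -
  interpret x: magic_family complex_numbers V \<sigma> x by fact
  have idem: "x i j = 0 \<or> x i j = 1" if "i \<in> V" "j \<in> V" for i j
    using x.x_row[of i j j] that by simp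
  have row: "j = k" if "i \<in> V" "j \<in> V" "k \<in> V" "x i j = 1" "x i k = 1" for i j k
    using x.x_row[of i j k] that by (auto split: if_splits)
  have col: "i = k" if "i \<in> V" "j \<in> V" "k \<in> V" "x i j = 1" "x k j = 1" for i j k
    using x.x_col[of j i k] that by (auto split: if_splits)
  have "\<exists>i\<in>V. x i j = 1" if j: "j \<in> V" for j
  proof (rule ccontr)
    assume "\<not> ?thesis"
    then have "x i j = 0" if "i \<in> V" for i using idem that j by blast
    then show False using x.col_sum[OF j] by (simp add: finsum_complex_numbers)
  qed
  then have "\<forall>j\<in>V. \<exists>i. i \<in> V \<and> x i j = 1" by blast
  from bchoice[OF this] obtain \<pi> where \<pi>: "\<And>j. j \<in> V \<Longrightarrow> \<pi> j \<in> V" "\<And>j. j \<in> V \<Longrightarrow> x (\<pi> j) j = 1"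
    by blast
  have x_eq: "x i j = (if i = \<pi> j then 1 else 0)" if i: "i \<in> V" and j: "j \<in> V" for i j
  proof (cases "i = \<pi> j")
    case False
    then have "x i j \<noteq> 1" using col[OF i j \<pi>(1)[OF j] _ \<pi>(2)[OF j]] by blast
    then show ?thesis using idem[OF i j] False by simp
  qed (use \<pi>(2)[OF j] in simp)
  have "inj_on \<pi> V"
  proof (rule inj_onI)
    fix j k assume "j \<in> V" "k \<in> V" "\<pi> j = \<pi> k"
    then show "j = k" using row[of "\<pi> j" j k] \<pi>(1)[of j] \<pi>(2)[of j] \<pi>(2)[of k] by simp
  qed
  then have "bij_betw \<pi> V V"
    using \<pi>(1) endo_inj_surj[OF finite_V, of \<pi>] by (simp add: bij_betw_def image_subset_iff)
  moreover have "\<pi> (\<sigma> j) = \<sigma> (\<pi> j)" if "j \<in> V" for j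
    using col[of "\<sigma> (\<pi> j)" "\<sigma> j" "\<pi> (\<sigma> j)"] x.x_invol[of "\<pi> j" j] \<pi> that by simp
  ultimately show thesis
    using that[of \<pi>] x_eq by (simp add: aut_perms_def)
qed

end

section \<open>The presentation and its description by matrices of projections\<close>

locale involution_graph = finite_involution V \<sigma> for V :: "'v set" and \<sigma>
begin

definition G where "G = \<lparr>pverts = V, parcs = (\<lambda>i. (i, \<sigma> i)) ` V\<rparr>"

lemma G_simps [simp]: "pverts G = V" "parcs G = (\<lambda>i. (i, \<sigma> i)) ` V"
  by (simp_all add: G_def)

abbreviation W where "W \<equiv> word_monoid (V \<times> V)"

lemma W_simps: "carrier W = lists (V \<times> V)" "mult W = (@)" "one W = []"
  by (simp_all add: word_monoid_def)

sublocale W: involutive_monoid W rev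
proof -
  interpret Group.monoid W
    by (rule monoidI) (auto simp: W_simps)
  show "involutive_monoid W rev"
    by unfold_locales (auto simp: W_simps)
qed

abbreviation X where "X i j \<equiv> single [(i, j)] (1 :: complex)"
abbreviation XX where "XX i j k l \<equiv> single [(i, j), (k, l)] (1 :: complex)"
abbreviation I1 where "I1 \<equiv> single ([] :: ('v \<times> 'v) list) (1 :: complex)"

text \<open>An edge is determined by its source, so every quantifier and every sum over edges
  becomes one over vertices, with \<open>\<sigma>\<close> producing the target.\<close>

lemma aut_relations_eq:
  "aut_relations G =
    {XX i j i k - (if j = k then X i j else 0) | i j k. i \<in> V \<and> j \<in> V \<and> k \<in> V} \<union>
    {XX j i k i - (if j = k then X j i else 0) | i j k. i \<in> V \<and> j \<in> V \<and> k \<in> V} \<union>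
    {(\<Sum>l\<in>V. X i l) - I1 | i. i \<in> V} \<union>
    {(\<Sum>l\<in>V. X l i) - I1 | i. i \<in> V} \<union>
    {XX a i (\<sigma> a) k | a i k. a \<in> V \<and> i \<in> V \<and> k \<in> V \<and> k \<noteq> \<sigma> i} \<union>
    {XX (\<sigma> a) k a i | a i k. a \<in> V \<and> i \<in> V \<and> k \<in> V \<and> k \<noteq> \<sigma> i} \<union>
    {XX i a k (\<sigma> a) | a i k. a \<in> V \<and> i \<in> V \<and> k \<in> V \<and> k \<noteq> \<sigma> i} \<union>
    {XX k (\<sigma> a) i a | a i k. a \<in> V \<and> i \<in> V \<and> k \<in> V \<and> k \<noteq> \<sigma> i} \<union>
    {XX a b (\<sigma> a) (\<sigma> b) - XX (\<sigma> a) (\<sigma> b) a b | a b. a \<in> V \<and> b \<in> V} \<union>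
    {(\<Sum>i\<in>V. XX i a (\<sigma> i) (\<sigma> a)) - I1 | a. a \<in> V} \<union>
    {(\<Sum>i\<in>V. XX a i (\<sigma> a) (\<sigma> i)) - I1 | a. a \<in> V}"
proof -
  have mul: "single [(i, j)] 1 \<otimes>\<^bsub>free_star_algebra (V \<times> V)\<^esub> single [(k, l)] 1 = XX i j k l" for i j k l
    by (simp add: free_star_algebra_def W_simps)
  have one: "\<one>\<^bsub>free_star_algebra (V \<times> V)\<^esub> = I1"
    by (simp add: free_star_algebra_def W_simps)
  have inj: "inj_on (\<lambda>i. (i, \<sigma> i)) V" by (simp add: inj_on_def)
  have sum: "(\<Sum>h\<in>parcs G. f h) = (\<Sum>i\<in>V. f (i, \<sigma> i))" for f :: "_ \<Rightarrow> ('v \<times> 'v) list \<Rightarrow>\<^sub>0 complex"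
    by (simp add: sum.reindex[OF inj])
  have c1: "{f g | g. g \<in> parcs G} = {f (a, \<sigma> a) | a. a \<in> V}"
    for f :: "_ \<Rightarrow> ('v \<times> 'v) list \<Rightarrow>\<^sub>0 complex" by auto
  have c2: "{f g h | g h. g \<in> parcs G \<and> h \<in> parcs G} = {f (a, \<sigma> a) (b, \<sigma> b) | a b. a \<in> V \<and> b \<in> V}"
    for f :: "_ \<Rightarrow> _ \<Rightarrow> ('v \<times> 'v) list \<Rightarrow>\<^sub>0 complex"
    unfolding G_simps by blast
  have c3: "{f g i k | g i k. g \<in> parcs G \<and> (i, k) \<in> V \<times> V - parcs G} =
      {f (a, \<sigma> a) i k | a i k. a \<in> V \<and> i \<in> V \<and> k \<in> V \<and> k \<noteq> \<sigma> i}"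
    for f :: "_ \<Rightarrow> _ \<Rightarrow> _ \<Rightarrow> ('v \<times> 'v) list \<Rightarrow>\<^sub>0 complex"
  proof -
    have "(i, k) \<in> V \<times> V - parcs G \<longleftrightarrow> i \<in> V \<and> k \<in> V \<and> k \<noteq> \<sigma> i" for i k
      by auto
    then show ?thesis unfolding G_simps by blast
  qed
  show ?thesis
    by (simp only: aut_relations_def Let_def mul one G_simps(1) sum c1 c2 c3 fst_conv snd_conv)
qed

abbreviation F where "F \<equiv> W.MA"

lemma aut_free_eq: "aut_free G = F"
  by (simp add: free_star_algebra_def)

lemma relation_cases:
  assumes "r \<in> aut_relations G"
  obtains
      (row) i j k where "r = XX i j i k - (if j = k then X i j else 0)" "i \<in> V" "j \<in> V" "k \<in> V"
    | (col) i j k where "r = XX j i k i - (if j = k then X j i else 0)" "i \<in> V" "j \<in> V" "k \<in> V"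
    | (row_sum) i where "r = (\<Sum>l\<in>V. X i l) - I1" "i \<in> V"
    | (col_sum) i where "r = (\<Sum>l\<in>V. X l i) - I1" "i \<in> V"
    | (edge1) a i k where "r = XX a i (\<sigma> a) k" "a \<in> V" "i \<in> V" "k \<in> V" "k \<noteq> \<sigma> i"
    | (edge2) a i k where "r = XX (\<sigma> a) k a i" "a \<in> V" "i \<in> V" "k \<in> V" "k \<noteq> \<sigma> i"
    | (edge3) a i k where "r = XX i a k (\<sigma> a)" "a \<in> V" "i \<in> V" "k \<in> V" "k \<noteq> \<sigma> i"
    | (edge4) a i k where "r = XX k (\<sigma> a) i a" "a \<in> V" "i \<in> V" "k \<in> V" "k \<noteq> \<sigma> i"
    | (comm) a b where "r = XX a b (\<sigma> a) (\<sigma> b) - XX (\<sigma> a) (\<sigma> b) a b" "a \<in> V" "b \<in> V"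
    | (edge_sum1) a where "r = (\<Sum>i\<in>V. XX i a (\<sigma> i) (\<sigma> a)) - I1" "a \<in> V"
    | (edge_sum2) a where "r = (\<Sum>i\<in>V. XX a i (\<sigma> a) (\<sigma> i)) - I1" "a \<in> V"
  using assms unfolding aut_relations_eq
  by (elim UnE CollectE exE conjE) (rule that; assumption)+

lemma word_closed: "w \<in> lists (V \<times> V) \<Longrightarrow> single w c \<in> carrier F"
  by (simp add: W_simps)

lemma sum_closed: "(\<And>i. i \<in> V \<Longrightarrow> f i \<in> carrier F) \<Longrightarrow> (\<Sum>i\<in>V. f i) \<in> carrier F"
  using W.MA.finsum_closed[of f V] W.MA_finsum[of f V] by (auto simp: Pi_def simp del: W.MA_simps(1))

lemma zero_closed': "0 \<in> carrier F"
  by simp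

lemma relations_closed: "aut_relations G \<subseteq> carrier F"
proof
  fix r assume "r \<in> aut_relations G"
  then show "r \<in> carrier F"
    by (cases rule: relation_cases)
      (auto simp del: W.MA_simps(1) intro!: W.MA_minus_closed sum_closed word_closed zero_closed')
qed

lemma sum_invol: "(\<Sum>i\<in>V. f (\<sigma> i)) = (\<Sum>i\<in>V. f i)" for f :: "'v \<Rightarrow> _ \<Rightarrow>\<^sub>0 complex"
  by (rule sum.reindex_bij_betw[OF \<sigma>_bij])

lemma relation_row:
  assumes "i \<in> V" "j \<in> V" "k \<in> V"
  shows "XX i j i k - (if j = k then X i j else 0) \<in> aut_relations G"
proof -
  have "XX i j i k - (if j = k then X i j else 0) \<in>
      {XX i j i k - (if j = k then X i j else 0) | i j k. i \<in> V \<and> j \<in> V \<and> k \<in> V}"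
    using assms by (intro CollectI exI[of _ i] exI[of _ j] exI[of _ k]) simp
  then show ?thesis unfolding aut_relations_eq Un_iff by argo
qed

lemma relation_col:
  assumes "i \<in> V" "j \<in> V" "k \<in> V"
  shows "XX j i k i - (if j = k then X j i else 0) \<in> aut_relations G"
proof -
  have "XX j i k i - (if j = k then X j i else 0) \<in>
      {XX j i k i - (if j = k then X j i else 0) | i j k. i \<in> V \<and> j \<in> V \<and> k \<in> V}"
    using assms by (intro CollectI exI[of _ i] exI[of _ j] exI[of _ k]) simp
  then show ?thesis unfolding aut_relations_eq Un_iff by argo
qed

text \<open>Reversing words exchanges \<open>j\<close> and \<open>k\<close> in the orthogonality
  relations and swaps the two orders in (R2). The commutation relations and the edge sums go to
  those of the reversed edges, after a change of summation index by \<open>\<sigma>\<close>. So the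
  ideal of relations is stable under the involution.\<close>

lemma relations_star:
  assumes "r \<in> aut_relations G"
  shows "star F r \<in> aut_relations G"
  using assms
proof (cases rule: relation_cases)
  case (row i j k)
  then have "star F r = XX i k i j - (if k = j then X i k else 0)"
    by (simp add: W.MA_star_minus)
  with row show ?thesis using relation_row[of i k j] by simp
next
  case (col i j k)
  then have "star F r = XX k i j i - (if k = j then X k i else 0)"
    by (simp add: W.MA_star_minus)
  with col show ?thesis using relation_col[of i k j] by simp
next
  case (row_sum i)
  then have "star F r = (\<Sum>l\<in>V. X i l) - I1"
    by (simp add: W.MA_star_minus W.MA_star_sum)
  with row_sum show ?thesis unfolding aut_relations_eq by blast
next
  case (col_sum i)
  then have "star F r = (\<Sum>l\<in>V. X l i) - I1"
    by (simp add: W.MA_star_minus W.MA_star_sum)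
  with col_sum show ?thesis unfolding aut_relations_eq by blast
next
  case (edge1 a i k)
  then have "star F r = XX (\<sigma> a) k a i" by simp
  with edge1 show ?thesis unfolding aut_relations_eq by blast
next
  case (edge2 a i k)
  then have "star F r = XX a i (\<sigma> a) k" by simp
  with edge2 show ?thesis unfolding aut_relations_eq by blast
next
  case (edge3 a i k)
  then have "star F r = XX k (\<sigma> a) i a" by simp
  with edge3 show ?thesis unfolding aut_relations_eq by blast
next
  case (edge4 a i k)
  then have "star F r = XX i a k (\<sigma> a)" by simp
  with edge4 show ?thesis unfolding aut_relations_eq by blast
next
  case (comm a b)
  then have "star F r = XX (\<sigma> a) (\<sigma> b) (\<sigma> (\<sigma> a)) (\<sigma> (\<sigma> b)) - XX (\<sigma> (\<sigma> a)) (\<sigma> (\<sigma> b)) (\<sigma> a) (\<sigma> b)"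
    by (simp add: W.MA_star_minus)
  moreover have "\<sigma> a \<in> V" "\<sigma> b \<in> V" using comm by simp_all
  ultimately show ?thesis unfolding aut_relations_eq by blast
next
  case (edge_sum1 a)
  then have "star F r = (\<Sum>i\<in>V. XX (\<sigma> i) (\<sigma> a) (\<sigma> (\<sigma> i)) (\<sigma> (\<sigma> a))) - I1"
    by (simp add: W.MA_star_minus W.MA_star_sum)
  then have "star F r = (\<Sum>i\<in>V. XX i (\<sigma> a) (\<sigma> i) (\<sigma> (\<sigma> a))) - I1"
    by (simp only: sum_invol[of "\<lambda>i. XX i (\<sigma> a) (\<sigma> i) (\<sigma> (\<sigma> a))"])
  moreover have "\<sigma> a \<in> V" using edge_sum1 by simp
  ultimately show ?thesis unfolding aut_relations_eq by blast
next
  case (edge_sum2 a)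
  then have "star F r = (\<Sum>i\<in>V. XX (\<sigma> a) (\<sigma> i) (\<sigma> (\<sigma> a)) (\<sigma> (\<sigma> i))) - I1"
    by (simp add: W.MA_star_minus W.MA_star_sum)
  then have "star F r = (\<Sum>i\<in>V. XX (\<sigma> a) i (\<sigma> (\<sigma> a)) (\<sigma> i)) - I1"
    by (simp only: sum_invol[of "\<lambda>i. XX (\<sigma> a) i (\<sigma> (\<sigma> a)) (\<sigma> i)"])
  moreover have "\<sigma> a \<in> V" using edge_sum2 by simp
  ultimately show ?thesis unfolding aut_relations_eq by blast
qed

sublocale R: star_ideal F "aut_ideal G"
  unfolding aut_ideal_def aut_free_eq
  using W.MA.genideal_self[OF relations_closed]
  by (intro W.MA.star_ideal_genideal relations_closed) (auto dest: relations_star)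

abbreviation A0 where "A0 \<equiv> aut_algebra0 G"
abbreviation coset where "coset f \<equiv> aut_ideal G +>\<^bsub>F\<^esub> f"
abbreviation gen where "gen i j \<equiv> coset (X i j)"

lemma A0_eq: "A0 = R.Q"
  unfolding aut_algebra0_def aut_free_eq ..

sublocale A0: complex_star_algebra A0
  unfolding A0_eq by (rule R.quotient_star_algebra)

lemma coset_hom: "coset \<in> star_hom F A0"
  unfolding A0_eq by (rule R.coset_hom)

sublocale coset: star_algebra_hom F A0 coset
  by unfold_locales (rule coset_hom)

lemma coset_relation: "r \<in> aut_relations G \<Longrightarrow> coset r = \<zero>\<^bsub>A0\<^esub>"
proof -
  assume "r \<in> aut_relations G"
  then have "r \<in> aut_ideal G"
    using W.MA.genideal_self[OF relations_closed] unfolding aut_ideal_def aut_free_eq by blast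
  then show ?thesis
    using R.coset_eq_zero_iff[of r] R.a_Hcarr[of r]
    by (simp add: A0_eq quotient_star_algebra_def FactRing_def)
qed

lemma X_closed: "\<lbrakk>i \<in> V; j \<in> V\<rbrakk> \<Longrightarrow> X i j \<in> carrier F"
  by (simp add: W_simps)

lemma XX_eq: "XX i j k l = X i j \<otimes>\<^bsub>F\<^esub> X k l"
  by (simp add: W_simps)

lemma hom_diff:
  assumes "star_algebra_hom F T h" "f \<in> carrier F" "g \<in> carrier F"
  shows "h (f - g) = h f \<ominus>\<^bsub>T\<^esub> h g"
  using star_algebra_hom.hom_minus[OF assms] W.MA_minus[OF assms(2,3)] by simp

lemma hom_sum:
  assumes "star_algebra_hom F T h" "\<And>i. i \<in> V \<Longrightarrow> f i \<in> carrier F"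
  shows "h (\<Sum>i\<in>V. f i) = (\<Oplus>\<^bsub>T\<^esub>i\<in>V. h (f i))"
  using star_algebra_hom.hom_finsum[OF assms(1), of f V] W.MA_finsum[of f V] assms(2)
  by (auto simp: Pi_def simp del: W.MA_simps(1))

lemma hom_I1: "star_algebra_hom F T h \<Longrightarrow> h I1 = \<one>\<^bsub>T\<^esub>"
  using star_homD(6)[OF star_algebra_hom.hom, of F T h] by (simp add: W_simps)

lemma hom_XX:
  assumes "star_algebra_hom F T h" "i \<in> V" "j \<in> V" "k \<in> V" "l \<in> V"
  shows "h (XX i j k l) = h (X i j) \<otimes>\<^bsub>T\<^esub> h (X k l)"
  unfolding XX_eq by (intro star_hom_mult[OF star_algebra_hom.hom[OF assms(1)]] X_closed assms)

lemma XX_closed: "\<lbrakk>i \<in> V; j \<in> V; k \<in> V; l \<in> V\<rbrakk> \<Longrightarrow> XX i j k l \<in> carrier F"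
  by (simp add: W_simps)

lemma gen_closed [simp]: "\<lbrakk>i \<in> V; j \<in> V\<rbrakk> \<Longrightarrow> gen i j \<in> carrier A0"
  by (rule star_hom_closed[OF coset_hom X_closed])

lemma gen_sums:
  assumes i: "i \<in> V"
  shows "(\<Oplus>\<^bsub>A0\<^esub>l\<in>V. gen i l) = \<one>\<^bsub>A0\<^esub>" "(\<Oplus>\<^bsub>A0\<^esub>l\<in>V. gen l i) = \<one>\<^bsub>A0\<^esub>"
proof -
  note coset_hom' = coset.star_algebra_hom_axioms
  note eqs = hom_diff[OF coset_hom'] hom_sum[OF coset_hom'] hom_I1[OF coset_hom']
  have "coset ((\<Sum>l\<in>V. X i l) - I1) = \<zero>\<^bsub>A0\<^esub>" "coset ((\<Sum>l\<in>V. X l i) - I1) = \<zero>\<^bsub>A0\<^esub>"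
    by (rule coset_relation, use i in \<open>unfold aut_relations_eq, blast\<close>)+
  then show "(\<Oplus>\<^bsub>A0\<^esub>l\<in>V. gen i l) = \<one>\<^bsub>A0\<^esub>" "(\<Oplus>\<^bsub>A0\<^esub>l\<in>V. gen l i) = \<one>\<^bsub>A0\<^esub>"
    using i by (simp_all add: eqs X_closed word_closed sum_closed A0.finsum_closed Pi_def del: W.MA_simps(1))
qed

lemma magic_gen: "magic_family A0 V \<sigma> gen"
proof unfold_locales
  note coset_hom' = coset.star_algebra_hom_axioms
  note eqs = hom_diff[OF coset_hom'] hom_XX[OF coset_hom']
  fix i j assume i: "i \<in> V" and j: "j \<in> V"
  show "star A0 (gen i j) = gen i j"
    using star_hom_star[OF coset_hom X_closed[OF i j]] by simp
  fix k assume k: "k \<in> V"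
  have "coset (XX i j i k - (if j = k then X i j else 0)) = \<zero>\<^bsub>A0\<^esub>"
    by (intro coset_relation relation_row i j k)
  then show "gen i j \<otimes>\<^bsub>A0\<^esub> gen i k = (if j = k then gen i j else \<zero>\<^bsub>A0\<^esub>)"
    using i j k coset.hom_zero by (auto simp: eqs X_closed XX_closed simp del: W.MA_simps(1))
  have "coset (XX j i k i - (if j = k then X j i else 0)) = \<zero>\<^bsub>A0\<^esub>"
    by (intro coset_relation relation_col i j k)
  then show "gen j i \<otimes>\<^bsub>A0\<^esub> gen k i = (if j = k then gen j i else \<zero>\<^bsub>A0\<^esub>)"
    using i j k coset.hom_zero by (auto simp: eqs X_closed XX_closed simp del: W.MA_simps(1))
next
  fix i j assume i: "i \<in> V" and j: "j \<in> V"
  \<comment> \<open>Both \<open>gen i j\<close> and \<open>gen (\<sigma> i) (\<sigma> j)\<close>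
    will be shown equal to this product, by inserting the sum of the row of the missing
    factor.\<close>
  let ?e = "gen i j \<otimes>\<^bsub>A0\<^esub> gen (\<sigma> i) (\<sigma> j)"
  have zero: "gen i l \<otimes>\<^bsub>A0\<^esub> gen (\<sigma> i) k = \<zero>\<^bsub>A0\<^esub>" if "l \<in> V" "k \<in> V" "k \<noteq> \<sigma> l" for l k
  proof -
    have "coset (XX i l (\<sigma> i) k) = \<zero>\<^bsub>A0\<^esub>"
      by (rule coset_relation) (use i that in \<open>unfold aut_relations_eq, blast\<close>)
    then show ?thesis
      using hom_XX[OF coset.star_algebra_hom_axioms, of i l "\<sigma> i" k] i that by simp
  qed
  have "gen i j = gen i j \<otimes>\<^bsub>A0\<^esub> (\<Oplus>\<^bsub>A0\<^esub>k\<in>V. gen (\<sigma> i) k)"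
    using i j by (simp add: gen_sums)
  also have "\<dots> = (\<Oplus>\<^bsub>A0\<^esub>k\<in>V. gen i j \<otimes>\<^bsub>A0\<^esub> gen (\<sigma> i) k)"
    using i j by (intro A0.finsum_rdistr finite_V) auto
  also have "\<dots> = (\<Oplus>\<^bsub>A0\<^esub>k\<in>V. if \<sigma> j = k then ?e else \<zero>\<^bsub>A0\<^esub>)"
    using i j zero by (intro A0.finsum_cong') auto
  also have "\<dots> = ?e"
    using i j finite_V by (intro A0.finsum_singleton) auto
  finally have 1: "gen i j = ?e" .
  have "gen (\<sigma> i) (\<sigma> j) = (\<Oplus>\<^bsub>A0\<^esub>k\<in>V. gen i k) \<otimes>\<^bsub>A0\<^esub> gen (\<sigma> i) (\<sigma> j)"
    using i j by (simp add: gen_sums)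
  also have "\<dots> = (\<Oplus>\<^bsub>A0\<^esub>k\<in>V. gen i k \<otimes>\<^bsub>A0\<^esub> gen (\<sigma> i) (\<sigma> j))"
    using i j by (intro A0.finsum_ldistr finite_V) auto
  also have "\<dots> = (\<Oplus>\<^bsub>A0\<^esub>k\<in>V. if j = k then ?e else \<zero>\<^bsub>A0\<^esub>)"
  proof (intro A0.finsum_cong')
    show "gen i k \<otimes>\<^bsub>A0\<^esub> gen (\<sigma> i) (\<sigma> j) = (if j = k then ?e else \<zero>\<^bsub>A0\<^esub>)" if "k \<in> V" for k
    proof (cases "j = k")
      case False
      then have "\<sigma> j \<noteq> \<sigma> k" using \<sigma>_\<sigma> j that by metis
      then show ?thesis using zero[of k "\<sigma> j"] that j False by simp
    qed simp
  qed (use i j in auto)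
  also have "\<dots> = ?e"
    using i j finite_V by (intro A0.finsum_singleton) auto
  finally show "gen (\<sigma> i) (\<sigma> j) = gen i j" using 1 by simp
qed (simp_all add: gen_sums)

text \<open>Under the symmetry, the edge relations (R2) become orthogonality within a row or a
  column, the two factors of a commutator in (R3) coincide, and each summand in (R4) is the square
  of a projection, so that (R4) reduces to column and row sums.\<close>

lemma magic_family_relations:
  assumes "magic_family T V \<sigma> x" and h: "star_algebra_hom F T h"
    and hX: "\<And>i j. \<lbrakk>i \<in> V; j \<in> V\<rbrakk> \<Longrightarrow> h (X i j) = x i j" and r: "r \<in> aut_relations G"
  shows "h r = \<zero>\<^bsub>T\<^esub>"
proof -
  interpret magic_family T V \<sigma> x by fact
  interpret h: star_algebra_hom F T h by fact
  note eqs = hom_diff[OF h] hom_sum[OF h] hom_I1[OF h] hom_XX[OF h] hX X_closed XX_closed word_closed sum_closed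
  note [simp del] = W.MA_simps(1)
  have h0 [simp]: "h 0 = \<zero>\<^bsub>T\<^esub>" using h.hom_zero by simp
  have invol_mult: "x i j \<otimes>\<^bsub>T\<^esub> x (\<sigma> i) (\<sigma> j) = x i j" if "i \<in> V" "j \<in> V" for i j
    using x_invol[OF that] x_row[of i j j] that by simp
  have left: "x a i \<otimes>\<^bsub>T\<^esub> x (\<sigma> a) k = \<zero>\<^bsub>T\<^esub>" "x (\<sigma> a) k \<otimes>\<^bsub>T\<^esub> x a i = \<zero>\<^bsub>T\<^esub>"
    "x i a \<otimes>\<^bsub>T\<^esub> x k (\<sigma> a) = \<zero>\<^bsub>T\<^esub>" "x k (\<sigma> a) \<otimes>\<^bsub>T\<^esub> x i a = \<zero>\<^bsub>T\<^esub>"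
    if "a \<in> V" "i \<in> V" "k \<in> V" "k \<noteq> \<sigma> i" for a i k
    using x_invol[of a i, symmetric] x_invol[of i a, symmetric] that
    by (auto simp: x_row x_col)
  note sums = row_sum col_sum
  from r show ?thesis
  proof (cases rule: relation_cases)
    case (row i j k)
    then show ?thesis using x_row[of i j k] by (auto simp: eqs a_minus_def r_neg zero_closed')
  next
    case (col i j k)
    then show ?thesis using x_col[of i j k] by (auto simp: eqs a_minus_def r_neg zero_closed')
  next
    case (row_sum i)
    have "(\<Oplus>\<^bsub>T\<^esub>l\<in>V. h (X i l)) = (\<Oplus>\<^bsub>T\<^esub>l\<in>V. x i l)"
      by (rule finsum_cong') (use row_sum hX in auto)
    with row_sum show ?thesis by (simp add: eqs sums a_minus_def r_neg)
  next
    case (col_sum i)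
    have "(\<Oplus>\<^bsub>T\<^esub>l\<in>V. h (X l i)) = (\<Oplus>\<^bsub>T\<^esub>l\<in>V. x l i)"
      by (rule finsum_cong') (use col_sum hX in auto)
    with col_sum show ?thesis by (simp add: eqs sums a_minus_def r_neg)
  next
    case (edge1 a i k)
    then show ?thesis by (simp add: eqs left)
  next
    case (edge2 a i k)
    then show ?thesis by (simp add: eqs left)
  next
    case (edge3 a i k)
    then show ?thesis by (simp add: eqs left)
  next
    case (edge4 a i k)
    then show ?thesis by (simp add: eqs left)
  next
    case (comm a b)
    then show ?thesis by (simp add: eqs x_invol a_minus_def r_neg)
  next
    case (edge_sum1 a)
    have "(\<Oplus>\<^bsub>T\<^esub>l\<in>V. h (XX l a (\<sigma> l) (\<sigma> a))) = (\<Oplus>\<^bsub>T\<^esub>l\<in>V. x l a)"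
      by (rule finsum_cong') (use edge_sum1 in \<open>auto simp: eqs invol_mult\<close>)
    with edge_sum1 show ?thesis by (simp add: eqs sums a_minus_def r_neg)
  next
    case (edge_sum2 a)
    have "(\<Oplus>\<^bsub>T\<^esub>l\<in>V. h (XX a l (\<sigma> a) (\<sigma> l))) = (\<Oplus>\<^bsub>T\<^esub>l\<in>V. x a l)"
      by (rule finsum_cong') (use edge_sum2 in \<open>auto simp: eqs invol_mult\<close>)
    with edge_sum2 show ?thesis by (simp add: eqs sums a_minus_def r_neg)
  qed
qed

text \<open>Words are evaluated at the entries of \<open>x\<close>. Reversal of a word matches the
  involution of \<open>T\<close> because the entries are self-adjoint.\<close>

lemma aut_algebra0_universal:
  assumes "magic_family T V \<sigma> x"
  obtains h where "h \<in> star_hom A0 T" "\<And>i j. \<lbrakk>i \<in> V; j \<in> V\<rbrakk> \<Longrightarrow> h (gen i j) = x i j"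
proof -
  interpret magic_family T V \<sigma> x by fact
  define u where "u w = foldr (\<lambda>(i, j) y. x i j \<otimes>\<^bsub>T\<^esub> y) w \<one>\<^bsub>T\<^esub>" for w
  have u_simps [simp]: "u [] = \<one>\<^bsub>T\<^esub>" "u ((i, j) # w) = x i j \<otimes>\<^bsub>T\<^esub> u w" for i j w
    by (simp_all add: u_def)
  have u_closed [simp]: "u w \<in> carrier T" if "w \<in> lists (V \<times> V)" for w
    using that by (induction w rule: lists.induct) auto
  have u_append: "u (v @ w) = u v \<otimes>\<^bsub>T\<^esub> u w" if v: "v \<in> lists (V \<times> V)" and w: "w \<in> lists (V \<times> V)" for v w
    using v
  proof (induction v rule: lists.induct)
    case (Cons a v)
    then show ?case using u_closed[OF Cons(2)] u_closed[OF w] by (cases a) (simp add: m_assoc)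
  qed (use u_closed[OF w] in simp)
  have u_rev: "u (rev w) = star T (u w)" if "w \<in> lists (V \<times> V)" for w
    using that
  proof (induction w rule: lists.induct)
    case (Cons a w)
    then have "rev w \<in> lists (V \<times> V)" by (simp add: in_lists_conv_set)
    with Cons show ?case using u_closed[OF Cons(2)] u_append[of "rev w" "[a]"]
      by (cases a) (simp add: x_star star_mult)
  qed simp
  obtain h where h: "h \<in> star_hom F T"
    and h_single: "\<And>w c. w \<in> carrier W \<Longrightarrow> h (single w c) = c \<odot>\<^bsub>T\<^esub> u w"
    by (rule W.monoid_star_algebra_universal[OF complex_star_algebra_axioms, of u])
      (auto simp: W_simps u_append u_rev)
  interpret h: star_algebra_hom F T h by unfold_locales (rule h)
  have hX: "h (X i j) = x i j" if "i \<in> V" "j \<in> V" for i j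
    using h_single[of "[(i, j)]" 1] that by (simp add: W_simps)
  have "h f = \<zero>\<^bsub>T\<^esub>" if "f \<in> aut_ideal G" for f
    using h.hom_genideal[OF relations_closed] that
      magic_family_relations[OF assms h.star_algebra_hom_axioms hX]
    unfolding aut_ideal_def aut_free_eq by blast
  then obtain k where "k \<in> star_hom A0 T" "\<And>f. f \<in> carrier F \<Longrightarrow> k (coset f) = h f"
    using R.quotient_universal[OF complex_star_algebra_axioms h] unfolding A0_eq by blast
  then show thesis
    using that[of k] hX X_closed by simp
qed

lemma word_Cons:
  "\<lbrakk>i \<in> V; j \<in> V; w \<in> lists (V \<times> V)\<rbrakk> \<Longrightarrow>
    coset (single ((i, j) # w) 1) = gen i j \<otimes>\<^bsub>A0\<^esub> coset (single w 1)"
proof -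
  assume "i \<in> V" "j \<in> V" "w \<in> lists (V \<times> V)"
  then have "coset (X i j \<otimes>\<^bsub>F\<^esub> single w 1) = gen i j \<otimes>\<^bsub>A0\<^esub> coset (single w 1)"
    by (intro star_hom_mult[OF coset_hom] X_closed word_closed)
  then show ?thesis by (simp only: W.MA_mult_single) (simp add: W_simps)
qed

lemma A0_cases:
  assumes "z \<in> carrier A0"
  obtains f where "z = coset f" "f \<in> carrier F"
  using assms unfolding A0_eq R.carrier_Q by blast

lemma aut_algebra0_hom_eqI:
  assumes h: "h \<in> star_hom A0 T" and k: "k \<in> star_hom A0 T" and T: "complex_star_algebra T"
    and eq: "\<And>i j. \<lbrakk>i \<in> V; j \<in> V\<rbrakk> \<Longrightarrow> h (gen i j) = k (gen i j)" and z: "z \<in> carrier A0"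
  shows "h z = k z"
proof -
  obtain f where f: "z = coset f" "f \<in> carrier F" using z by (rule A0_cases)
  have words: "h (coset (single w 1)) = k (coset (single w 1))"
    if "w \<in> lists (V \<times> V)" for w
    using that
  proof (induction w rule: lists.induct)
    case Nil
    have "coset (single [] 1) = \<one>\<^bsub>A0\<^esub>"
      by (rule hom_I1[OF coset.star_algebra_hom_axioms])
    then show ?case
      by (simp only: star_hom_one[OF h] star_hom_one[OF k])
  next
    case (Cons a w)
    obtain i j where a: "a = (i, j)" "i \<in> V" "j \<in> V" using Cons(1) by auto
    have w: "coset (single w 1) \<in> carrier A0"
      by (intro star_hom_closed[OF coset_hom] word_closed Cons)
    show ?case
      unfolding a(1) word_Cons[OF a(2,3) Cons(2)] star_hom_mult[OF h gen_closed[OF a(2,3)] w]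
        star_hom_mult[OF k gen_closed[OF a(2,3)] w] eq[OF a(2,3)] Cons.IH ..
  qed
  have "h (coset f) = k (coset f)"
    by (rule W.monoid_star_algebra_hom_eqI[OF star_hom_compose[OF coset_hom h] star_hom_compose[OF coset_hom k] T _ f(2)])
      (simp only: words W_simps)
  then show ?thesis by (simp only: f(1))
qed

text \<open>Words are products of projections, so every C*-seminorm is at most 1 on them.\<close>

lemma aut_algebra0_bounded:
  assumes "z \<in> carrier A0"
  shows "\<exists>K. \<forall>p. cstar_seminorm A0 p \<longrightarrow> p z \<le> K"
proof -
  interpret magic_family A0 V \<sigma> gen by (rule magic_gen)
  obtain f where f: "z = coset f" "f \<in> carrier F" using assms by (rule A0_cases)
  have word: "p (coset (single w 1)) \<le> 1" if p: "cstar_seminorm A0 p" and "w \<in> lists (V \<times> V)" for p w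
  proof -
    interpret cstar_seminormed A0 p by unfold_locales (rule p)
    show ?thesis using \<open>w \<in> _\<close>
    proof (induction w rule: lists.induct)
      case Nil
      then show ?case
        using hom_I1[OF coset.star_algebra_hom_axioms] p_idempotent_le_1[of "\<one>\<^bsub>A0\<^esub>"] by simp
    next
      case (Cons a w)
      obtain i j where a: "a = (i, j)" "i \<in> V" "j \<in> V" using Cons(1) by auto
      have w: "coset (single w 1) \<in> carrier A0"
        by (intro star_hom_closed[OF coset_hom] word_closed Cons)
      have "p (gen i j) \<le> 1"
        using a by (intro p_idempotent_le_1) (simp_all add: x_star x_row)
      then have "p (gen i j) * p (coset (single w 1)) \<le> 1 * 1"
        using Cons.IH p_nonneg[OF w] by (intro mult_mono) simp_all
      then show ?case
        using p_mult[OF gen_closed[OF a(2,3)] w] unfolding a(1) word_Cons[OF a(2,3) Cons(2)] by simp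
    qed
  qed
  have "\<exists>K. \<forall>p\<in>{p. cstar_seminorm A0 p}. p (coset f) \<le> K"
    by (rule W.seminorms_bounded_on_image[OF A0.complex_star_algebra_axioms coset_hom f(2), of _ "\<lambda>_. 1"])
      (simp_all only: mem_Collect_eq word W_simps)
  then show ?thesis by (simp only: f(1) mem_Collect_eq Ball_def)
qed

section \<open>The enveloping C*-algebra and its universal property\<close>

sublocale U: cstar_seminormed A0 "universal_norm A0"
  by unfold_locales (rule cstar_seminorm_universal_norm[OF A0.complex_star_algebra_axioms aut_algebra0_bounded])

abbreviation A where "A \<equiv> aut_algebra G"
abbreviation g where "g \<equiv> aut_gen G"

lemma A_eq: "A = U.compl"
  by (simp add: aut_algebra_def cstar_envelope_def)

sublocale A: cstar_algebra A
  unfolding A_eq by (rule U.cstar_algebra_compl)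

lemma g_eq: "g i j = U.\<iota> (gen i j)"
  unfolding aut_gen_def aut_free_eq ..

lemma \<iota>_hom: "U.\<iota> \<in> star_hom A0 A"
  unfolding A_eq by (rule U.\<iota>_hom)

lemma magic_g: "magic_family A V \<sigma> g"
proof -
  interpret star_algebra_hom A0 A U.\<iota> by unfold_locales (rule \<iota>_hom)
  show ?thesis
    using magic_family_image[OF magic_gen] by (simp add: g_eq[abs_def])
qed

sublocale g: magic_family A V \<sigma> g
  by (rule magic_g)

text \<open>The universal norm dominates the pullback of the norm of \<open>B\<close>, so the
  homomorphism defined on \<open>A0\<close> is contractive and extends.\<close>

lemma extend_to_aut_algebra:
  assumes "cstar_algebra B" and "magic_family B V \<sigma> x"
  obtains H where "H \<in> star_hom A B" "\<And>i j. \<lbrakk>i \<in> V; j \<in> V\<rbrakk> \<Longrightarrow> H (g i j) = x i j"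
    "\<And>a. a \<in> carrier A \<Longrightarrow> alg_norm B (H a) \<le> alg_norm A a"
proof -
  interpret B: cstar_algebra B by fact
  obtain h where h: "h \<in> star_hom A0 B" "\<And>i j. \<lbrakk>i \<in> V; j \<in> V\<rbrakk> \<Longrightarrow> h (gen i j) = x i j"
    using aut_algebra0_universal[OF assms(2)] by blast
  have "cstar_seminorm A0 (\<lambda>z. alg_norm B (h z))"
    by (rule cstar_seminorm_pullback[OF A0.complex_star_algebra_axioms h(1) B.seminorm])
  then have "alg_norm B (h z) \<le> universal_norm A0 z" if "z \<in> carrier A0" for z
    using le_universal_norm[OF A0.complex_star_algebra_axioms aut_algebra0_bounded] that by blast
  then obtain H where "H \<in> star_hom A B" "\<And>z. z \<in> carrier A0 \<Longrightarrow> H (U.\<iota> z) = h z"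
      "\<And>a. a \<in> carrier A \<Longrightarrow> alg_norm B (H a) \<le> alg_norm A a"
    using U.extend_to_completion[OF assms(1) h(1)] unfolding A_eq by blast
  then show thesis
    using that[of H] h(2) by (simp add: g_eq)
qed

lemma hom_eq_on_\<iota>:
  assumes "complex_star_algebra B" "H \<in> star_hom A B" "K \<in> star_hom A B"
    and "\<And>i j. \<lbrakk>i \<in> V; j \<in> V\<rbrakk> \<Longrightarrow> H (g i j) = K (g i j)" "z \<in> carrier A0"
  shows "H (U.\<iota> z) = K (U.\<iota> z)"
  by (rule aut_algebra0_hom_eqI[OF star_hom_compose[OF \<iota>_hom assms(2)] star_hom_compose[OF \<iota>_hom assms(3)]])
    (use assms in \<open>simp_all add: g_eq\<close>)

lemma aut_algebra_hom_eqI: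
  assumes "cstar_algebra B" "H \<in> star_hom A B" "K \<in> star_hom A B"
    and "\<And>a. a \<in> carrier A \<Longrightarrow> alg_norm B (H a) \<le> c * alg_norm A a"
    and "\<And>a. a \<in> carrier A \<Longrightarrow> alg_norm B (K a) \<le> d * alg_norm A a"
    and "\<And>i j. \<lbrakk>i \<in> V; j \<in> V\<rbrakk> \<Longrightarrow> H (g i j) = K (g i j)" "a \<in> carrier A"
  shows "H a = K a"
  by (rule U.completion_hom_eqI[folded A_eq, OF assms(1-5) _ assms(7)])
    (use assms hom_eq_on_\<iota>[OF cstar_algebra.axioms(1)[OF assms(1)] assms(2,3)] in blast)+

lemma aut_character_eqI:
  assumes "\<kappa> \<in> characters A" "\<psi> \<in> characters A"
    and "\<And>i j. \<lbrakk>i \<in> V; j \<in> V\<rbrakk> \<Longrightarrow> \<kappa> (g i j) = \<psi> (g i j)"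
  shows "\<kappa> = \<psi>"
  by (rule U.character_eqI[folded A_eq, OF assms(1,2)], rule hom_eq_on_\<iota>[OF complex_star_algebra_complex_numbers])
    (use assms in \<open>auto simp: characters_def\<close>)

lemma aut_character_exists:
  assumes "magic_family complex_numbers V \<sigma> x"
  obtains \<kappa> where "\<kappa> \<in> characters A" "\<And>i j. \<lbrakk>i \<in> V; j \<in> V\<rbrakk> \<Longrightarrow> \<kappa> (g i j) = x i j"
proof -
  obtain h where h: "h \<in> star_hom A0 complex_numbers" "\<And>i j. \<lbrakk>i \<in> V; j \<in> V\<rbrakk> \<Longrightarrow> h (gen i j) = x i j"
    using aut_algebra0_universal[OF assms] by blast
  have "cstar_seminorm A0 (\<lambda>z. cmod (h z))"
    by (rule cstar_seminorm_pullback[OF A0.complex_star_algebra_axioms h(1) cstar_seminorm_cmod])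
  then have "cmod (h z) \<le> universal_norm A0 z" if "z \<in> carrier A0" for z
    using le_universal_norm[OF A0.complex_star_algebra_axioms aut_algebra0_bounded] that by blast
  then obtain \<kappa> where "\<kappa> \<in> characters A" "\<And>z. z \<in> carrier A0 \<Longrightarrow> \<kappa> (U.\<iota> z) = h z"
    using U.character_extension[OF h(1)] unfolding A_eq by blast
  then show thesis
    using that[of \<kappa>] h(2) by (simp add: g_eq)
qed

section \<open>The coproduct and the convolution of characters\<close>

sublocale AA: cstar_pair A A ..

abbreviation D where "D i j \<equiv> \<Oplus>\<^bsub>AA.T\<^esub>k\<in>V. AA.te (g i k) (g k j)"

text \<open>Existence: the matrix \<open>D\<close> satisfies the relations, by
  \<open>magic_family_tensor\<close>. Uniqueness: a bounded homomorphism is determined by its values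
  on the generators. Together they resolve the definite description.\<close>

lemma aut_coproduct:
  shows aut_coproduct_hom: "aut_coproduct G \<in> star_hom A AA.T"
    and aut_coproduct_gen: "\<And>i j. \<lbrakk>i \<in> V; j \<in> V\<rbrakk> \<Longrightarrow> aut_coproduct G (g i j) = D i j"
proof -
  have "magic_family AA.T V \<sigma> D"
    by (rule AA.magic_family_tensor[OF magic_g magic_g finite_V \<sigma>_bij])
  then obtain H where H: "H \<in> star_hom A AA.T" "\<And>i j. \<lbrakk>i \<in> V; j \<in> V\<rbrakk> \<Longrightarrow> H (g i j) = D i j"
    and H_le: "\<And>a. a \<in> carrier A \<Longrightarrow> alg_norm AA.T (H a) \<le> alg_norm A a"
    using extend_to_aut_algebra[OF AA.TT.cstar_algebra_axioms] by blast
  let ?P = "\<lambda>D'. D' \<in> star_hom A AA.T \<inter> extensional (carrier A) \<and>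
     (\<exists>C. \<forall>a\<in>carrier A. alg_norm AA.T (D' a) \<le> C * alg_norm A a) \<and>
     (\<forall>i\<in>V. \<forall>j\<in>V. D' (g i j) = D i j)"
  have "\<exists>!D'. ?P D'"
  proof (rule ex1I)
    show "?P (restrict H (carrier A))"
    proof (intro conjI ballI IntI)
      show "restrict H (carrier A) \<in> star_hom A AA.T"
        by (rule star_hom_cong[OF A.complex_star_algebra_axioms H(1)]) simp
      show "\<exists>C. \<forall>a\<in>carrier A. alg_norm AA.T (restrict H (carrier A) a) \<le> C * alg_norm A a"
        by (rule exI[of _ "1 :: real"]) (simp add: H_le)
    qed (simp_all add: H(2))
  next
    fix D' assume D': "?P D'"
    then obtain C where C: "\<And>a. a \<in> carrier A \<Longrightarrow> alg_norm AA.T (D' a) \<le> C * alg_norm A a" by blast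
    show "D' = restrict H (carrier A)"
    proof (rule extensionalityI)
      fix a assume a: "a \<in> carrier A"
      have "D' a = H a"
      proof (rule aut_algebra_hom_eqI[OF AA.TT.cstar_algebra_axioms _ H(1) C])
        show "alg_norm AA.T (H a) \<le> 1 * alg_norm A a" if "a \<in> carrier A" for a
          using H_le[OF that] by simp
        show "D' (g i j) = H (g i j)" if "i \<in> V" "j \<in> V" for i j
          using D' H(2)[OF that] that by simp
      qed (use D' a in simp_all)
      then show "D' a = restrict H (carrier A) a" using a by simp
    qed (use D' in auto)
  qed
  from theI'[OF this] have *: "?P (aut_coproduct G)"
    unfolding aut_coproduct_def G_simps .
  show "aut_coproduct G \<in> star_hom A AA.T"
    using * by simp
  show "aut_coproduct G (g i j) = D i j" if "i \<in> V" "j \<in> V" for i j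
    using * that by simp
qed

text \<open>Applying the tensor product of the two characters to the coproduct of a generator turns
  convolution into multiplication of complex matrices.\<close>

lemma aut_spectrum_mult:
  assumes \<kappa>: "\<kappa> \<in> characters A" and \<psi>: "\<psi> \<in> characters A"
  shows "\<kappa> \<otimes>\<^bsub>aut_spectrum G\<^esub> \<psi> \<in> characters A"
    and "\<And>i j. \<lbrakk>i \<in> V; j \<in> V\<rbrakk> \<Longrightarrow> (\<kappa> \<otimes>\<^bsub>aut_spectrum G\<^esub> \<psi>) (g i j) = (\<Sum>k\<in>V. \<kappa> (g i k) * \<psi> (g k j))"
proof -
  let ?t = "tensor_character A A \<kappa> \<psi>"
  have t: "?t \<in> star_hom AA.T complex_numbers"
    using AA.tensor_character(1)[OF \<kappa> \<psi>] unfolding characters_def by blast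
  interpret t: star_algebra_hom AA.T complex_numbers ?t
    by (rule star_algebra_homI[OF AA.TT.complex_star_algebra_axioms complex_star_algebra_complex_numbers t])
  have eq: "\<kappa> \<otimes>\<^bsub>aut_spectrum G\<^esub> \<psi> = compose (carrier A) ?t (aut_coproduct G)"
    by (simp only: aut_spectrum_def monoid.simps)
  have "compose (carrier A) ?t (aut_coproduct G) \<in> star_hom A complex_numbers"
    by (rule star_hom_cong[OF A.complex_star_algebra_axioms star_hom_compose[OF aut_coproduct_hom t]])
      (simp only: compose_def restrict_apply if_True)
  then show "\<kappa> \<otimes>\<^bsub>aut_spectrum G\<^esub> \<psi> \<in> characters A"
    unfolding eq by (simp add: characters_def compose_extensional)
  fix i j assume i: "i \<in> V" and j: "j \<in> V"
  have "(\<kappa> \<otimes>\<^bsub>aut_spectrum G\<^esub> \<psi>) (g i j) = ?t (D i j)"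
    unfolding eq compose_def by (simp only: restrict_apply aut_coproduct_gen[OF i j] g.x_closed[OF i j] if_True)
  also have "\<dots> = (\<Oplus>\<^bsub>complex_numbers\<^esub>k\<in>V. ?t (AA.te (g i k) (g k j)))"
    by (rule t.hom_finsum) (use i j in auto)
  also have "\<dots> = (\<Sum>k\<in>V. ?t (AA.te (g i k) (g k j)))"
    by (rule finsum_complex_numbers)
  also have "\<dots> = (\<Sum>k\<in>V. \<kappa> (g i k) * \<psi> (g k j))"
    by (intro sum.cong refl AA.tensor_character(2)[OF \<kappa> \<psi>] g.x_closed i j)
  finally show "(\<kappa> \<otimes>\<^bsub>aut_spectrum G\<^esub> \<psi>) (g i j) = (\<Sum>k\<in>V. \<kappa> (g i k) * \<psi> (g k j))" .
qed

section \<open>The spectrum\<close>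

text \<open>For \<open>\<pi>\<close> in \<open>aut_perms\<close> the choice has exactly one
  candidate, since a character is determined by its values on the generators.\<close>

definition perm_character where
  "perm_character \<pi> = (SOME \<kappa>. \<kappa> \<in> characters A \<and> (\<forall>i\<in>V. \<forall>j\<in>V. \<kappa> (g i j) = (if i = \<pi> j then 1 else 0)))"

lemma perm_character:
  assumes "\<pi> \<in> aut_perms"
  shows "perm_character \<pi> \<in> characters A"
    and "\<And>i j. \<lbrakk>i \<in> V; j \<in> V\<rbrakk> \<Longrightarrow> perm_character \<pi> (g i j) = (if i = \<pi> j then 1 else 0)"
proof -
  have "\<exists>\<kappa>. \<kappa> \<in> characters A \<and> (\<forall>i\<in>V. \<forall>j\<in>V. \<kappa> (g i j) = (if i = \<pi> j then 1 else 0))"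
    using aut_character_exists[OF magic_permutation[OF assms]] by metis
  from someI_ex[OF this] show "perm_character \<pi> \<in> characters A"
    "\<And>i j. \<lbrakk>i \<in> V; j \<in> V\<rbrakk> \<Longrightarrow> perm_character \<pi> (g i j) = (if i = \<pi> j then 1 else 0)"
    unfolding perm_character_def by blast+
qed

text \<open>A character maps the generating matrix to a complex matrix with the same relations, and
  such a matrix comes from a permutation.\<close>

lemma character_is_perm_character:
  assumes "\<kappa> \<in> characters A"
  obtains \<pi> where "\<pi> \<in> aut_perms" "\<kappa> = perm_character \<pi>"
proof -
  have "\<kappa> \<in> star_hom A complex_numbers" using assms unfolding characters_def by blast
  then interpret \<kappa>: star_algebra_hom A complex_numbers \<kappa>
    by (rule star_algebra_homI[OF A.complex_star_algebra_axioms complex_star_algebra_complex_numbers])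
  obtain \<pi> where \<pi>: "\<pi> \<in> aut_perms" "\<And>i j. \<lbrakk>i \<in> V; j \<in> V\<rbrakk> \<Longrightarrow> \<kappa> (g i j) = (if i = \<pi> j then 1 else 0)"
    using magic_complex_permutation[OF \<kappa>.magic_family_image[OF magic_g \<sigma>_closed]] by blast
  have "\<kappa> = perm_character \<pi>"
    by (rule aut_character_eqI[OF assms perm_character(1)[OF \<pi>(1)]])
      (simp only: \<pi>(2) perm_character(2)[OF \<pi>(1)])
  with \<pi>(1) show thesis by (rule that)
qed

text \<open>Elements of \<open>aut_perms\<close> are unconstrained outside \<open>V\<close>, so they
  correspond to characters only up to equality on \<open>V\<close>.\<close>

lemma perm_character_cong:
  assumes "\<pi> \<in> aut_perms" "\<rho> \<in> aut_perms" "\<And>j. j \<in> V \<Longrightarrow> \<pi> j = \<rho> j"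
  shows "perm_character \<pi> = perm_character \<rho>"
  by (rule aut_character_eqI[OF perm_character(1)[OF assms(1)] perm_character(1)[OF assms(2)]])
    (simp only: perm_character(2)[OF assms(1)] perm_character(2)[OF assms(2)] assms(3))

lemma perm_character_inj:
  assumes "\<pi> \<in> aut_perms" "\<rho> \<in> aut_perms" "perm_character \<pi> = perm_character \<rho>" "j \<in> V"
  shows "\<pi> j = \<rho> j"
proof -
  have "\<pi> j \<in> V" using assms(1,4) by (auto simp: aut_perms_def bij_betw_def)
  then show ?thesis
    using perm_character(2)[OF assms(1), of "\<pi> j" j] perm_character(2)[OF assms(2), of "\<pi> j" j] assms(3,4)
    by (auto split: if_splits)
qed

lemma perm_character_mult:
  assumes "\<pi> \<in> aut_perms" "\<rho> \<in> aut_perms" "\<tau> \<in> aut_perms" "\<And>j. j \<in> V \<Longrightarrow> \<tau> j = \<pi> (\<rho> j)"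
  shows "perm_character \<pi> \<otimes>\<^bsub>aut_spectrum G\<^esub> perm_character \<rho> = perm_character \<tau>"
proof (rule aut_character_eqI)
  show "perm_character \<pi> \<otimes>\<^bsub>aut_spectrum G\<^esub> perm_character \<rho> \<in> characters A"
    by (intro aut_spectrum_mult perm_character assms)
  fix i j assume i: "i \<in> V" and j: "j \<in> V"
  have \<rho>j: "\<rho> j \<in> V" using assms(2) j by (auto simp: aut_perms_def bij_betw_def)
  have "(perm_character \<pi> \<otimes>\<^bsub>aut_spectrum G\<^esub> perm_character \<rho>) (g i j) =
      (\<Sum>k\<in>V. perm_character \<pi> (g i k) * perm_character \<rho> (g k j))"
    by (intro aut_spectrum_mult(2) perm_character assms i j)
  \<comment> \<open>Column \<open>j\<close> of the second matrix has its only nonzero entry in row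
    \<open>\<rho> j\<close>.\<close>
  also have "\<dots> = (\<Sum>k\<in>V. if k = \<rho> j then (if i = \<pi> k then 1 else 0) else 0)"
    by (rule sum.cong) (simp_all only: perm_character(2)[OF assms(1)] perm_character(2)[OF assms(2)] i j, simp)
  also have "\<dots> = (if i = \<tau> j then 1 else 0)"
    using finite_V \<rho>j assms(4)[OF j] by simp
  finally show "(perm_character \<pi> \<otimes>\<^bsub>aut_spectrum G\<^esub> perm_character \<rho>) (g i j) = perm_character \<tau> (g i j)"
    by (simp only: perm_character(2)[OF assms(3) i j])
qed (rule perm_character assms)+

lemma perm_character_one:
  assumes "\<pi> \<in> aut_perms" "\<And>j. j \<in> V \<Longrightarrow> \<pi> j = j"
  shows "aut_counit G = perm_character \<pi>"
  unfolding aut_counit_def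
proof (rule the_equality)
  show "perm_character \<pi> \<in> characters A \<and>
      (\<forall>i\<in>pverts G. \<forall>j\<in>pverts G. perm_character \<pi> (g i j) = (if i = j then 1 else 0))"
    using perm_character[OF assms(1)] assms(2) by simp
  fix \<kappa> assume \<kappa>: "\<kappa> \<in> characters A \<and> (\<forall>i\<in>pverts G. \<forall>j\<in>pverts G. \<kappa> (g i j) = (if i = j then 1 else 0))"
  show "\<kappa> = perm_character \<pi>"
    by (rule aut_character_eqI) (use \<kappa> perm_character[OF assms(1)] assms(2) in simp_all)
qed

text \<open>The hypotheses on \<open>act\<close> identify \<open>H\<close> with the group of all
  permutations of \<open>V\<close> commuting with \<open>\<sigma>\<close>. The spectrum then
  receives associativity and inverses from \<open>H\<close> along a multiplicative
  bijection.\<close>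

theorem aut_spectrum_iso:
  assumes "Group.group H"
    and act: "\<And>h. h \<in> carrier H \<Longrightarrow> act h \<in> aut_perms"
    and act_mult: "\<And>h k j. \<lbrakk>h \<in> carrier H; k \<in> carrier H; j \<in> V\<rbrakk> \<Longrightarrow> act (h \<otimes>\<^bsub>H\<^esub> k) j = act h (act k j)"
    and act_one: "\<And>j. j \<in> V \<Longrightarrow> act \<one>\<^bsub>H\<^esub> j = j"
    and faithful: "\<And>h k. \<lbrakk>h \<in> carrier H; k \<in> carrier H; \<forall>j\<in>V. act h j = act k j\<rbrakk> \<Longrightarrow> h = k"
    and full: "\<And>\<pi>. \<pi> \<in> aut_perms \<Longrightarrow> \<exists>h\<in>carrier H. \<forall>j\<in>V. act h j = \<pi> j"
  shows "Group.group (aut_spectrum G)" and "aut_spectrum G \<cong> H"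
proof -
  interpret H: Group.group H by fact
  let ?\<Phi> = "\<lambda>h. perm_character (act h)"
  have carrier: "carrier (aut_spectrum G) = characters A" and one: "\<one>\<^bsub>aut_spectrum G\<^esub> = aut_counit G"
    by (simp_all only: aut_spectrum_def partial_object.simps monoid.simps)
  have hom: "?\<Phi> \<in> hom H (aut_spectrum G)"
  proof (rule homI)
    fix h k assume "h \<in> carrier H" "k \<in> carrier H"
    then show "?\<Phi> (h \<otimes>\<^bsub>H\<^esub> k) = ?\<Phi> h \<otimes>\<^bsub>aut_spectrum G\<^esub> ?\<Phi> k"
      by (intro perm_character_mult[symmetric] act act_mult H.m_closed)
  qed (simp add: carrier perm_character act)
  have image: "?\<Phi> ` carrier H = carrier (aut_spectrum G)"
  proof
    show "?\<Phi> ` carrier H \<subseteq> carrier (aut_spectrum G)"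
      by (intro image_subsetI) (simp add: carrier perm_character act)
    show "carrier (aut_spectrum G) \<subseteq> ?\<Phi> ` carrier H"
    proof
      fix \<kappa> assume "\<kappa> \<in> carrier (aut_spectrum G)"
      then have "\<kappa> \<in> characters A" by (simp only: carrier)
      then obtain \<pi> where \<pi>: "\<pi> \<in> aut_perms" "\<kappa> = perm_character \<pi>"
        by (rule character_is_perm_character)
      obtain h where h: "h \<in> carrier H" "\<forall>j\<in>V. act h j = \<pi> j" using full[OF \<pi>(1)] by blast
      have "\<kappa> = ?\<Phi> h"
        unfolding \<pi>(2) by (rule perm_character_cong[OF \<pi>(1) act[OF h(1)]]) (simp only: h(2)[rule_format])
      then show "\<kappa> \<in> ?\<Phi> ` carrier H" using h(1) by (rule image_eqI)
    qed
  qed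
  have "inj_on ?\<Phi> (carrier H)"
  proof (rule inj_onI)
    fix h k assume "h \<in> carrier H" "k \<in> carrier H" "?\<Phi> h = ?\<Phi> k"
    then show "h = k"
      by (intro faithful ballI perm_character_inj[OF act act])
  qed
  with hom image have "?\<Phi> \<in> iso H (aut_spectrum G)"
    by (simp add: iso_iff)
  then show "aut_spectrum G \<cong> H"
    by (intro H.iso_sym is_isoI)
  have "Group.group (aut_spectrum G \<lparr>carrier := ?\<Phi> ` carrier H, one := ?\<Phi> \<one>\<^bsub>H\<^esub>\<rparr>)"
    by (rule H.hom_imp_img_group[OF hom])
  moreover have "?\<Phi> \<one>\<^bsub>H\<^esub> = \<one>\<^bsub>aut_spectrum G\<^esub>"
    unfolding one by (rule perm_character_one[symmetric]) (simp_all add: act act_one)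
  ultimately show "Group.group (aut_spectrum G)"
    by (simp only: image) simp
qed

end

section \<open>Complex-linear operators on the plane\<close>

definition cscale :: "complex \<Rightarrow> complex \<times> complex \<Rightarrow> complex \<times> complex" where
  "cscale c v = (c * fst v, c * snd v)"

lemma norm_cscale: "norm (cscale c v) = cmod c * norm v"
proof -
  have "(cmod c * cmod (fst v))\<^sup>2 + (cmod c * cmod (snd v))\<^sup>2 = (cmod c)\<^sup>2 * ((cmod (fst v))\<^sup>2 + (cmod (snd v))\<^sup>2)"
    by (simp add: power_mult_distrib distrib_left)
  then show ?thesis
    by (simp add: cscale_def norm_prod_def norm_mult real_sqrt_mult)
qed

lemma bounded_linear_cscale: "bounded_linear (cscale c)"
proof (rule bounded_linear_intro)
  show "norm (cscale c v) \<le> norm v * cmod c" for v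
    by (simp add: norm_cscale mult.commute)
qed (simp_all add: cscale_def distrib_left prod_eq_iff)

text \<open>\<open>inner\<close> is the real part of the Hermitian form, so a complex scalar is
  conjugated when it changes sides.\<close>

lemma inner_cscale: "inner (cscale c v) w = inner v (cscale (cnj c) w)"
  by (simp add: cscale_def inner_prod_def inner_complex_def algebra_simps)

type_synonym operator = "(complex \<times> complex) \<Rightarrow>\<^sub>L (complex \<times> complex)"

text \<open>The adjoint is taken over the reals. On complex-linear maps it is the Hermitian adjoint,
  because the real part of a Hermitian form determines the form.\<close>

definition adj :: "operator \<Rightarrow> operator" where
  "adj f = Blinfun (adjoint (blinfun_apply f))"

lemma inner_adj: "inner (blinfun_apply f v) w = inner v (blinfun_apply (adj f) w)"
proof -
  have lin: "linear (blinfun_apply f)"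
    by (rule bounded_linear.linear[OF blinfun.bounded_linear_right])
  then have "bounded_linear (adjoint (blinfun_apply f))"
    by (intro linear_conv_bounded_linear[THEN iffD1] adjoint_linear)
  then show ?thesis
    by (simp add: adj_def bounded_linear_Blinfun_apply adjoint_works[OF lin])
qed

lemma adj_eqI:
  assumes "\<And>v w. inner (blinfun_apply f v) w = inner v (blinfun_apply h w)"
  shows "adj f = h"
proof (rule blinfun_eqI)
  fix w
  have "inner v (blinfun_apply (adj f) w) = inner v (blinfun_apply h w)" for v
    by (simp only: assms flip: inner_adj)
  then show "blinfun_apply (adj f) w = blinfun_apply h w"
    by (rule iffD1[OF vector_eq_ldot, OF allI])
qed

lemma inner_adj_left: "inner (blinfun_apply (adj f) v) w = inner v (blinfun_apply f w)"
  using inner_adj[of f w v] by (simp only: inner_commute)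

text \<open>This is the algebra of complex 2 by 2 matrices with the operator norm: the type
  \<open>operator\<close> consists of real-linear maps, and commuting with \<open>cscale\<close>
  singles out the complex-linear ones.\<close>

definition operator_algebra :: "operator normed_star_algebra" where
  "operator_algebra =
    \<lparr>carrier = {f. \<forall>c v. blinfun_apply f (cscale c v) = cscale c (blinfun_apply f v)},
     mult = (o\<^sub>L), one = id_blinfun, zero = 0, add = (+),
     smult = (\<lambda>c f. Blinfun (cscale c) o\<^sub>L f), star = adj, alg_norm = norm\<rparr>"

lemma operator_algebra_simps [simp]:
  "f \<in> carrier operator_algebra \<longleftrightarrow> (\<forall>c v. blinfun_apply f (cscale c v) = cscale c (blinfun_apply f v))"
  "mult operator_algebra = (o\<^sub>L)" "one operator_algebra = id_blinfun" "zero operator_algebra = 0"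
  "add operator_algebra = (+)" "smult operator_algebra = (\<lambda>c f. Blinfun (cscale c) o\<^sub>L f)"
  "star operator_algebra = adj" "alg_norm operator_algebra = norm"
  by (simp_all add: operator_algebra_def)

lemma operator_cscale:
  "f \<in> carrier operator_algebra \<Longrightarrow> blinfun_apply f (cscale c v) = cscale c (blinfun_apply f v)"
  unfolding operator_algebra_simps by blast

lemma Blinfun_cscale [simp]: "blinfun_apply (Blinfun (cscale c)) = cscale c"
  by (rule bounded_linear_Blinfun_apply[OF bounded_linear_cscale])

lemma cscale_simps:
  "cscale c (v + w) = cscale c v + cscale c w" "cscale (c + d) v = cscale c v + cscale d v"
  "cscale (c * d) v = cscale c (cscale d v)" "cscale 1 v = v" "cscale (-1) v = - v" "cscale c 0 = 0"
  by (simp_all add: cscale_def algebra_simps prod_eq_iff)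

lemma cscale_commute: "cscale c (cscale d v) = cscale d (cscale c v)"
  by (simp add: cscale_def mult.left_commute)

lemma blinfun_add_apply: "blinfun_apply (f + h) v = blinfun_apply f v + blinfun_apply h v"
  by (simp add: blinfun.add_left)

lemma complex_star_algebra_operator: "complex_star_algebra operator_algebra"
proof (rule complex_star_algebraI)
  fix f assume f: "f \<in> carrier operator_algebra"
  show "star operator_algebra f \<in> carrier operator_algebra"
  proof (simp, intro allI)
    fix c v
    have "inner u (blinfun_apply (adj f) (cscale c v)) = inner u (cscale c (blinfun_apply (adj f) v))" for u
    proof -
      have "inner u (blinfun_apply (adj f) (cscale c v)) = inner (blinfun_apply f u) (cscale c v)"
        by (rule inner_adj[symmetric])
      also have "\<dots> = inner (blinfun_apply f (cscale (cnj c) u)) v"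
        by (simp only: operator_cscale[OF f] inner_cscale complex_cnj_cnj)
      also have "\<dots> = inner u (cscale c (blinfun_apply (adj f) v))"
        by (simp only: inner_adj inner_cscale complex_cnj_cnj)
      finally show ?thesis .
    qed
    then show "blinfun_apply (adj f) (cscale c v) = cscale c (blinfun_apply (adj f) v)"
      by (rule iffD1[OF vector_eq_ldot, OF allI])
  qed
  show "star operator_algebra (star operator_algebra f) = f"
    by (simp, rule adj_eqI) (rule inner_adj_left)
  show "star operator_algebra (c \<odot>\<^bsub>operator_algebra\<^esub> f) = cnj c \<odot>\<^bsub>operator_algebra\<^esub> star operator_algebra f" for c
  proof (simp, rule adj_eqI)
    fix v w
    show "inner (blinfun_apply (Blinfun (cscale c) o\<^sub>L f) v) w = inner v (blinfun_apply (Blinfun (cscale (cnj c)) o\<^sub>L adj f) w)"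
      by (simp only: blinfun_apply_blinfun_compose Blinfun_cscale operator_cscale[OF f, symmetric]
          inner_adj inner_cscale)
  qed
  fix h assume h: "h \<in> carrier operator_algebra"
  show "star operator_algebra (f \<oplus>\<^bsub>operator_algebra\<^esub> h) = star operator_algebra f \<oplus>\<^bsub>operator_algebra\<^esub> star operator_algebra h"
    by (simp, rule adj_eqI) (simp add: blinfun_add_apply inner_add_left inner_add_right inner_adj)
  show "star operator_algebra (f \<otimes>\<^bsub>operator_algebra\<^esub> h) = star operator_algebra h \<otimes>\<^bsub>operator_algebra\<^esub> star operator_algebra f"
    by (simp, rule adj_eqI) (simp add: inner_adj)
qed (auto simp: blinfun_add_apply cscale_simps cscale_commute intro!: blinfun_eqI
    simp: blinfun.add_right blinfun.zero_left simp del: split_paired_All)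

interpretation op: complex_star_algebra operator_algebra
  by (rule complex_star_algebra_operator)

lemma operator_minus:
  "\<lbrakk>f \<in> carrier operator_algebra; h \<in> carrier operator_algebra\<rbrakk> \<Longrightarrow> f \<ominus>\<^bsub>operator_algebra\<^esub> h = f - h"
  using op.minus_eq_smult[of f h]
  by (intro blinfun_eqI) (simp add: blinfun_add_apply cscale_simps blinfun.diff_left)

text \<open>With \<open>w\<close> the image of \<open>v\<close> under \<open>adj f\<close>,
  Cauchy-Schwarz applied to \<open>inner v (f w)\<close> bounds the square of \<open>norm w\<close>,
  and one factor \<open>norm w\<close> cancels.\<close>

lemma norm_adj_le: "norm (adj f) \<le> norm f"
proof (rule norm_blinfun_bound)
  fix v
  let ?w = "blinfun_apply (adj f) v"
  have "norm ?w * norm ?w = inner v (blinfun_apply f ?w)"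
    using inner_adj_left[of f v ?w] by (simp add: dot_square_norm power2_eq_square)
  also have "\<dots> \<le> norm v * norm (blinfun_apply f ?w)"
    by (rule norm_cauchy_schwarz)
  also have "\<dots> \<le> norm v * (norm f * norm ?w)"
    by (intro mult_left_mono norm_blinfun) simp
  finally have "norm ?w * norm ?w \<le> (norm f * norm v) * norm ?w"
    by (simp add: mult_ac)
  then show "norm ?w \<le> norm f * norm v"
    by (cases "norm ?w = 0") (auto simp: mult_le_cancel_right)
qed simp

text \<open>The lower bound is Cauchy-Schwarz again: the squared norm of \<open>f v\<close> is the
  inner product of \<open>v\<close> with its image under \<open>adj f o\<^sub>L f\<close>.\<close>

lemma norm_adj_mult: "norm (adj f o\<^sub>L f) = (norm f)\<^sup>2"
proof (rule antisym)
  have "norm (adj f o\<^sub>L f) \<le> norm (adj f) * norm f" by (rule norm_blinfun_compose)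
  also have "\<dots> \<le> norm f * norm f" by (intro mult_right_mono norm_adj_le) simp
  finally show "norm (adj f o\<^sub>L f) \<le> (norm f)\<^sup>2" by (simp add: power2_eq_square)
  have "norm f \<le> sqrt (norm (adj f o\<^sub>L f))"
  proof (rule norm_blinfun_bound)
    fix v
    have "(norm (blinfun_apply f v))\<^sup>2 = inner v (blinfun_apply (adj f o\<^sub>L f) v)"
      by (simp add: power2_norm_eq_inner inner_adj)
    also have "\<dots> \<le> norm v * norm (blinfun_apply (adj f o\<^sub>L f) v)"
      by (rule norm_cauchy_schwarz)
    also have "\<dots> \<le> norm v * (norm (adj f o\<^sub>L f) * norm v)"
      by (intro mult_left_mono norm_blinfun) simp
    finally have "(norm (blinfun_apply f v))\<^sup>2 \<le> (sqrt (norm (adj f o\<^sub>L f)) * norm v)\<^sup>2"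
      by (simp add: power_mult_distrib power2_eq_square mult_ac)
    then show "norm (blinfun_apply f v) \<le> sqrt (norm (adj f o\<^sub>L f)) * norm v"
      by (rule power2_le_imp_le) simp
  qed simp
  then show "(norm f)\<^sup>2 \<le> norm (adj f o\<^sub>L f)"
    by (simp add: real_le_rsqrt sqrt_ge_absD)
qed

lemma norm_cscale_compose: "norm (Blinfun (cscale c) o\<^sub>L f) = cmod c * norm f"
proof (rule antisym)
  show "norm (Blinfun (cscale c) o\<^sub>L f) \<le> cmod c * norm f"
    by (rule norm_blinfun_bound) (simp_all add: norm_cscale mult.assoc mult_left_mono norm_blinfun)
  show "cmod c * norm f \<le> norm (Blinfun (cscale c) o\<^sub>L f)"
  proof (cases "c = 0")
    case False
    have "norm f \<le> norm (Blinfun (cscale c) o\<^sub>L f) / cmod c"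
    proof (rule norm_blinfun_bound)
      fix v
      show "norm (blinfun_apply f v) \<le> norm (Blinfun (cscale c) o\<^sub>L f) / cmod c * norm v"
        using norm_blinfun[of "Blinfun (cscale c) o\<^sub>L f" v] False
        by (simp add: norm_cscale field_simps)
    qed simp
    then show ?thesis using False by (simp add: field_simps)
  qed simp
qed

lemma cstar_algebra_operator: "cstar_algebra operator_algebra"
proof unfold_locales
  fix u :: "nat \<Rightarrow> operator"
  assume u: "\<And>n. u n \<in> carrier operator_algebra"
    and "\<forall>e>0. \<exists>N. \<forall>m\<ge>N. \<forall>n\<ge>N. alg_norm operator_algebra (u m \<ominus>\<^bsub>operator_algebra\<^esub> u n) < e"
  then have "Cauchy u"
    by (simp add: operator_minus[OF u u] Cauchy_def dist_norm)
  then obtain L where L: "u \<longlonglongrightarrow> L"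
    using Cauchy_convergent convergent_def by blast
  have ap: "(\<lambda>n. blinfun_apply (u n) v) \<longlonglongrightarrow> blinfun_apply L v" for v
    using L by (intro tendsto_intros)
  \<comment> \<open>The complex-linear operators form a closed set, since commuting with a scalar
    passes to pointwise limits.\<close>
  have Lc: "L \<in> carrier operator_algebra"
  proof (simp, intro allI)
    fix c v
    have "(\<lambda>n. cscale c (blinfun_apply (u n) v)) \<longlonglongrightarrow> cscale c (blinfun_apply L v)"
      by (rule bounded_linear.tendsto[OF bounded_linear_cscale ap])
    then have "(\<lambda>n. blinfun_apply (u n) (cscale c v)) \<longlonglongrightarrow> cscale c (blinfun_apply L v)"
      by (simp only: operator_cscale[OF u])
    then show "blinfun_apply L (cscale c v) = cscale c (blinfun_apply L v)"
      using ap LIMSEQ_unique by blast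
  qed
  have "(\<lambda>n. norm (u n - L)) \<longlonglongrightarrow> 0"
    using L by (simp add: tendsto_norm_zero LIM_zero)
  then have "(\<lambda>n. alg_norm operator_algebra (u n \<ominus>\<^bsub>operator_algebra\<^esub> L)) \<longlonglongrightarrow> 0"
    by (simp add: operator_minus[OF u Lc])
  with Lc show "\<exists>x\<in>carrier operator_algebra. (\<lambda>n. alg_norm operator_algebra (u n \<ominus>\<^bsub>operator_algebra\<^esub> x)) \<longlonglongrightarrow> 0"
    by blast
qed (simp_all add: norm_triangle_ineq norm_cscale_compose norm_blinfun_compose norm_adj_mult)

section \<open>Two projections in general position\<close>

text \<open>For \<open>c\<^sup>2 + s\<^sup>2 = 1\<close> this is the orthogonal projection onto the
  complex line through \<open>(c, s)\<close>.\<close>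

definition proj :: "real \<Rightarrow> real \<Rightarrow> operator" where
  "proj c s = Blinfun (\<lambda>v. let x = c *\<^sub>R fst v + s *\<^sub>R snd v in (c *\<^sub>R x, s *\<^sub>R x))"

lemma proj_apply:
  "blinfun_apply (proj c s) v = (c *\<^sub>R (c *\<^sub>R fst v + s *\<^sub>R snd v), s *\<^sub>R (c *\<^sub>R fst v + s *\<^sub>R snd v))"
proof -
  have "linear (\<lambda>v :: complex \<times> complex. let x = c *\<^sub>R fst v + s *\<^sub>R snd v in (c *\<^sub>R x, s *\<^sub>R x))"
    by (rule linearI) (simp_all add: Let_def algebra_simps)
  then have "bounded_linear (\<lambda>v :: complex \<times> complex. let x = c *\<^sub>R fst v + s *\<^sub>R snd v in (c *\<^sub>R x, s *\<^sub>R x))"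
    by (rule linear_conv_bounded_linear[THEN iffD1])
  then show ?thesis
    unfolding proj_def by (simp add: bounded_linear_Blinfun_apply Let_def)
qed

lemma proj_closed: "proj c s \<in> carrier operator_algebra"
  by (simp add: proj_apply cscale_def algebra_simps)

lemma proj_star: "star operator_algebra (proj c s) = proj c s"
  by (simp, rule adj_eqI) (simp add: proj_apply inner_prod_def inner_add_left inner_add_right algebra_simps)

lemma proj_idem:
  assumes "c\<^sup>2 + s\<^sup>2 = 1"
  shows "proj c s \<otimes>\<^bsub>operator_algebra\<^esub> proj c s = proj c s"
proof (simp, rule blinfun_eqI)
  fix v :: "complex \<times> complex"
  define x where "x = c *\<^sub>R fst v + s *\<^sub>R snd v"
  have "c *\<^sub>R c *\<^sub>R x + s *\<^sub>R s *\<^sub>R x = (c\<^sup>2 + s\<^sup>2) *\<^sub>R x"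
    by (simp add: scaleR_left_distrib power2_eq_square)
  then have "c *\<^sub>R c *\<^sub>R x + s *\<^sub>R s *\<^sub>R x = x"
    using assms by simp
  then show "blinfun_apply (proj c s o\<^sub>L proj c s) v = blinfun_apply (proj c s) v"
    by (simp add: proj_apply flip: x_def)
qed

definition block_matrix :: "('a, 'm) ring_scheme \<Rightarrow> 'a \<Rightarrow> 'a \<Rightarrow> nat \<Rightarrow> nat \<Rightarrow> 'a" where
  "block_matrix T p q i j =
    (if i \<in> {1, 2} \<and> j \<in> {1, 2} then (if i = j then p else \<one>\<^bsub>T\<^esub> \<ominus>\<^bsub>T\<^esub> p)
     else if i \<in> {3, 4} \<and> j \<in> {3, 4} then (if i = j then q else \<one>\<^bsub>T\<^esub> \<ominus>\<^bsub>T\<^esub> q)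
     else \<zero>\<^bsub>T\<^esub>)"

text \<open>The name refers to the square on which the vertices are placed below: the two ends of an
  edge are opposite corners there.\<close>

definition opposite :: "nat \<Rightarrow> nat" where
  "opposite i = (if i = 1 then 2 else if i = 2 then 1 else if i = 3 then 4 else 3)"

text \<open>The nonzero entries of a row or column are a projection and its complement, which are
  orthogonal and add up to one. \<open>opposite\<close> preserves the blocks and the diagonal inside
  each block, which gives the symmetry.\<close>

lemma (in complex_star_algebra) block_matrix_magic:
  assumes p: "p \<in> carrier A" "star A p = p" "p \<otimes> p = p" and q: "q \<in> carrier A" "star A q = q" "q \<otimes> q = q"
  shows "magic_family A {1, 2, 3, 4} opposite (block_matrix A p q)"
proof -
  have compl: "r \<otimes> (\<one> \<ominus> r) = \<zero>" "(\<one> \<ominus> r) \<otimes> r = \<zero>" "(\<one> \<ominus> r) \<otimes> (\<one> \<ominus> r) = \<one> \<ominus> r"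
      "star A (\<one> \<ominus> r) = \<one> \<ominus> r" "r \<oplus> (\<one> \<ominus> r) = \<one>" "(\<one> \<ominus> r) \<oplus> r = \<one>"
    if r: "r \<in> carrier A" "star A r = r" "r \<otimes> r = r" for r
  proof -
    have eq: "\<one> \<ominus> r = \<one> \<oplus> (-1) \<odot> r" using r by (simp add: minus_eq_smult)
    have cancel: "r \<oplus> (-1) \<odot> r = \<zero>" "(-1) \<odot> r \<oplus> r = \<zero>"
      using r_neg[OF r(1)] l_neg[OF r(1)] r by (simp_all add: uminus_eq_smult)
    show 1: "r \<otimes> (\<one> \<ominus> r) = \<zero>" "(\<one> \<ominus> r) \<otimes> r = \<zero>"
      using r by (simp_all add: eq r_distr l_distr smult_mult_left smult_mult_right cancel)
    show "(\<one> \<ominus> r) \<otimes> (\<one> \<ominus> r) = \<one> \<ominus> r"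
      using 1 r by (subst eq, subst l_distr) (simp_all add: smult_mult_left)
    show "star A (\<one> \<ominus> r) = \<one> \<ominus> r"
      using r by (simp add: star_minus)
    show 2: "(\<one> \<ominus> r) \<oplus> r = \<one>"
      using r by (simp add: eq a_assoc cancel)
    then show "r \<oplus> (\<one> \<ominus> r) = \<one>"
      using r by (simp add: a_comm)
  qed
  note [simp] = p q compl[OF p] compl[OF q]
  have sum: "(\<Oplus>l\<in>{1, 2, 3, 4 :: nat}. f l) = f 1 \<oplus> (f 2 \<oplus> (f 3 \<oplus> f 4))"
    if "\<And>l. l \<in> {1, 2, 3, 4} \<Longrightarrow> f l \<in> carrier A" for f
    using that by (simp add: finsum_insert Pi_def)
  have closed: "block_matrix A p q i j \<in> carrier A" for i j
    by (simp add: block_matrix_def)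
  show ?thesis
  proof unfold_locales
    fix i j :: nat assume ij: "i \<in> {1, 2, 3, 4}" "j \<in> {1, 2, 3, 4}"
    show "star A (block_matrix A p q i j) = block_matrix A p q i j"
      by (simp add: block_matrix_def)
    show "block_matrix A p q (opposite i) (opposite j) = block_matrix A p q i j"
      using ij by (elim insertE emptyE) (simp_all add: block_matrix_def opposite_def)
    fix k :: nat assume "k \<in> {1, 2, 3, 4}"
    then show "block_matrix A p q i j \<otimes> block_matrix A p q i k = (if j = k then block_matrix A p q i j else \<zero>)"
      "block_matrix A p q j i \<otimes> block_matrix A p q k i = (if j = k then block_matrix A p q j i else \<zero>)"
      using ij by (elim insertE emptyE; simp add: block_matrix_def)+
  next
    fix i :: nat assume "i \<in> {1, 2, 3, 4}"
    then show "(\<Oplus>l\<in>{1, 2, 3, 4}. block_matrix A p q i l) = \<one>"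
      "(\<Oplus>l\<in>{1, 2, 3, 4}. block_matrix A p q l i) = \<one>"
      by (elim insertE emptyE; simp only: sum closed; simp add: block_matrix_def)+
  qed (rule closed)
qed

section \<open>Infinite dimension\<close>

text \<open>A polynomial with a nonzero coefficient has finitely many roots, whereas
  \<open>z\<close> takes infinitely many values.\<close>

lemma polynomial_vanishing:
  fixes z :: "nat \<Rightarrow> complex"
  assumes "inj z" and "\<And>m. (\<Sum>i\<le>d. c i * z m ^ i) = 0" and "i \<le> d"
  shows "c i = 0"
proof (rule ccontr)
  assume "c i \<noteq> 0"
  then have "finite {x. (\<Sum>i\<le>d. c i * x ^ i) = 0}"
    using assms(3) by (subst polyfun_finite_roots) blast
  moreover have "range z \<subseteq> {x. (\<Sum>i\<le>d. c i * x ^ i) = 0}"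
    using assms(2) by auto
  ultimately show False
    using finite_subset range_inj_infinite[OF assms(1)] by blast
qed

lemma sum_fun_apply: "(\<Sum>s\<in>S. f s) k = (\<Sum>s\<in>S. f s k)" for f :: "'s \<Rightarrow> 'k \<Rightarrow> 'c :: comm_monoid_add"
  by (induction S rule: infinite_finite_induct) simp_all

interpretation seq: vector_space "\<lambda>(c :: complex) (f :: nat \<Rightarrow> complex) k. c * f k"
  by unfold_locales (simp_all add: fun_eq_iff algebra_simps)

text \<open>Independence concerns the set of sequences, so injectivity in the exponent is
  established separately; it makes that set infinite.\<close>

lemma power_sequences_independent:
  fixes z :: "nat \<Rightarrow> complex"
  assumes "inj z"
  shows "inj (\<lambda>n m. z m ^ n)" and "seq.independent (range (\<lambda>n m. z m ^ n))"
proof -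
  let ?F = "\<lambda>n m. z m ^ n"
  show inj: "inj ?F"
  proof (rule injI, rule ccontr)
    fix n n' assume eq: "?F n = ?F n'" and "n \<noteq> n'"
    \<comment> \<open>These are the coefficients of the difference of two monomials, which would
      vanish at every \<open>z m\<close>.\<close>
    let ?c = "\<lambda>i. (if i = n then 1 else 0) - (if i = n' then 1 else 0 :: complex)"
    have "(\<Sum>i\<le>max n n'. ?c i * z m ^ i) = 0" for m
      using fun_cong[OF eq, of m] by (simp add: left_diff_distrib sum_subtractf if_distrib[of "\<lambda>x. x * _"] cong: if_cong)
    from polynomial_vanishing[OF assms this, of n] \<open>n \<noteq> n'\<close> show False by simp
  qed
  show "seq.independent (range ?F)"
    unfolding seq.independent_explicit_finite_subsets
  proof (intro allI impI ballI)
    fix T u v assume T: "T \<subseteq> range ?F" "finite T" and sum0: "(\<Sum>v\<in>T. (\<lambda>k. u v * v k)) = 0" and v: "v \<in> T"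
    obtain N where N: "finite N" "T = ?F ` N"
      using finite_subset_image[OF T(2,1)] by blast
    obtain n where n: "n \<in> N" "v = ?F n" using v N(2) by blast
    \<comment> \<open>A linear relation between the sequences is read as a polynomial that vanishes
      at every \<open>z m\<close>.\<close>
    let ?c = "\<lambda>i. if i \<in> N then u (?F i) else 0"
    have le: "i \<le> Max N" if "i \<in> N" for i using N(1) that by simp
    have "(\<Sum>i\<le>Max N. ?c i * z m ^ i) = 0" for m
    proof -
      have "(\<Sum>i\<le>Max N. ?c i * z m ^ i) = (\<Sum>i\<in>N. u (?F i) * z m ^ i)"
        using N(1) le by (intro sum.mono_neutral_cong_right) auto
      also have "\<dots> = (\<Sum>v\<in>T. u v * v m)"
        unfolding N(2) by (subst sum.reindex) (auto intro: inj_on_subset[OF inj])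
      also have "\<dots> = 0"
        using fun_cong[OF sum0, of m] by (simp add: sum_fun_apply)
      finally show ?thesis .
    qed
    from polynomial_vanishing[OF assms this le[OF n(1)]] n show "u v = 0" by simp
  qed
qed

text \<open>The functionals send an element to the sequence of its values. A finite spanning set of
  \<open>A\<close> would give finitely many sequences whose span contains infinitely many
  independent ones.\<close>

lemma (in complex_star_algebra) not_finite_dimensionalI:
  fixes \<phi> :: "nat \<Rightarrow> 'a \<Rightarrow> complex"
  assumes add: "\<And>m x y. \<lbrakk>x \<in> carrier A; y \<in> carrier A\<rbrakk> \<Longrightarrow> \<phi> m (x \<oplus> y) = \<phi> m x + \<phi> m y"
    and smult: "\<And>m c x. x \<in> carrier A \<Longrightarrow> \<phi> m (c \<odot> x) = c * \<phi> m x"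
    and a: "\<And>n. a n \<in> carrier A" and \<phi>_a: "\<And>m n. \<phi> m (a n) = z m ^ n" and "inj z"
  shows "\<not> finite_dimensional A"
proof
  assume "finite_dimensional A"
  then obtain S where S: "finite S" "S \<subseteq> carrier A"
    and span: "\<And>x. x \<in> carrier A \<Longrightarrow> \<exists>c. x = (\<Oplus>s\<in>S. c s \<odot> s)"
    unfolding finite_dimensional_def by blast
  have zero: "\<phi> m \<zero> = 0" for m
    using smult[of \<zero> m 0] by simp
  have sum: "\<phi> m (\<Oplus>s\<in>S'. c s \<odot> s) = (\<Sum>s\<in>S'. c s * \<phi> m s)" if "finite S'" "S' \<subseteq> carrier A" for S' c m
    using that
  proof (induction S')
    case (insert s S')
    then have "(\<lambda>s. c s \<odot> s) \<in> S' \<rightarrow> carrier A" "s \<in> carrier A" by auto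
    with insert show ?case by (simp add: finsum_insert add smult)
  qed (simp add: zero)
  let ?E = "\<lambda>s m. \<phi> m s"
  have "(\<lambda>m. z m ^ n) \<in> seq.span (?E ` S)" for n
  proof -
    obtain c where c: "a n = (\<Oplus>s\<in>S. c s \<odot> s)" using span[OF a] by blast
    have "(\<lambda>m. z m ^ n) = (\<Sum>s\<in>S. (\<lambda>m. c s * ?E s m))"
      using sum[OF S, of _ c] by (simp add: fun_eq_iff sum_fun_apply flip: \<phi>_a c)
    also have "\<dots> \<in> seq.span (?E ` S)"
      by (intro seq.span_sum seq.span_scale seq.span_base imageI)
    finally show ?thesis .
  qed
  then have "finite (range (\<lambda>n m. z m ^ n))"
    using seq.independent_span_bound[of "?E ` S"] S(1) power_sequences_independent(2)[OF \<open>inj z\<close>] by blast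
  then show False
    using range_inj_infinite[OF power_sequences_independent(1)[OF \<open>inj z\<close>]] by blast
qed

context involution_graph
begin

lemma aut_algebra_noncommutativeI:
  assumes "cstar_algebra B" "magic_family B V \<sigma> x" "i \<in> V" "j \<in> V" "k \<in> V" "l \<in> V"
    and neq: "x i j \<otimes>\<^bsub>B\<^esub> x k l \<noteq> x k l \<otimes>\<^bsub>B\<^esub> x i j"
  shows "noncommutative A"
proof -
  obtain H where H: "H \<in> star_hom A B" "\<And>i j. \<lbrakk>i \<in> V; j \<in> V\<rbrakk> \<Longrightarrow> H (g i j) = x i j"
    using extend_to_aut_algebra[OF assms(1,2)] by metis
  have "g i j \<otimes>\<^bsub>A\<^esub> g k l \<noteq> g k l \<otimes>\<^bsub>A\<^esub> g i j"
  proof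
    assume "g i j \<otimes>\<^bsub>A\<^esub> g k l = g k l \<otimes>\<^bsub>A\<^esub> g i j"
    then have "H (g i j \<otimes>\<^bsub>A\<^esub> g k l) = H (g k l \<otimes>\<^bsub>A\<^esub> g i j)" by simp
    then show False
      using neq by (simp only: star_hom_mult[OF H(1)] g.x_closed assms(3-6) H(2))
  qed
  then show ?thesis
    unfolding noncommutative_def using g.x_closed[OF assms(3,4)] g.x_closed[OF assms(5,6)] by blast
qed

end

section \<open>The dihedral group\<close>

lemma group_dihedral_group:
  assumes "n > 0"
  shows "Group.group (dihedral_group n)"
proof (rule groupI)
  fix x assume x: "x \<in> carrier (dihedral_group n)"
  obtain a e where ae: "x = (a, e)" by (cases x)
  show "\<one>\<^bsub>dihedral_group n\<^esub> \<otimes>\<^bsub>dihedral_group n\<^esub> x = x"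
    using x by (simp add: dihedral_group_def ae)
  show "\<exists>y\<in>carrier (dihedral_group n). y \<otimes>\<^bsub>dihedral_group n\<^esub> x = \<one>\<^bsub>dihedral_group n\<^esub>"
    \<comment> \<open>A reflection is its own inverse, and a rotation is undone by the opposite one;
      reduction modulo \<open>n\<close> keeps the exponent among the representatives.\<close>
    using assms by (intro bexI[of _ "(if e then a mod int n else - a mod int n, e)"])
      (auto simp: dihedral_group_def ae mod_simps)
qed (use assms in \<open>auto simp: dihedral_group_def mod_simps algebra_simps split: if_splits\<close>)

text \<open>
  The four vertices are placed on a square in the order 1, 3, 2, 4, so that the edges of the graph join
  opposite corners.
\<close>

definition corner :: "nat \<Rightarrow> int" where
  "corner i = (if i = 1 then 0 else if i = 3 then 1 else if i = 2 then 2 else 3)"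

definition vertex :: "int \<Rightarrow> nat" where
  "vertex k = (if k = 0 then 1 else if k = 1 then 3 else if k = 2 then 2 else 4)"

text \<open>\<open>r\<close> acts as the quarter turn and \<open>s\<close> as the reflection in the
  diagonal through corner 0, so \<open>r^a s^e\<close> sends corner \<open>k\<close> to
  \<open>a + k\<close> or \<open>a - k\<close>.\<close>

definition square_action :: "int \<times> bool \<Rightarrow> nat \<Rightarrow> nat" where
  "square_action h i = vertex ((fst h + (if snd h then - corner i else corner i)) mod 4)"

lemma corner_vertex: "0 \<le> k \<Longrightarrow> k < 4 \<Longrightarrow> corner (vertex k) = k"
  by (auto simp: corner_def vertex_def)

lemma corner_square_action: "corner (square_action h i) = (fst h + (if snd h then - corner i else corner i)) mod 4"
  unfolding square_action_def by (rule corner_vertex) simp_all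

lemma vertex_mem: "vertex k \<in> {1, 2, 3, 4}"
  by (simp add: vertex_def)

lemma vertex_corner: "i \<in> {1, 2, 3, 4} \<Longrightarrow> vertex (corner i) = i"
  by (auto simp: corner_def vertex_def)

lemma corner_bounds: "0 \<le> corner i" "corner i < 4"
  by (simp_all add: corner_def)

lemma corner_inj: "\<lbrakk>i \<in> {1, 2, 3, 4}; j \<in> {1, 2, 3, 4}; corner i = corner j\<rbrakk> \<Longrightarrow> i = j"
  by (metis vertex_corner)

lemma square_action_mult:
  "square_action (h \<otimes>\<^bsub>dihedral_group 4\<^esub> k) i = square_action h (square_action k i)"
proof -
  obtain a e b f where hk: "h = (a, e)" "k = (b, f)" by (cases h; cases k)
  show ?thesis
    unfolding square_action_def[of "h \<otimes>\<^bsub>dihedral_group 4\<^esub> k"] square_action_def[of h] corner_square_action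
    by (rule arg_cong[of _ _ vertex]) (auto simp: hk dihedral_group_def mod_simps algebra_simps)
qed

lemma square_action_one: "i \<in> {1, 2, 3, 4} \<Longrightarrow> square_action \<one>\<^bsub>dihedral_group 4\<^esub> i = i"
  using corner_bounds[of i] by (simp add: square_action_def dihedral_group_def vertex_corner)

lemma corner_opposite: "i \<in> {1, 2, 3, 4} \<Longrightarrow> corner (opposite i) = (corner i + 2) mod 4"
  by (auto simp: corner_def opposite_def)

lemma opposite_mem: "opposite i \<in> {1, 2, 3, 4}"
  by (simp add: opposite_def)

lemma square_action_mem: "square_action h i \<in> {1, 2, 3, 4}"
  unfolding square_action_def by (rule vertex_mem)

text \<open>Passing to the opposite corner adds 2. This commutes with rotations, and with
  reflections because 2 and -2 agree modulo 4.\<close>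

lemma square_action_opposite:
  assumes "i \<in> {1, 2, 3, 4}"
  shows "square_action h (opposite i) = opposite (square_action h i)"
proof (rule corner_inj[OF square_action_mem opposite_mem])
  have "(a - (c + 2)) mod 4 = (a + (2 - c)) mod 4" for a c :: int by presburger
  then show "corner (square_action h (opposite i)) = corner (opposite (square_action h i))"
    by (simp add: corner_square_action corner_opposite[OF assms] corner_opposite[OF square_action_mem]
        mod_simps add.assoc)
qed

interpretation square: finite_involution "{1, 2, 3, 4 :: nat}" opposite
  by unfold_locales (auto simp: opposite_def)

text \<open>Bijectivity comes from the group: the inverse of \<open>h\<close> acts as the inverse
  map.\<close>

lemma square_action_perm:
  assumes "h \<in> carrier (dihedral_group 4)"
  shows "square_action h \<in> square.aut_perms"
proof -
  interpret D: Group.group "dihedral_group 4" by (rule group_dihedral_group) simp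
  let ?h' = "inv\<^bsub>dihedral_group 4\<^esub> h"
  have "bij_betw (square_action h) {1, 2, 3, 4} {1, 2, 3, 4}"
  proof (rule bij_betw_byWitness[of _ "square_action ?h'"])
    show "\<forall>i\<in>{1, 2, 3, 4}. square_action ?h' (square_action h i) = i"
      "\<forall>i\<in>{1, 2, 3, 4}. square_action h (square_action ?h' i) = i"
      unfolding square_action_mult[symmetric] D.l_inv[OF assms] D.r_inv[OF assms]
      by (intro ballI square_action_one; assumption)+
  qed (use square_action_mem in blast)+
  then show ?thesis
    unfolding square.aut_perms_def using square_action_opposite by blast
qed

text \<open>Vertex 1 sits at corner 0, so its image reveals \<open>a\<close>. Vertex 3 sits at
  corner 1 and goes to \<open>a + 1\<close> or \<open>a - 1\<close>, which differ modulo 4.\<close>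

lemma square_action_faithful:
  assumes "h \<in> carrier (dihedral_group 4)" "k \<in> carrier (dihedral_group 4)"
    and "square_action h 1 = square_action k 1" "square_action h 3 = square_action k 3"
  shows "h = k"
proof -
  obtain a e b f where hk: "h = (a, e)" "k = (b, f)" by (cases h; cases k)
  have ab: "0 \<le> a" "a < 4" "0 \<le> b" "b < 4"
    using assms(1,2) by (simp_all add: hk dihedral_group_def)
  have "corner (square_action h 1) = corner (square_action k 1)"
    "corner (square_action h 3) = corner (square_action k 3)"
    using assms(3,4) by simp_all
  then have "a = b" "(a + (if e then -1 else 1)) mod 4 = (b + (if f then -1 else 1)) mod 4"
    unfolding corner_square_action using ab by (simp_all add: hk corner_def split: if_splits)
  moreover have "(a + 1) mod 4 \<noteq> (a - 1) mod 4" by presburger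
  ultimately show ?thesis by (auto simp: hk split: if_splits)
qed

text \<open>Commuting with \<open>opposite\<close>, the permutation is determined by its values at 1
  and 3. The second value differs from the first and from its opposite, so it is one of the two
  corners adjacent to it.\<close>

lemma square_action_full:
  assumes "\<pi> \<in> square.aut_perms"
  shows "\<exists>h\<in>carrier (dihedral_group 4). \<forall>i\<in>{1, 2, 3, 4}. square_action h i = \<pi> i"
proof -
  have bij: "bij_betw \<pi> {1, 2, 3, 4} {1, 2, 3, 4}"
    and comm: "\<And>j. j \<in> {1, 2, 3, 4} \<Longrightarrow> \<pi> (opposite j) = opposite (\<pi> j)"
    using assms unfolding square.aut_perms_def by blast+
  have mem: "\<pi> 1 \<in> {1, 2, 3, 4}" "\<pi> 3 \<in> {1, 2, 3, 4}"
    by (rule bij_betw_apply[OF bij]; simp)+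
  have inj: "\<pi> 1 \<noteq> \<pi> 3" "\<pi> 2 \<noteq> \<pi> 3"
    by (subst inj_on_eq_iff[OF bij_betw_imp_inj_on[OF bij]]; simp)+
  have \<pi>2: "\<pi> 2 = opposite (\<pi> 1)" and \<pi>4: "\<pi> 4 = opposite (\<pi> 3)"
    using comm[of 1] comm[of 3] by (simp_all add: opposite_def)
  \<comment> \<open>The rotation part is the corner to which vertex 1 goes; a reflection is added
    exactly when vertex 3 goes to the preceding corner instead of the next one.\<close>
  define h where "h = (corner (\<pi> 1), corner (\<pi> 3) \<noteq> (corner (\<pi> 1) + 1) mod 4)"
  have h: "h \<in> carrier (dihedral_group 4)"
    using corner_bounds[of "\<pi> 1"] by (simp add: h_def dihedral_group_def)
  have 1: "square_action h 1 = \<pi> 1"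
    using vertex_corner[OF mem(1)] corner_bounds[of "\<pi> 1"]
    by (simp add: square_action_def h_def corner_def[of "Suc 0"])
  have "corner (square_action h 3) = corner (\<pi> 3)"
    using mem inj \<pi>2 unfolding corner_square_action
    by (elim insertE emptyE) (simp_all add: h_def corner_def opposite_def)
  then have 3: "square_action h 3 = \<pi> 3"
    by (rule corner_inj[OF square_action_mem mem(2)])
  have "square_action h 2 = \<pi> 2" "square_action h 4 = \<pi> 4"
    using square_action_opposite[of 1 h] square_action_opposite[of 3 h] 1 3 \<pi>2 \<pi>4
    by (simp_all add: opposite_def[of "Suc 0"] opposite_def[of 3])
  with 1 3 h show ?thesis by (intro bexI[of _ h]) auto
qed

section \<open>Two disjoint edges\<close>

lemma block_matrix_diag: "block_matrix T p q 1 1 = p" "block_matrix T p q 3 3 = q"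
  by (simp_all add: block_matrix_def)

text \<open>\<open>(3/5, 4/5)\<close> is a rational unit vector neither parallel nor orthogonal to
  the first axis. On \<open>(1, 0)\<close> the two products give \<open>(9/25, 0)\<close> and
  \<open>(9/25, 12/25)\<close>.\<close>

lemma proj_noncommuting:
  "proj 1 0 \<otimes>\<^bsub>operator_algebra\<^esub> proj (3/5) (4/5) \<noteq> proj (3/5) (4/5) \<otimes>\<^bsub>operator_algebra\<^esub> proj 1 0"
proof
  assume "proj 1 0 \<otimes>\<^bsub>operator_algebra\<^esub> proj (3/5) (4/5) = proj (3/5) (4/5) \<otimes>\<^bsub>operator_algebra\<^esub> proj 1 0"
  then have "blinfun_apply (proj 1 0 o\<^sub>L proj (3/5) (4/5)) (1, 0) = blinfun_apply (proj (3/5) (4/5) o\<^sub>L proj 1 0) (1, 0)"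
    by simp
  then show False by (simp add: proj_apply)
qed

lemma proj_mult_apply: "blinfun_apply (proj 1 0 \<otimes>\<^bsub>operator_algebra\<^esub> proj c s) (1, 0) = c\<^sup>2 *\<^sub>R (1, 0)"
  by (simp add: proj_apply power2_eq_square scaleR_conv_of_real)

lemma operator_power_apply:
  assumes "blinfun_apply f v = r *\<^sub>R v" and "h 0 = id_blinfun" and "\<And>n. h (Suc n) = h n o\<^sub>L f"
  shows "blinfun_apply (h n) v = r ^ n *\<^sub>R v"
  by (induction n) (simp_all add: assms blinfun.scaleR_right)

lemma magic_projections:
  "c\<^sup>2 + s\<^sup>2 = 1 \<Longrightarrow>
    magic_family operator_algebra {1, 2, 3, 4} opposite (block_matrix operator_algebra (proj 1 0) (proj c s))"
  by (intro op.block_matrix_magic proj_closed proj_star proj_idem) simp_all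

locale two_edges = involution_graph "{1, 2, 3, 4 :: nat}" opposite
begin

lemma G_eq: "G = \<lparr>pverts = {1, 2, 3, 4}, parcs = {(1, 2), (2, 1), (3, 4), (4, 3)}\<rparr>"
  unfolding G_def by (simp add: opposite_def)

text \<open>The entries at (1, 1) and (3, 3) lie in different blocks, so they represent the two
  projections, whose relative position is free.\<close>

lemma noncommutative: "noncommutative A"
  by (rule aut_algebra_noncommutativeI[OF cstar_algebra_operator magic_projections[of "3/5" "4/5"], of 1 1 3 3])
    (simp_all only: block_matrix_diag proj_noncommuting insert_iff simp_thms, simp add: power2_eq_square)

text \<open>
  The product of the projections onto the first axis and onto the line spanned by \<open>(c, s)\<close> scales
  \<open>(1, 0)\<close> by \<open>c\<^sup>2\<close>, so the powers of \<open>X 1 1 \<otimes> X 3 3\<close> are linearly independent.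
\<close>

lemma infinite_dimensional: "\<not> finite_dimensional A"
proof -
  \<comment> \<open>Distinct numbers in the interval from 0 to 1: at most 1 so that
    \<open>s m\<close> completes a unit vector, and positive so that their squares stay
    distinct.\<close>
  define c where "c m = 1 / (real m + 1)" for m :: nat
  define s where "s m = sqrt (1 - (c m)\<^sup>2)" for m
  have "(c m)\<^sup>2 \<le> 1" for m
    by (simp add: c_def power_le_one)
  then have cs: "(c m)\<^sup>2 + (s m)\<^sup>2 = 1" for m
    by (simp add: s_def)
  let ?P = "\<lambda>m H. H \<in> star_hom A operator_algebra \<and> (\<forall>i\<in>{1, 2, 3, 4}. \<forall>j\<in>{1, 2, 3, 4}.
      H (g i j) = block_matrix operator_algebra (proj 1 0) (proj (c m) (s m)) i j)"
  have "\<exists>H. ?P m H" for m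
    by (rule extend_to_aut_algebra[OF cstar_algebra_operator magic_projections[OF cs[of m]]]) blast
  from choice[OF allI[OF this]] obtain H where "\<forall>m. ?P m (H m)" ..
  then have H: "H m \<in> star_hom A operator_algebra"
    and Hg: "\<lbrakk>i \<in> {1, 2, 3, 4}; j \<in> {1, 2, 3, 4}\<rbrakk> \<Longrightarrow>
      H m (g i j) = block_matrix operator_algebra (proj 1 0) (proj (c m) (s m)) i j" for m i j
    by blast+
  define f where "f = g 1 1 \<otimes>\<^bsub>A\<^esub> g 3 3"
  have g11: "g 1 1 \<in> carrier A" and g33: "g 3 3 \<in> carrier A"
    by (rule g.x_closed; simp)+
  have f: "f \<in> carrier A"
    unfolding f_def by (rule A.m_closed[OF g11 g33])
  define a where "a = rec_nat \<one>\<^bsub>A\<^esub> (\<lambda>_ y. y \<otimes>\<^bsub>A\<^esub> f)"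
  have a0: "a 0 = \<one>\<^bsub>A\<^esub>" and a_Suc: "a (Suc n) = a n \<otimes>\<^bsub>A\<^esub> f" for n
    by (simp_all add: a_def)
  have a: "a n \<in> carrier A" for n
    by (induction n) (simp_all only: a0 a_Suc A.one_closed A.m_closed f)
  have Ha: "blinfun_apply (H m (a n)) (1, 0) = ((c m)\<^sup>2) ^ n *\<^sub>R (1, 0)" for m n
  proof (rule operator_power_apply)
    have "H m f = proj 1 0 \<otimes>\<^bsub>operator_algebra\<^esub> proj (c m) (s m)"
      unfolding f_def star_hom_mult[OF H g11 g33] by (simp only: Hg insert_iff simp_thms block_matrix_diag)
    then show "blinfun_apply (H m f) (1, 0) = (c m)\<^sup>2 *\<^sub>R (1, 0)"
      by (simp only: proj_mult_apply)
    show "H m (a 0) = id_blinfun"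
      unfolding a0 star_hom_one[OF H] operator_algebra_simps ..
    show "H m (a (Suc n)) = H m (a n) o\<^sub>L H m f" for n
      unfolding a_Suc star_hom_mult[OF H a f] operator_algebra_simps ..
  qed
  show ?thesis
  \<comment> \<open>The functionals are the upper left matrix coefficients of the representations
    \<open>H m\<close>; at the power \<open>a n\<close> the value is the \<open>n\<close>-th power
    of the squared cosine \<open>(c m)\<^sup>2\<close>.\<close>
  proof (rule A.not_finite_dimensionalI[of "\<lambda>m x. fst (blinfun_apply (H m x) (1, 0))" a "\<lambda>m. of_real ((c m)\<^sup>2)"])
    fix m x y assume x: "x \<in> carrier A"
    show "fst (blinfun_apply (H m (k \<odot>\<^bsub>A\<^esub> x)) (1, 0)) = k * fst (blinfun_apply (H m x) (1, 0))" for k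
      unfolding star_hom_smult[OF H x] operator_algebra_simps
      by (simp only: blinfun_apply_blinfun_compose Blinfun_cscale cscale_def fst_conv)
    assume y: "y \<in> carrier A"
    show "fst (blinfun_apply (H m (x \<oplus>\<^bsub>A\<^esub> y)) (1, 0)) =
        fst (blinfun_apply (H m x) (1, 0)) + fst (blinfun_apply (H m y) (1, 0))"
      unfolding star_hom_add[OF H x y] operator_algebra_simps by (simp only: blinfun_add_apply fst_add)
  next
    show "a n \<in> carrier A" for n by (rule a)
    show "fst (blinfun_apply (H m (a n)) (1, 0)) = of_real ((c m)\<^sup>2) ^ n" for m n
      unfolding Ha fst_scaleR by (simp only: fst_conv scaleR_conv_of_real mult_1_right of_real_power)
    show "inj (\<lambda>m. complex_of_real ((c m)\<^sup>2))"
    proof (rule injI)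
      fix m n assume "complex_of_real ((c m)\<^sup>2) = complex_of_real ((c n)\<^sup>2)"
      then have "(c m)\<^sup>2 = (c n)\<^sup>2" using of_real_eq_iff by blast
      then have "c m = c n"
        by (rule power2_eq_imp_eq) (simp_all add: c_def)
      then show "m = n" by (simp add: c_def)
    qed
  qed
qed

lemma spectrum: "Group.group (aut_spectrum G)" "aut_spectrum G \<cong> dihedral_group 4"
proof -
  have "h = k" if "h \<in> carrier (dihedral_group 4)" "k \<in> carrier (dihedral_group 4)"
    "\<forall>j\<in>{1, 2, 3, 4}. square_action h j = square_action k j" for h k
    using that(3) by (intro square_action_faithful[OF that(1,2)]) (simp_all only: ball_simps)
  note iso = aut_spectrum_iso[of "dihedral_group 4" square_action,
      OF group_dihedral_group square_action_perm square_action_mult square_action_one this square_action_full]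
  show "Group.group (aut_spectrum G)" "aut_spectrum G \<cong> dihedral_group 4"
    by (rule iso; simp)+
qed

end

theorem proposition3p3:
  fixes G :: "nat pair_pre_digraph"
  assumes "G = \<lparr>pverts = {1, 2, 3, 4}, parcs = {(1, 2), (2, 1), (3, 4), (4, 3)}\<rparr>"
  shows "cstar_algebra (aut_algebra G)
    \<and> noncommutative (aut_algebra G)
    \<and> \<not> finite_dimensional (aut_algebra G)
    \<and> Group.group (aut_spectrum G)
    \<and> aut_spectrum G \<cong> dihedral_group 4"
proof -
  interpret two_edges
    by (intro two_edges.intro involution_graph.intro square.finite_involution_axioms)
  show ?thesis
    unfolding assms G_eq[symmetric]
    by (intro conjI A.cstar_algebra_axioms noncommutative infinite_dimensional spectrum)
qed

end
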